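(* Fix $K\ge1$, a probability distribution $\pi$ on $[K]$, and a symmetric matrix $B^*\in\mathbb R_+^{K\times K}$ of rank $K$ with $\sum_{a=1}^K\sum_{b=1}^K\pi_a\pi_bB^*_{ab}=1$. Let $\alpha=\alpha_n$ satisfy $\alpha\to0$ and $\alpha>1/n$, and let $\theta^*=\alpha B^*\in[0,1]^{K\times K}$. For each $n$ let $z_1,\dots,z_n$ be i.i.d. with distribution $\pi$ and, conditionally on $z$, let $A\in\{0,1\}^{n\times n}$ be symmetric with zero diagonal and with independent entries $A_{ij}\sim\mathrm{Bernoulli}(\theta^*_{z_i,z_j})$ for $i<j$. Let $\hat\theta=\hat\alpha\hat B$ where $\hat\alpha=\frac{1}{n(n-1)}\sum_{i,j}A_{ij}$ and $\hat B\in\mathbb R_+^{K\times K}$ is a fixed matrix with positive entries such that $$\mathcal Q_{\hat B}(a,b)=\mathcal Q_{B^*}(a,b)\quad\text{for all }a,b\in[K],$$ $$B^*_{ab}\log\frac{\hat B_{ab}}{\hat B_{cd}}-(\hat B_{ab}-\hat B_{cd})>0\quad\text{for all }a,b\in[K]\text{ and }(c,d)\in[K]^2\setminus\mathcal Q_{B^*}(a,b),$$ where $\mathcal Q_B(a,b)=\{(c,d)\in[K]^2:B_{cd}=B_{ab}\}$. Let $\hat X$ be any solution of the semidefinite program in the context with data $A$ and parameter $\hat\theta$, and let $\hat P$ and $\tilde P$ be the MAP-type and randomized estimates built from $\hat X$ as in the context. Then $$\frac1{n^2}\sum_{i=1}^n\sum_{j=1}^n 1\{\hat P_{ij}\ne\hat\theta_{z_iz_j}\}=O_P\left(\frac{1}{\sqrt{n\alpha}}\right),$$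 and the same holds with $\hat P$ replaced by $\tilde P$.
   Context: Notation. $[m]=\{1,\dots,m\}$. For $M\in\mathbb R^{nK\times nK}$ and $i,j\in[n]$, $M^{(ij)}\in\mathbb R^{K\times K}$ is the $(i,j)$ block, $M^{(ij)}_{ab}=M_{a+(i-1)K,\,b+(j-1)K}$. $\langle M,N\rangle=\sum_{k,l}M_{kl}N_{kl}$. $X\succeq 0$ means symmetric positive semidefinite; $X\ge 0$ means entrywise nonnegative. Semidefinite program. Given $A$ and $\hat\theta$, let $F\in\mathbb R^{nK\times nK}$ have blocks $F^{(ij)}_{ab}=A_{ij}\log\hat\theta_{ab}+(1-A_{ij})\log(1-\hat\theta_{ab})$ for $i,j\in[n]$, $a,b\in[K]$. The program is: maximize $\langle F,X\rangle$ over $$\mathcal X=\Big\{X\in\mathbb R^{nK\times nK}: X\succeq 0,\ X\ge 0,\ \sum_{a=1}^K\sum_{b=1}^K X^{(ij)}_{ab}=1\ \text{ for all } i,j\in[n]\Big\}.$$ $\hat X$ denotes a maximizer (a function of $A$). On the event that some entry of $\hat\alpha\hat B$ is not in $(0,1)$ (where $F$ is undefined), the estimates may be defined arbitrarily. MAP-type estimate: $\hat P_{ij}\in\arg\max_{\vartheta\in[0,1]}\sum_{a=1}^K\sum_{b=1}^K\hat X^{(ij)}_{ab}\,1\{\hat\theta_{ab}=\vartheta\}$, ties broken arbitrarily. Randomized estimate: conditionally on $(A,z)$, the entries $\tilde P_{ij}$, $i\le j$, are independent, with $\tilde P_{ij}=\hat\theta_{ab}$ with probability $\hat X^{(ij)}_{ab}$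 (draw $(a,b)$ with probability $\hat X^{(ij)}_{ab}$ and set $\tilde P_{ij}=\hat\theta_{ab}$), and $\tilde P_{ji}=\tilde P_{ij}$. $U_n=O_P(r_n)$ means: for every $\epsilon>0$ there are $M,N$ with $\mathbb P(|U_n|>Mr_n)\le\epsilon$ for all $n\ge N$. *)

theory Defs
  imports "HOL-Probability.Probability"
begin

text \<open>
  Communities are the elements of a finite type \<open>'k\<close>, so \<open>K = CARD('k)\<close>. A matrix of size
  \<open>nK \<times> nK\<close> is a function on pairs of indices from \<open>{1..n} \<times> UNIV\<close>: the index \<open>(i, a)\<close>
  stands for \<open>a + (i - 1)K\<close>, so that \<open>M (i, a) (j, b)\<close> is the entry \<open>(a, b)\<close> of the block \<open>(i, j)\<close>.
  Values outside the index set are ignored.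
\<close>

type_synonym 'k bmat = "nat \<times> 'k \<Rightarrow> nat \<times> 'k \<Rightarrow> real"

definition bidx :: "nat \<Rightarrow> (nat \<times> 'k) set" where
  "bidx n = {1..n} \<times> UNIV"

definition binner :: "nat \<Rightarrow> 'k::finite bmat \<Rightarrow> 'k bmat \<Rightarrow> real" where
  "binner n M N = (\<Sum>p\<in>bidx n. \<Sum>q\<in>bidx n. M p q * N p q)"

definition bpsd :: "nat \<Rightarrow> 'k::finite bmat \<Rightarrow> bool" where
  "bpsd n X \<longleftrightarrow>
     (\<forall>p\<in>bidx n. \<forall>q\<in>bidx n. X p q = X q p) \<and>
     (\<forall>v :: nat \<times> 'k \<Rightarrow> real. (\<Sum>p\<in>bidx n. \<Sum>q\<in>bidx n. v p * X p q * v q) \<ge> 0)"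

definition sdp_feasible :: "nat \<Rightarrow> 'k::finite bmat \<Rightarrow> bool" where
  "sdp_feasible n X \<longleftrightarrow>
     bpsd n X \<and>
     (\<forall>p\<in>bidx n. \<forall>q\<in>bidx n. X p q \<ge> 0) \<and>
     (\<forall>i\<in>{1..n}. \<forall>j\<in>{1..n}. (\<Sum>a\<in>UNIV. \<Sum>b\<in>UNIV. X (i, a) (j, b)) = 1)"

text \<open>
  An adjacency matrix with entries in \<open>{0, 1}\<close> is a Boolean function of two vertices.
\<close>

type_synonym adj = "nat \<Rightarrow> nat \<Rightarrow> bool"

definition sdp_cost :: "adj \<Rightarrow> real^'k^'k \<Rightarrow> 'k::finite bmat" where
  "sdp_cost A \<theta> = (\<lambda>(i, a) (j, b).
     of_bool (A i j) * ln (\<theta> $ a $ b) + (1 - of_bool (A i j)) * ln (1 - \<theta> $ a $ b))"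

definition sdp_solution :: "nat \<Rightarrow> adj \<Rightarrow> real^'k^'k \<Rightarrow> 'k::finite bmat \<Rightarrow> bool" where
  "sdp_solution n A \<theta> X \<longleftrightarrow> is_arg_max (binner n (sdp_cost A \<theta>)) (sdp_feasible n) X"

text \<open>The case in which \<^const>\<open>sdp_cost\<close> is well defined.\<close>

definition in_unit_interior :: "real^'k^'k \<Rightarrow> bool" where
  "in_unit_interior \<theta> \<longleftrightarrow> (\<forall>a b. 0 < \<theta> $ a $ b \<and> \<theta> $ a $ b < 1)"

definition alpha_hat :: "nat \<Rightarrow> adj \<Rightarrow> real" where
  "alpha_hat n A = 1 / (real n * (real n - 1)) * (\<Sum>i\<in>{1..n}. \<Sum>j\<in>{1..n}. of_bool (A i j))"

definition theta_hat :: "nat \<Rightarrow> adj \<Rightarrow> real^'k^'k \<Rightarrow> real^'k^'k" where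
  "theta_hat n A Bhat = alpha_hat n A *\<^sub>R Bhat"

definition Qset :: "real^'k^'k \<Rightarrow> 'k \<Rightarrow> 'k \<Rightarrow> ('k \<times> 'k) set" where
  "Qset B a b = {(c, d). B $ c $ d = B $ a $ b}"

text \<open>
  \<open>uniform_measure M E\<close> is the measure \<open>M\<close> conditioned on the event \<open>E\<close>. The matrix \<open>A\<close> is
  padded by \<open>False\<close> outside \<open>{1..n} \<times> {1..n}\<close>, so that a function of \<open>A \<omega>\<close> is a function of
  the \<open>n \<times> n\<close> matrix alone.
\<close>

definition sbm ::
  "'w measure \<Rightarrow> nat \<Rightarrow> 'k::finite pmf \<Rightarrow> real^'k^'k \<Rightarrow> ('w \<Rightarrow> nat \<Rightarrow> 'k) \<Rightarrow> ('w \<Rightarrow> adj) \<Rightarrow> bool" where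
  "sbm M n \<pi> \<theta> z A \<longleftrightarrow>
     prob_space M \<and>
     prob_space.indep_vars M (\<lambda>_. count_space UNIV) (\<lambda>i \<omega>. z \<omega> i) {1..n} \<and>
     (\<forall>i\<in>{1..n}. distr M (count_space UNIV) (\<lambda>\<omega>. z \<omega> i) = measure_pmf \<pi>) \<and>
     (\<forall>i j. (\<lambda>\<omega>. A \<omega> i j) \<in> M \<rightarrow>\<^sub>M count_space UNIV) \<and>
     (\<forall>\<omega>\<in>space M. \<forall>i j. A \<omega> i j \<longrightarrow> i \<in> {1..n} \<and> j \<in> {1..n} \<and> i \<noteq> j \<and> A \<omega> j i) \<and>
     (\<forall>zz. let E = {\<omega>\<in>space M. \<forall>i\<in>{1..n}. z \<omega> i = zz i} in
        measure M E > 0 \<longrightarrow>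
          prob_space.indep_vars (uniform_measure M E) (\<lambda>_. count_space UNIV)
            (\<lambda>(i, j) \<omega>. A \<omega> i j) {(i, j). 1 \<le> i \<and> i < j \<and> j \<le> n} \<and>
          (\<forall>i j. 1 \<le> i \<and> i < j \<and> j \<le> n \<longrightarrow>
             distr (uniform_measure M E) (count_space UNIV) (\<lambda>\<omega>. A \<omega> i j)
               = measure_pmf (bernoulli_pmf (\<theta> $ zz i $ zz j))))"

definition map_estimate :: "nat \<Rightarrow> real^'k^'k \<Rightarrow> 'k::finite bmat \<Rightarrow> (nat \<Rightarrow> nat \<Rightarrow> real) \<Rightarrow> bool" where
  "map_estimate n \<theta> X P \<longleftrightarrow>
     (\<forall>i\<in>{1..n}. \<forall>j\<in>{1..n}.
        is_arg_max (\<lambda>t. \<Sum>a\<in>UNIV. \<Sum>b\<in>UNIV. X (i, a) (j, b) * of_bool (\<theta> $ a $ b = t))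
          (\<lambda>t. t \<in> {0..1}) (P i j))"

text \<open>
  In both estimators below \<open>Xhat\<close> maps an adjacency matrix to a block matrix, and nothing is required
  where \<^const>\<open>theta_hat\<close> leaves the open unit interval. Measurability is part of the
  definitions because \<^const>\<open>measure\<close> assigns zero to sets that are not measurable.
\<close>

definition is_map_estimator ::
  "'w measure \<Rightarrow> nat \<Rightarrow> real^'k^'k \<Rightarrow> (adj \<Rightarrow> 'k::finite bmat) \<Rightarrow> ('w \<Rightarrow> adj) \<Rightarrow>
   ('w \<Rightarrow> nat \<Rightarrow> nat \<Rightarrow> real) \<Rightarrow> bool" where
  "is_map_estimator M n Bhat Xhat A P \<longleftrightarrow>
     (\<forall>i\<in>{1..n}. \<forall>j\<in>{1..n}. (\<lambda>\<omega>. P \<omega> i j) \<in> borel_measurable M) \<and>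
     (\<forall>\<omega>\<in>space M. in_unit_interior (theta_hat n (A \<omega>) Bhat) \<longrightarrow>
        map_estimate n (theta_hat n (A \<omega>) Bhat) (Xhat (A \<omega>)) (P \<omega>))"

text \<open>
  Drawing \<open>(a, b)\<close> with probability \<open>X (i, a) (j, b)\<close> and returning \<open>\<theta> $ a $ b\<close> gives the value
  \<open>t\<close> with the total probability of the pairs \<open>(a, b)\<close> such that \<open>\<theta> $ a $ b = t\<close>.
\<close>

definition is_randomized_estimator ::
  "'w measure \<Rightarrow> nat \<Rightarrow> real^'k^'k \<Rightarrow> (adj \<Rightarrow> 'k::finite bmat) \<Rightarrow> ('w \<Rightarrow> nat \<Rightarrow> 'k) \<Rightarrow> ('w \<Rightarrow> adj) \<Rightarrow>
   ('w \<Rightarrow> nat \<Rightarrow> nat \<Rightarrow> real) \<Rightarrow> bool" where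
  "is_randomized_estimator M n Bhat Xhat z A P \<longleftrightarrow>
     (\<forall>i\<in>{1..n}. \<forall>j\<in>{1..n}. (\<lambda>\<omega>. P \<omega> i j) \<in> borel_measurable M) \<and>
     (\<forall>\<omega>\<in>space M. in_unit_interior (theta_hat n (A \<omega>) Bhat) \<longrightarrow>
        (\<forall>i\<in>{1..n}. \<forall>j\<in>{1..n}. P \<omega> j i = P \<omega> i j)) \<and>
     (\<forall>aa zz.
        let E = {\<omega>\<in>space M. A \<omega> = aa \<and> (\<forall>i\<in>{1..n}. z \<omega> i = zz i)};
            \<theta> = theta_hat n aa Bhat
        in measure M E > 0 \<and> in_unit_interior \<theta> \<longrightarrow>
          prob_space.indep_vars (uniform_measure M E) (\<lambda>_. borel)
            (\<lambda>(i, j) \<omega>. P \<omega> i j) {(i, j). 1 \<le> i \<and> i \<le> j \<and> j \<le> n} \<and>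
          (\<forall>i j t. 1 \<le> i \<and> i \<le> j \<and> j \<le> n \<longrightarrow>
             measure (uniform_measure M E) {\<omega>\<in>space M. P \<omega> i j = t}
               = (\<Sum>(a, b) | \<theta> $ a $ b = t. Xhat aa (i, a) (j, b))))"

definition error_rate :: "nat \<Rightarrow> real^'k^'k \<Rightarrow> (nat \<Rightarrow> 'k) \<Rightarrow> (nat \<Rightarrow> nat \<Rightarrow> real) \<Rightarrow> real" where
  "error_rate n \<theta> z P =
     1 / (real n)\<^sup>2 * (\<Sum>i\<in>{1..n}. \<Sum>j\<in>{1..n}. of_bool (P i j \<noteq> \<theta> $ z i $ z j))"

definition big_O_prob :: "(nat \<Rightarrow> 'w measure) \<Rightarrow> (nat \<Rightarrow> 'w \<Rightarrow> real) \<Rightarrow> (nat \<Rightarrow> real) \<Rightarrow> bool" where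
  "big_O_prob \<Omega> U r \<longleftrightarrow>
     (\<forall>\<epsilon>>0. \<exists>C::real. \<exists>N. \<forall>n\<ge>N. measure (\<Omega> n) {\<omega>\<in>space (\<Omega> n). \<bar>U n \<omega>\<bar> > C * r n} \<le> \<epsilon>)"

end

theory Submission
  imports Defs
begin

text \<open>
  The likelihood is compared at the solution \<open>X\<close> of the semidefinite program and at the block matrix of
  the true labels, which is feasible. Write \<open>W\<close> for the adjacency matrix minus its conditional mean given
  the labels, extended to the diagonal by the same formula. Replacing the edge indicators by their
  conditional means, each unit of weight that \<open>X\<close> places on a pair of classes with a wrong connection rate
  loses an expected log-likelihood of order \<open>\<alpha>\<close>, by the gap condition (\<open>log_gain_uniform\<close>). Optimality of
  \<open>X\<close> therefore bounds \<open>\<alpha>\<close> times this off-class mass by the contribution of \<open>W\<close> (\<open>off_mass_le\<close>).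

  The contribution of \<open>W\<close> is a bounded combination of sums \<open>\<Sum>i j. W i j * X (i, a) (j, b)\<close>. Since \<open>X\<close> is a
  Gram matrix of vectors in the unit ball, \<open>grothendieck_inequality\<close> bounds each sum by a constant times
  the \<open>\<infinity>\<close>-to-1 norm of \<open>W\<close>. That norm is a maximum over \<open>4 ^ n\<close> pairs of sign vectors, and a Chernoff
  bound with a union bound shows that it is of order \<open>n * sqrt (n * \<alpha>)\<close> with overwhelming probability
  (\<open>sbm_cut_tail\<close>). This holds even for bounded average degree, where the operator norm of \<open>W\<close> is
  too large because of vertices of high degree. Dividing by \<open>\<alpha>\<close> leaves an off-class mass of order
  \<open>n\<^sup>2 / sqrt (n * \<alpha>)\<close>.

  The gap condition concerns the true density, whereas the program uses the estimate \<open>alpha_hat\<close>. The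
  same norm bound together with the concentration of the class frequencies shows that the
  relative error of the estimate is small (\<open>alpha_hat_close\<close>) provided \<open>n * \<alpha>\<close> exceeds a constant; otherwise the claim
  holds trivially because error rates are at most 1.

  Finally, an entry of the MAP-type estimate can be wrong only if its block has off-class mass at least
  \<open>1 / 2\<close> (\<open>map_estimate_error_le\<close>), and an entry of the randomized estimate is wrong with conditional
  probability equal to the off-class mass of its block, so that Markov's inequality applies
  (\<open>randomized_error_tail\<close>).
\<close>

section \<open>Grothendieck's inequality\<close>

text \<open>
  The \<open>\<infinity>\<close>-to-1 norm of \<open>W\<close>, which is comparable to its cut norm, is at most \<open>c\<close>. One-sided
  sums suffice because \<open>s\<close> may be negated.
\<close>

definition cut_bound :: "'i set \<Rightarrow> 'j set \<Rightarrow> ('i \<Rightarrow> 'j \<Rightarrow> real) \<Rightarrow> real \<Rightarrow> bool" where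
  "cut_bound I J W c \<longleftrightarrow>
     (\<forall>s t. (\<forall>i. s i \<in> {-1, 1}) \<longrightarrow> (\<forall>j. t j \<in> {-1, 1}) \<longrightarrow>
        (\<Sum>i\<in>I. \<Sum>j\<in>J. W i j * (s i * t j)) \<le> c)"

lemma cut_bound_cong:
  assumes "\<And>i j. i \<in> I \<Longrightarrow> j \<in> J \<Longrightarrow> W i j = W' i j"
  shows "cut_bound I J W c = cut_bound I J W' c"
proof -
  have "(\<Sum>i\<in>I. \<Sum>j\<in>J. W i j * (s i * t j)) = (\<Sum>i\<in>I. \<Sum>j\<in>J. W' i j * (s i * t j))" for s t
    using assms by (intro sum.cong refl) auto
  then show ?thesis by (simp add: cut_bound_def)
qed

text \<open>
  A bilinear form on a product of cubes is largest at a pair of vertices: for fixed \<open>t\<close> the best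
  \<open>s\<close> is a sign vector, and then the same holds for \<open>t\<close>.
\<close>

lemma cut_bound_real:
  assumes cut: "cut_bound I J W c"
    and s: "\<And>i. i \<in> I \<Longrightarrow> \<bar>s i\<bar> \<le> 1" and t: "\<And>j. j \<in> J \<Longrightarrow> \<bar>t j\<bar> \<le> 1"
  shows "(\<Sum>i\<in>I. \<Sum>j\<in>J. W i j * (s i * t j)) \<le> c"
proof -
  define s' where "s' i = (if (\<Sum>j\<in>J. W i j * t j) \<ge> 0 then 1 else -1 :: real)" for i
  define t' where "t' j = (if (\<Sum>i\<in>I. W i j * s' i) \<ge> 0 then 1 else -1 :: real)" for j
  have bd: "x * y \<le> \<bar>y\<bar>" if "\<bar>x\<bar> \<le> 1" for x y :: real
  proof -
    have "x * y \<le> \<bar>x\<bar> * \<bar>y\<bar>" by (metis abs_ge_self abs_mult)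
    also have "\<dots> \<le> 1 * \<bar>y\<bar>" using that by (intro mult_right_mono) auto
    finally show ?thesis by simp
  qed
  have "(\<Sum>i\<in>I. \<Sum>j\<in>J. W i j * (s i * t j)) = (\<Sum>i\<in>I. s i * (\<Sum>j\<in>J. W i j * t j))"
    by (simp add: sum_distrib_left mult_ac)
  also have "\<dots> \<le> (\<Sum>i\<in>I. \<bar>\<Sum>j\<in>J. W i j * t j\<bar>)"
    using s by (intro sum_mono bd)
  also have "\<dots> = (\<Sum>i\<in>I. s' i * (\<Sum>j\<in>J. W i j * t j))"
    by (intro sum.cong) (auto simp: s'_def)
  also have "\<dots> = (\<Sum>i\<in>I. \<Sum>j\<in>J. t j * (W i j * s' i))"
    by (simp add: sum_distrib_left mult_ac)
  also have "\<dots> = (\<Sum>j\<in>J. t j * (\<Sum>i\<in>I. W i j * s' i))"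
    by (subst sum.swap) (simp add: sum_distrib_left)
  also have "\<dots> \<le> (\<Sum>j\<in>J. \<bar>\<Sum>i\<in>I. W i j * s' i\<bar>)"
    using t by (intro sum_mono bd)
  also have "\<dots> = (\<Sum>j\<in>J. t' j * (\<Sum>i\<in>I. W i j * s' i))"
    by (intro sum.cong) (auto simp: t'_def)
  also have "\<dots> = (\<Sum>j\<in>J. \<Sum>i\<in>I. W i j * (s' i * t' j))"
    by (simp add: sum_distrib_left mult_ac)
  also have "\<dots> = (\<Sum>i\<in>I. \<Sum>j\<in>J. W i j * (s' i * t' j))"
    by (rule sum.swap)
  also have "\<dots> \<le> c"
    using cut unfolding cut_bound_def by (auto simp: s'_def t'_def)
  finally show ?thesis .
qed

text \<open>
  A subset \<open>T\<close> of \<open>D\<close> encodes the sign vector that is positive exactly on \<open>T\<close>, so the average over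
  \<open>Pow D\<close> is the expectation for independent Rademacher signs.
\<close>

definition signed_sum :: "'d set \<Rightarrow> ('d \<Rightarrow> real) \<Rightarrow> 'd set \<Rightarrow> real" where
  "signed_sum D u T = (\<Sum>k\<in>D. if k \<in> T then u k else - u k)"

lemma sum_Pow_insert:
  assumes "finite D" "x \<notin> D"
  shows "(\<Sum>T\<in>Pow (insert x D). f T) = (\<Sum>T\<in>Pow D. f T + f (insert x T) :: real)"
proof -
  have "(\<Sum>T\<in>Pow (insert x D). f T) = (\<Sum>T\<in>Pow D. f T) + (\<Sum>T\<in>insert x ` Pow D. f T)"
    unfolding Pow_insert using assms by (intro sum.union_disjoint) auto
  also have "(\<Sum>T\<in>insert x ` Pow D. f T) = (\<Sum>T\<in>Pow D. f (insert x T))"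
    using assms by (subst sum.reindex) (auto simp: inj_on_def)
  finally show ?thesis by (simp add: sum.distrib)
qed

lemma signed_sum_insert:
  assumes "finite D" "x \<notin> D" "T \<subseteq> D"
  shows "signed_sum (insert x D) u T = signed_sum D u T - u x"
    and "signed_sum (insert x D) u (insert x T) = signed_sum D u T + u x"
proof -
  show "signed_sum (insert x D) u T = signed_sum D u T - u x"
    using assms by (auto simp: signed_sum_def)
  have "(\<Sum>k\<in>D. if k = x \<or> k \<in> T then u k else - u k) = (\<Sum>k\<in>D. if k \<in> T then u k else - u k)"
    using assms by (intro sum.cong) auto
  then show "signed_sum (insert x D) u (insert x T) = signed_sum D u T + u x"
    using assms by (simp add: signed_sum_def)
qed

lemma signed_sum_inner:
  assumes "finite D"
  shows "(\<Sum>T\<in>Pow D. signed_sum D u T * signed_sum D v T) = 2 ^ card D * (\<Sum>k\<in>D. u k * v k)"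
  using assms
proof (induction D rule: finite_induct)
  case empty
  then show ?case by (simp add: signed_sum_def)
next
  case (insert x D)
  have "(\<Sum>T\<in>Pow (insert x D). signed_sum (insert x D) u T * signed_sum (insert x D) v T)
    = (\<Sum>T\<in>Pow D. 2 * (signed_sum D u T * signed_sum D v T) + 2 * (u x * v x))"
    unfolding sum_Pow_insert[OF insert.hyps]
    using insert.hyps by (intro sum.cong refl) (simp add: signed_sum_insert algebra_simps)
  also have "\<dots> = 2 ^ card (insert x D) * (\<Sum>k\<in>insert x D. u k * v k)"
    using insert by (simp add: sum.distrib card_Pow algebra_simps flip: sum_distrib_left)
  finally show ?case .
qed

text \<open>
  Khintchine's inequality for the fourth moment, with the Gaussian constant 3. In the inductive step
  odd powers of the new sign cancel and
  \<open>3 S\<^sup>2 + 6 S x\<^sup>2 + x ^ 4 \<le> 3 (S + x\<^sup>2)\<^sup>2\<close>.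
\<close>

lemma signed_sum_fourth_moment:
  assumes "finite D"
  shows "(\<Sum>T\<in>Pow D. signed_sum D u T ^ 4) \<le> 3 * 2 ^ card D * (\<Sum>k\<in>D. (u k)\<^sup>2)\<^sup>2"
  using assms
proof (induction D rule: finite_induct)
  case empty
  then show ?case by (simp add: signed_sum_def)
next
  case (insert x D)
  define S where "S = (\<Sum>k\<in>D. (u k)\<^sup>2)"
  have two: "(\<Sum>T\<in>Pow D. (signed_sum D u T)\<^sup>2) = 2 ^ card D * S"
    using signed_sum_inner[OF insert.hyps(1), of u u] by (simp add: power2_eq_square S_def)
  have "(\<Sum>T\<in>Pow (insert x D). signed_sum (insert x D) u T ^ 4)
    = (\<Sum>T\<in>Pow D. 2 * signed_sum D u T ^ 4 + 12 * (u x)\<^sup>2 * (signed_sum D u T)\<^sup>2 + 2 * (u x) ^ 4)"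
    unfolding sum_Pow_insert[OF insert.hyps]
    using insert.hyps
    by (intro sum.cong refl) (simp add: signed_sum_insert power2_eq_square power4_eq_xxxx algebra_simps)
  also have "\<dots> = 2 * (\<Sum>T\<in>Pow D. signed_sum D u T ^ 4) + 12 * (u x)\<^sup>2 * (2 ^ card D * S)
      + 2 ^ card D * (2 * (u x) ^ 4)"
    using insert.hyps by (simp add: sum.distrib card_Pow two flip: sum_distrib_left)
  also have "\<dots> \<le> 2 * (3 * 2 ^ card D * S\<^sup>2) + 12 * (u x)\<^sup>2 * (2 ^ card D * S)
      + 2 ^ card D * (6 * (u x) ^ 4)"
    using insert.IH unfolding S_def[symmetric] by (intro add_mono mult_left_mono) auto
  also have "\<dots> = 3 * 2 ^ card (insert x D) * (S + (u x)\<^sup>2)\<^sup>2"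
    using insert.hyps by (simp add: power2_eq_square power4_eq_xxxx algebra_simps)
  also have "S + (u x)\<^sup>2 = (\<Sum>k\<in>insert x D. (u k)\<^sup>2)"
    using insert.hyps by (simp add: S_def)
  finally show ?case .
qed

definition clip :: "real \<Rightarrow> real" where
  "clip x = max (-2) (min 2 x)"

lemma abs_clip_le: "\<bar>clip x\<bar> \<le> 2" by (auto simp: clip_def)

lemma clip_sq_le: "(clip x)\<^sup>2 \<le> x\<^sup>2"
proof -
  have "\<bar>clip x\<bar> \<le> \<bar>x\<bar>" by (auto simp: clip_def)
  then show ?thesis by (simp add: abs_le_square_iff)
qed

text \<open>
  Beyond the threshold 2 the remainder is \<open>\<bar>x\<bar> - 2\<close>, and \<open>\<bar>x\<bar> - 2 \<le> x\<^sup>2 / 8\<close> because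
  \<open>(\<bar>x\<bar> - 4)\<^sup>2 \<ge> 0\<close>. Thus a fourth moment controls the variance of the remainder.
\<close>

lemma clip_remainder: "(x - clip x)\<^sup>2 \<le> x ^ 4 / 64"
proof -
  have sq: "0 \<le> (x - 4)\<^sup>2" "0 \<le> (x + 4)\<^sup>2" by simp_all
  have "\<bar>x - clip x\<bar> \<le> \<bar>x\<^sup>2 / 8\<bar>"
    using sq by (auto simp: clip_def power2_eq_square algebra_simps abs_if max_def min_def)
  then have "(x - clip x)\<^sup>2 \<le> (x\<^sup>2 / 8)\<^sup>2" by (simp only: abs_le_square_iff)
  then show ?thesis by (simp add: power2_eq_square power4_eq_xxxx)
qed

text \<open>
  Let \<open>S\<close> be the supremum of the left-hand side over all vector systems in the unit ball of all
  dimensions. Vectors \<open>u i\<close>, \<open>v j\<close> are replaced by the Rademacher sums \<open>X i\<close>, \<open>Y j\<close> with these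
  coefficients, whose covariances are the inner products, and each sum is clipped at 2:
  \<open>E (X Y) = E (clip X clip Y) + E ((X - clip X) Y) + E (clip X (Y - clip Y))\<close>.
  The first term contributes at most \<open>4 c\<close>, since for every outcome the clipped sums divided by 2 lie
  in \<open>{-1..1}\<close>. In each of the other two, the random variables are themselves vectors in a Euclidean
  space whose coordinates are the sign patterns; the remainder has norm at most \<open>1 / 4\<close>, so that term
  is at most \<open>S / 4\<close>. Hence \<open>S \<le> 4 c + S / 2\<close>. This gives the constant 8, which is far from optimal.
\<close>

theorem grothendieck_inequality:
  fixes W :: "'i \<Rightarrow> 'j \<Rightarrow> real" and u :: "'i \<Rightarrow> 'd \<Rightarrow> real" and v :: "'j \<Rightarrow> 'd \<Rightarrow> real"
  assumes fin: "finite I" "finite J" "finite D"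
    and cut: "cut_bound I J W c"
    and u: "\<And>i. i \<in> I \<Longrightarrow> (\<Sum>k\<in>D. (u i k)\<^sup>2) \<le> 1"
    and v: "\<And>j. j \<in> J \<Longrightarrow> (\<Sum>k\<in>D. (v j k)\<^sup>2) \<le> 1"
  shows "(\<Sum>i\<in>I. \<Sum>j\<in>J. W i j * (\<Sum>k\<in>D. u i k * v j k)) \<le> 8 * c"
proof -
  define V where "V = {x. \<exists>(N::nat) f g. (\<forall>i\<in>I. (\<Sum>k<N. (f i k)\<^sup>2) \<le> (1::real)) \<and>
      (\<forall>j\<in>J. (\<Sum>k<N. (g j k)\<^sup>2) \<le> (1::real)) \<and>
      x = (\<Sum>i\<in>I. \<Sum>j\<in>J. W i j * (\<Sum>k<N. f i k * g j k))}"
  define S where "S = Sup V"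
  have bdd: "bdd_above V"
  proof (rule bdd_aboveI)
    fix x assume "x \<in> V"
    then obtain N :: nat and f g where fg: "\<And>i. i \<in> I \<Longrightarrow> (\<Sum>k<N. (f i k)\<^sup>2) \<le> (1::real)"
      "\<And>j. j \<in> J \<Longrightarrow> (\<Sum>k<N. (g j k)\<^sup>2) \<le> (1::real)"
      and x: "x = (\<Sum>i\<in>I. \<Sum>j\<in>J. W i j * (\<Sum>k<N. f i k * g j k))"
      unfolding V_def by blast
    have "W i j * (\<Sum>k<N. f i k * g j k) \<le> \<bar>W i j\<bar>" if ij: "i \<in> I" "j \<in> J" for i j
    proof -
      have "\<bar>\<Sum>k<N. f i k * g j k\<bar> \<le> (\<Sum>k<N. ((f i k)\<^sup>2 + (g j k)\<^sup>2) / 2)"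
      proof (rule order_trans[OF sum_abs sum_mono])
        fix k
        have "0 \<le> (f i k - g j k)\<^sup>2" "0 \<le> (f i k + g j k)\<^sup>2" by simp_all
        then show "\<bar>f i k * g j k\<bar> \<le> ((f i k)\<^sup>2 + (g j k)\<^sup>2) / 2"
          by (simp add: power2_eq_square algebra_simps abs_if)
      qed
      also have "\<dots> \<le> 1"
        using fg(1)[OF ij(1)] fg(2)[OF ij(2)] by (simp add: sum.distrib flip: sum_divide_distrib)
      finally have "\<bar>W i j\<bar> * \<bar>\<Sum>k<N. f i k * g j k\<bar> \<le> \<bar>W i j\<bar>"
        by (simp add: mult_left_le)
      then show ?thesis by (metis abs_ge_self abs_mult order_trans)
    qed
    then show "x \<le> (\<Sum>i\<in>I. \<Sum>j\<in>J. \<bar>W i j\<bar>)"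
      unfolding x by (intro sum_mono) auto
  qed
  \<comment> \<open>Vectors indexed by any finite set compete in the supremum; below the index set consists of
    sign patterns.\<close>
  have below_S: "(\<Sum>i\<in>I. \<Sum>j\<in>J. W i j * (\<Sum>k\<in>E. f i k * g j k)) \<le> S"
    if E: "finite E" and f: "\<And>i. i \<in> I \<Longrightarrow> (\<Sum>k\<in>E. (f i k)\<^sup>2) \<le> 1"
      and g: "\<And>j. j \<in> J \<Longrightarrow> (\<Sum>k\<in>E. (g j k)\<^sup>2) \<le> 1"
    for E :: "'e set" and f g
  proof -
    obtain h where h: "bij_betw h {..<card E} E"
      using ex_bij_betw_nat_finite[OF E] atLeast0LessThan by metis
    have re: "(\<Sum>k\<in>E. F k) = (\<Sum>k<card E. F (h k))" for F :: "'e \<Rightarrow> real"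
      using sum.reindex_bij_betw[OF h, of F] by simp
    have "(\<Sum>i\<in>I. \<Sum>j\<in>J. W i j * (\<Sum>k\<in>E. f i k * g j k)) \<in> V"
      unfolding V_def mem_Collect_eq
      by (rule exI[of _ "card E"], rule exI[of _ "\<lambda>i k. f i (h k)"], rule exI[of _ "\<lambda>j k. g j (h k)"])
        (use f g in \<open>auto simp: re\<close>)
    then show ?thesis unfolding S_def using bdd by (rule cSup_upper)
  qed
  have step: "x \<le> 4 * c + S / 2" if "x \<in> V" for x
  proof -
    obtain N :: nat and f g where f: "\<And>i. i \<in> I \<Longrightarrow> (\<Sum>k<N. (f i k)\<^sup>2) \<le> (1::real)"
      and g: "\<And>j. j \<in> J \<Longrightarrow> (\<Sum>k<N. (g j k)\<^sup>2) \<le> (1::real)"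
      and x: "x = (\<Sum>i\<in>I. \<Sum>j\<in>J. W i j * (\<Sum>k<N. f i k * g j k))"
      using \<open>x \<in> V\<close> unfolding V_def by blast
    define m where "m = (2::real) ^ N"
    have m: "m > 0" by (simp add: m_def)
    define P where "P = Pow {..<N}"
    have P: "finite P" "card P = 2 ^ N" by (auto simp: P_def card_Pow)
    define X where "X i = signed_sum {..<N} (f i)" for i
    define Y where "Y j = signed_sum {..<N} (g j)" for j
    \<comment> \<open>The factor \<open>1 / sqrt m\<close> turns the average over the \<open>m\<close> sign patterns into a plain sum of squares.\<close>
    have var: "(\<Sum>T\<in>P. (signed_sum {..<N} w T / sqrt m)\<^sup>2) \<le> 1"
      if "(\<Sum>k<N. (w k)\<^sup>2) \<le> 1" for w :: "nat \<Rightarrow> real"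
      using signed_sum_inner[of "{..<N}" w w] that m
      by (simp add: P_def m_def power_divide power2_eq_square flip: sum_divide_distrib)
    have var_clip: "(\<Sum>T\<in>P. (clip (signed_sum {..<N} w T) / sqrt m)\<^sup>2) \<le> 1"
      if "(\<Sum>k<N. (w k)\<^sup>2) \<le> 1" for w :: "nat \<Rightarrow> real"
    proof -
      have "(\<Sum>T\<in>P. (clip (signed_sum {..<N} w T) / sqrt m)\<^sup>2)
          \<le> (\<Sum>T\<in>P. (signed_sum {..<N} w T / sqrt m)\<^sup>2)"
        using m by (intro sum_mono) (simp add: power_divide divide_right_mono clip_sq_le)
      with var[OF that] show ?thesis by linarith
    qed
    have var_rem: "(\<Sum>T\<in>P. (4 * (signed_sum {..<N} w T - clip (signed_sum {..<N} w T)) / sqrt m)\<^sup>2) \<le> 1"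
      if "(\<Sum>k<N. (w k)\<^sup>2) \<le> 1" for w :: "nat \<Rightarrow> real"
    proof -
      have "(\<Sum>T\<in>P. (4 * (signed_sum {..<N} w T - clip (signed_sum {..<N} w T)) / sqrt m)\<^sup>2)
        \<le> (\<Sum>T\<in>P. (signed_sum {..<N} w T ^ 4 / 4) / m)"
      proof (rule sum_mono)
        fix T
        have "(4 * (signed_sum {..<N} w T - clip (signed_sum {..<N} w T)))\<^sup>2 \<le> signed_sum {..<N} w T ^ 4 / 4"
          using clip_remainder[of "signed_sum {..<N} w T"] by (simp only: power_mult_distrib) simp
        then show "(4 * (signed_sum {..<N} w T - clip (signed_sum {..<N} w T)) / sqrt m)\<^sup>2
           \<le> (signed_sum {..<N} w T ^ 4 / 4) / m"
          using m divide_right_mono[of _ _ m] by (auto simp only: power_divide real_sqrt_pow2 less_imp_le)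
      qed
      also have "\<dots> = (\<Sum>T\<in>P. signed_sum {..<N} w T ^ 4) / (4 * m)"
        by (simp flip: sum_divide_distrib)
      also have "\<dots> \<le> (3 * m * (\<Sum>k<N. (w k)\<^sup>2)\<^sup>2) / (4 * m)"
        using signed_sum_fourth_moment[of "{..<N}" w] m
        by (intro divide_right_mono) (auto simp: P_def m_def)
      also have "\<dots> \<le> 1"
      proof -
        have "(\<Sum>k<N. (w k)\<^sup>2)\<^sup>2 \<le> 1\<^sup>2"
          using that by (intro power_mono) (auto intro: sum_nonneg)
        then show ?thesis using m by simp
      qed
      finally show ?thesis .
    qed
    have split: "m * (\<Sum>k<N. f i k * g j k) =
        (\<Sum>T\<in>P. clip (X i T) * clip (Y j T))
        + m / 4 * (\<Sum>T\<in>P. (4 * (X i T - clip (X i T)) / sqrt m) * (Y j T / sqrt m))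
        + m / 4 * (\<Sum>T\<in>P. (clip (X i T) / sqrt m) * (4 * (Y j T - clip (Y j T)) / sqrt m))" for i j
    proof -
      have "m * (\<Sum>k<N. f i k * g j k) = (\<Sum>T\<in>P. X i T * Y j T)"
        using signed_sum_inner[of "{..<N}" "f i" "g j"] by (simp add: m_def P_def X_def Y_def)
      also have "\<dots> = (\<Sum>T\<in>P. clip (X i T) * clip (Y j T)
         + m / 4 * ((4 * (X i T - clip (X i T)) / sqrt m) * (Y j T / sqrt m))
         + m / 4 * ((clip (X i T) / sqrt m) * (4 * (Y j T - clip (Y j T)) / sqrt m)))"
        using m by (intro sum.cong refl) (simp add: field_simps)
      finally show ?thesis by (simp add: sum.distrib sum_distrib_left)
    qed
    have vars:
      "\<And>i. i \<in> I \<Longrightarrow> (\<Sum>T\<in>P. (clip (X i T) / sqrt m)\<^sup>2) \<le> 1"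
      "\<And>i. i \<in> I \<Longrightarrow> (\<Sum>T\<in>P. (4 * (X i T - clip (X i T)) / sqrt m)\<^sup>2) \<le> 1"
      "\<And>j. j \<in> J \<Longrightarrow> (\<Sum>T\<in>P. (Y j T / sqrt m)\<^sup>2) \<le> 1"
      "\<And>j. j \<in> J \<Longrightarrow> (\<Sum>T\<in>P. (4 * (Y j T - clip (Y j T)) / sqrt m)\<^sup>2) \<le> 1"
      unfolding X_def Y_def by (intro var var_clip var_rem f g; assumption)+
    have "m * x = (\<Sum>i\<in>I. \<Sum>j\<in>J. W i j * (m * (\<Sum>k<N. f i k * g j k)))"
      unfolding x by (simp add: sum_distrib_left mult_ac)
    also have "\<dots> = (\<Sum>i\<in>I. \<Sum>j\<in>J. \<Sum>T\<in>P. W i j * (clip (X i T) * clip (Y j T)))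
       + m / 4 * (\<Sum>i\<in>I. \<Sum>j\<in>J. W i j * (\<Sum>T\<in>P. (4 * (X i T - clip (X i T)) / sqrt m) * (Y j T / sqrt m)))
       + m / 4 * (\<Sum>i\<in>I. \<Sum>j\<in>J. W i j * (\<Sum>T\<in>P. (clip (X i T) / sqrt m) * (4 * (Y j T - clip (Y j T)) / sqrt m)))"
      unfolding split by (simp add: ring_distribs sum.distrib sum_distrib_left mult_ac)
    also have "\<dots> \<le> m * (4 * c) + m / 4 * S + m / 4 * S"
    proof (intro add_mono mult_left_mono below_S vars)
      have "(\<Sum>i\<in>I. \<Sum>j\<in>J. \<Sum>T\<in>P. W i j * (clip (X i T) * clip (Y j T)))
        = (\<Sum>T\<in>P. \<Sum>i\<in>I. \<Sum>j\<in>J. W i j * (clip (X i T) * clip (Y j T)))"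
        by (simp only: sum.swap[where A = J and B = P] sum.swap[where A = I and B = P])
      also have "\<dots> = (\<Sum>T\<in>P. 4 * (\<Sum>i\<in>I. \<Sum>j\<in>J. W i j * ((clip (X i T) / 2) * (clip (Y j T) / 2))))"
        by (simp add: sum_distrib_left)
      also have "\<dots> \<le> (\<Sum>T\<in>P. 4 * c)"
        using abs_clip_le by (intro sum_mono mult_left_mono cut_bound_real[OF cut]) auto
      also have "\<dots> = m * (4 * c)" using P by (simp add: m_def)
      finally show "(\<Sum>i\<in>I. \<Sum>j\<in>J. \<Sum>T\<in>P. W i j * (clip (X i T) * clip (Y j T))) \<le> m * (4 * c)" .
    qed (use P m in auto)
    finally have "m * x \<le> m * (4 * c + S / 2)" by (simp add: algebra_simps)
    then show ?thesis using m by simp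
  qed
  have "V \<noteq> {}" unfolding V_def by (auto intro!: exI[of _ "0::nat"])
  then have "S \<le> 4 * c + S / 2" unfolding S_def[symmetric] 
    using step by (subst (1) S_def) (intro cSup_least)
  then have "S \<le> 8 * c" by simp
  moreover have "(\<Sum>i\<in>I. \<Sum>j\<in>J. W i j * (\<Sum>k\<in>D. u i k * v j k)) \<le> S"
    using fin(3) u v by (rule below_S)
  ultimately show ?thesis by simp
qed

section \<open>Feasible matrices of the semidefinite program\<close>

text \<open>
  Cholesky factorization by induction on the index set. A new index \<open>r\<close> is eliminated by passing to
  the Schur complement, which stays positive semidefinite: the value of its quadratic form at \<open>v\<close> is
  the value of the full form at the extension of \<open>v\<close> that is minimal over the coordinate \<open>r\<close>.
\<close>

lemma gram_factorization:
  fixes X :: "'p \<Rightarrow> 'p \<Rightarrow> real"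
  assumes "finite P"
    and "\<And>p q. p \<in> P \<Longrightarrow> q \<in> P \<Longrightarrow> X p q = X q p"
    and "\<And>v. 0 \<le> (\<Sum>p\<in>P. \<Sum>q\<in>P. v p * X p q * v q)"
  shows "\<exists>u. \<forall>p\<in>P. \<forall>q\<in>P. X p q = (\<Sum>k\<in>P. u p k * u q k)"
  using assms
proof (induction P arbitrary: X rule: finite_induct)
  case empty
  then show ?case by simp
next
  case (insert r P)
  note sym = insert.prems(1) and psd = insert.prems(2)
  have symr: "X p r = X r p" if "p \<in> P" for p using sym that by blast
  have form: "(\<Sum>p\<in>insert r P. \<Sum>q\<in>insert r P. v p * X p q * v q)
    = (v r)\<^sup>2 * X r r + 2 * v r * (\<Sum>p\<in>P. v p * X r p) + (\<Sum>p\<in>P. \<Sum>q\<in>P. v p * X p q * v q)" for v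
  proof -
    have "(\<Sum>p\<in>P. v p * X p r * v r) = v r * (\<Sum>p\<in>P. v p * X r p)"
      unfolding sum_distrib_left using symr by (intro sum.cong) (auto simp: mult_ac)
    moreover have "(\<Sum>p\<in>P. v r * X r p * v p) = v r * (\<Sum>p\<in>P. v p * X r p)"
      unfolding sum_distrib_left by (intro sum.cong) (auto simp: mult_ac)
    ultimately show ?thesis
      using insert.hyps by (simp add: sum.distrib power2_eq_square)
  qed
  have fun_eq: "(\<Sum>p\<in>P. (f(r := t)) p * g p) = (\<Sum>p\<in>P. f p * g p)" for f g :: "'p \<Rightarrow> real" and t
    using insert.hyps by (intro sum.cong) auto
  have fun_eq2: "(\<Sum>p\<in>P. \<Sum>q\<in>P. (f(r := t)) p * X p q * (f(r := t)) q)
      = (\<Sum>p\<in>P. \<Sum>q\<in>P. f p * X p q * f q)" for f t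
    using insert.hyps by (intro sum.cong) auto
  have diag: "X r r \<ge> 0"
    using psd[of "(\<lambda>_. 0)(r := 1)"] unfolding form fun_eq fun_eq2 by simp
  have zero: "X r q = 0" if "X r r = 0" "q \<in> P" for q
  proof (rule ccontr)
    assume nz: "X r q \<noteq> 0"
    define t where "t = - (X q q + 1) / (2 * X r q)"
    define e where "e p = (if p = q then 1 else 0 :: real)" for p
    have "(\<Sum>p\<in>P. e p * X r p) = X r q" "(\<Sum>p\<in>P. \<Sum>p'\<in>P. e p * X p p' * e p') = X q q"
      using \<open>q \<in> P\<close> insert.hyps by (auto simp: e_def if_distrib[of "\<lambda>x. x * _"] if_distrib[of "\<lambda>x. _ * x"] cong: if_cong)
    then have "0 \<le> 2 * t * X r q + X q q"
      using psd[of "e(r := t)"] \<open>X r r = 0\<close> unfolding form fun_eq fun_eq2 by simp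
    moreover have "2 * t * X r q = - (X q q + 1)" using nz by (simp add: t_def)
    ultimately show False by simp
  qed
  \<comment> \<open>If \<open>X r r = 0\<close> then the division by zero makes \<open>Y = X\<close>, which is correct because the whole
    row \<open>r\<close> vanishes.\<close>
  define Y where "Y p q = X p q - X p r * X r q / X r r" for p q
  have "\<exists>u. \<forall>p\<in>P. \<forall>q\<in>P. Y p q = (\<Sum>k\<in>P. u p k * u q k)"
  proof (rule insert.IH)
    show "Y p q = Y q p" if "p \<in> P" "q \<in> P" for p q
      using that sym[of p q] symr[of p] symr[of q] by (simp add: Y_def)
    fix v :: "'p \<Rightarrow> real"
    define w where "w = (\<Sum>p\<in>P. v p * X r p)"
    have "0 \<le> (w / X r r)\<^sup>2 * X r r + 2 * (- w / X r r) * w + (\<Sum>p\<in>P. \<Sum>q\<in>P. v p * X p q * v q)"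
      using psd[of "v(r := - w / X r r)"] unfolding form fun_eq fun_eq2 by (simp add: w_def)
    also have "(w / X r r)\<^sup>2 * X r r + 2 * (- w / X r r) * w = - (w * w / X r r)"
      by (cases "X r r = 0") (auto simp: power2_eq_square)
    also have "w * w / X r r = (\<Sum>p\<in>P. \<Sum>q\<in>P. v p * (X p r * X r q / X r r) * v q)"
      unfolding w_def sum_product sum_divide_distrib using symr
      by (intro sum.cong refl) (simp add: mult_ac)
    finally show "0 \<le> (\<Sum>p\<in>P. \<Sum>q\<in>P. v p * Y p q * v q)"
      by (simp add: Y_def algebra_simps sum_subtractf)
  qed
  then obtain u where u: "\<And>p q. p \<in> P \<Longrightarrow> q \<in> P \<Longrightarrow> Y p q = (\<Sum>k\<in>P. u p k * u q k)" by blast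
  define u' where "u' p k = (if k = r then X p r / sqrt (X r r) else if p = r then 0 else u p k)" for p k
  have "X p q = (\<Sum>k\<in>insert r P. u' p k * u' q k)" if pq: "p \<in> insert r P" "q \<in> insert r P" for p q
  proof -
    have "(\<Sum>k\<in>insert r P. u' p k * u' q k) = X p r * X q r / X r r
       + (\<Sum>k\<in>P. if p = r \<or> q = r then 0 else u p k * u q k)"
      using insert.hyps diag by (auto simp: u'_def intro!: sum.cong)
    also have "\<dots> = X p r * X q r / X r r + (if p = r \<or> q = r then 0 else Y p q)"
      using pq u by auto
    also have "\<dots> = X p q"
      using pq zero symr by (cases "X r r = 0") (auto simp: Y_def)
    finally show ?thesis by simp
  qed
  then show ?case by blast
qed

lemma cut_bound_uminus:
  assumes "cut_bound I J W c"
  shows "cut_bound I J (\<lambda>i j. - W i j) c"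
  unfolding cut_bound_def
proof (intro allI impI)
  fix s :: "'a \<Rightarrow> real" and t :: "'b \<Rightarrow> real"
  assume st: "\<forall>i. s i \<in> {-1, 1}" "\<forall>j. t j \<in> {-1, 1}"
  have "\<bar>- s i\<bar> \<le> 1" "\<bar>t j\<bar> \<le> 1" for i j
    using st(1)[rule_format, of i] st(2)[rule_format, of j] by auto
  then have "(\<Sum>i\<in>I. \<Sum>j\<in>J. W i j * (- s i * t j)) \<le> c"
    by (intro cut_bound_real[OF assms])
  then show "(\<Sum>i\<in>I. \<Sum>j\<in>J. - W i j * (s i * t j)) \<le> c" by simp
qed

lemma feasible_block_nonneg:
  assumes "sdp_feasible n X" "i \<in> {1..n}" "j \<in> {1..n}"
  shows "X (i, a) (j, b) \<ge> 0"
  using assms by (auto simp: sdp_feasible_def bidx_def)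

lemma feasible_block_sum:
  assumes "sdp_feasible n X" "i \<in> {1..n}" "j \<in> {1..n}"
  shows "(\<Sum>a\<in>UNIV. \<Sum>b\<in>UNIV. X (i, a) (j, b)) = 1"
  using assms by (auto simp: sdp_feasible_def)

text \<open>
  This is where Grothendieck's inequality meets the program: a feasible matrix is a Gram matrix, and
  its diagonal entries are at most 1 because they are among the nonnegative entries of a block with sum 1.
\<close>

lemma feasible_cut_le:
  fixes X :: "'k::finite bmat"
  assumes X: "sdp_feasible n X" and cut: "cut_bound {1..n} {1..n} W c"
  shows "(\<Sum>i\<in>{1..n}. \<Sum>j\<in>{1..n}. W i j * X (i, a) (j, b)) \<le> 8 * c"
proof -
  define P :: "(nat \<times> 'k) set" where "P = bidx n"
  have P: "finite P" by (simp add: P_def bidx_def)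
  have "\<exists>u. \<forall>p\<in>P. \<forall>q\<in>P. X p q = (\<Sum>k\<in>P. u p k * u q k)"
    using X P by (intro gram_factorization) (auto simp: P_def sdp_feasible_def bpsd_def)
  then obtain u where u: "\<And>p q. p \<in> P \<Longrightarrow> q \<in> P \<Longrightarrow> X p q = (\<Sum>k\<in>P. u p k * u q k)" by blast
  have mem: "(i, e) \<in> P" if "i \<in> {1..n}" for i e using that by (simp add: P_def bidx_def)
  have norm: "(\<Sum>k\<in>P. (u (i, e) k)\<^sup>2) \<le> 1" if i: "i \<in> {1..n}" for i e
  proof -
    have "(\<Sum>k\<in>P. (u (i, e) k)\<^sup>2) = X (i, e) (i, e)"
      using u[OF mem[OF i] mem[OF i]] by (simp add: power2_eq_square)
    also have "\<dots> \<le> (\<Sum>b\<in>UNIV. X (i, e) (i, b))"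
      using feasible_block_nonneg[OF X i i] by (intro member_le_sum) auto
    also have "\<dots> \<le> (\<Sum>a\<in>UNIV. \<Sum>b\<in>UNIV. X (i, a) (i, b))"
      using feasible_block_nonneg[OF X i i]
      by (intro member_le_sum[where f = "\<lambda>a. \<Sum>b\<in>UNIV. X (i, a) (i, b)"]) (auto intro: sum_nonneg)
    also have "\<dots> = 1" by (rule feasible_block_sum[OF X i i])
    finally show ?thesis .
  qed
  have "(\<Sum>i\<in>{1..n}. \<Sum>j\<in>{1..n}. W i j * X (i, a) (j, b))
     = (\<Sum>i\<in>{1..n}. \<Sum>j\<in>{1..n}. W i j * (\<Sum>k\<in>P. u (i, a) k * u (j, b) k))"
    by (intro sum.cong refl) (simp only: u mem)
  also have "\<dots> \<le> 8 * c"
    using P cut norm by (intro grothendieck_inequality[where D = P]) auto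
  finally show ?thesis .
qed

lemma feasible_cut_abs_le:
  fixes X :: "'k::finite bmat"
  assumes X: "sdp_feasible n X" and cut: "cut_bound {1..n} {1..n} W c"
  shows "\<bar>\<Sum>i\<in>{1..n}. \<Sum>j\<in>{1..n}. W i j * X (i, a) (j, b)\<bar> \<le> 8 * c"
  using feasible_cut_le[OF X cut, of a b] feasible_cut_le[OF X cut_bound_uminus[OF cut], of a b]
  by (simp add: sum_negf)

definition membership_matrix :: "(nat \<Rightarrow> 'k) \<Rightarrow> 'k bmat" where
  "membership_matrix zz = (\<lambda>(i, a) (j, b). of_bool (zz i = a) * of_bool (zz j = b))"

lemma membership_block_sum:
  fixes zz :: "nat \<Rightarrow> 'k::finite"
  shows "(\<Sum>a\<in>UNIV. \<Sum>b\<in>UNIV. G a b * membership_matrix zz (i, a) (j, b)) = (G (zz i) (zz j) :: real)"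
proof -
  have "(\<Sum>a\<in>UNIV. \<Sum>b\<in>UNIV. G a b * membership_matrix zz (i, a) (j, b))
    = (\<Sum>a\<in>UNIV. \<Sum>b\<in>UNIV. if zz j = b then (if zz i = a then G a b else 0) else 0)"
    by (intro sum.cong refl) (simp add: membership_matrix_def)
  then show ?thesis by simp
qed

lemma membership_matrix_feasible:
  fixes zz :: "nat \<Rightarrow> 'k::finite"
  shows "sdp_feasible n (membership_matrix zz)"
proof -
  define y where "y p = (of_bool (zz (fst p) = snd p) :: real)" for p
  have Z: "membership_matrix zz p q = y p * y q" for p q
    by (cases p; cases q) (simp add: membership_matrix_def y_def)
  have "(\<Sum>p\<in>bidx n. \<Sum>q\<in>bidx n. v p * (y p * y q) * v q) = (\<Sum>p\<in>bidx n. v p * y p)\<^sup>2"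
    for v :: "nat \<times> 'k \<Rightarrow> real"
    by (simp add: power2_eq_square sum_product mult_ac)
  then have "bpsd n (membership_matrix zz)"
    by (simp add: bpsd_def Z)
  moreover have "(\<Sum>a\<in>UNIV. \<Sum>b\<in>UNIV. membership_matrix zz (i, a) (j, b)) = 1" for i j
    using membership_block_sum[of "\<lambda>_ _. 1" zz] by simp
  moreover have "0 \<le> membership_matrix zz p q" for p q
    by (simp add: Z y_def)
  ultimately show ?thesis by (simp add: sdp_feasible_def)
qed

lemma binner_blocks:
  "binner n F X = (\<Sum>i\<in>{1..n}. \<Sum>j\<in>{1..n}. \<Sum>a\<in>UNIV. \<Sum>b\<in>UNIV. F (i, a) (j, b) * X (i, a) (j, b))"
proof -
  have "binner n F X = (\<Sum>i\<in>{1..n}. \<Sum>a\<in>UNIV. \<Sum>j\<in>{1..n}. \<Sum>b\<in>UNIV. F (i, a) (j, b) * X (i, a) (j, b))"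
    by (simp add: binner_def bidx_def sum.cartesian_product')
  also have "\<dots> = (\<Sum>i\<in>{1..n}. \<Sum>j\<in>{1..n}. \<Sum>a\<in>UNIV. \<Sum>b\<in>UNIV. F (i, a) (j, b) * X (i, a) (j, b))"
    by (intro sum.cong refl sum.swap)
  finally show ?thesis .
qed

section \<open>Optimality of the solution against the true membership matrix\<close>

text \<open>
  The total weight that \<open>X\<close> puts on pairs of classes whose connection rate differs from the rate of
  the true pair of classes.
\<close>

definition off_mass :: "nat \<Rightarrow> real^'k^'k \<Rightarrow> (nat \<Rightarrow> 'k) \<Rightarrow> 'k::finite bmat \<Rightarrow> real" where
  "off_mass n B zz X = (\<Sum>i\<in>{1..n}. \<Sum>j\<in>{1..n}.
     \<Sum>a\<in>UNIV. \<Sum>b\<in>UNIV. of_bool ((a, b) \<notin> Qset B (zz i) (zz j)) * X (i, a) (j, b))"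

text \<open>
  The expected log-likelihood ratio of \<open>\<theta> $ a $ b\<close> against \<open>\<theta> $ c $ d\<close> for one edge that is present
  with probability \<open>p $ a $ b\<close>.
\<close>

definition log_gain :: "real^'k^'k \<Rightarrow> real^'k^'k \<Rightarrow> 'k \<Rightarrow> 'k \<Rightarrow> 'k \<Rightarrow> 'k \<Rightarrow> real" where
  "log_gain p \<theta> a b c d =
     p $ a $ b * (ln (\<theta> $ a $ b) - ln (\<theta> $ c $ d))
     + (1 - p $ a $ b) * (ln (1 - \<theta> $ a $ b) - ln (1 - \<theta> $ c $ d))"

text \<open>
  The true membership matrix is feasible, so the objective at the solution \<open>X\<close> is at least as large.
  Splitting the edge indicators into their means and centred noise turns this into: the expected loss
  of \<open>X\<close>, which is at least \<open>g\<close> per unit of off-class mass, is at most the noise term.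

  In the noise term the coefficients are log-odds of \<open>\<theta>\<close>, which are unbounded as the graph gets sparse.
  Every block of \<open>X\<close> and of the membership matrix sums to 1, so a common constant \<open>h\<close> may be subtracted
  from all log-odds; only the bound \<open>D\<close> on the differences matters. For each of the \<open>CARD('k)\<^sup>2\<close> pairs of
  classes both matrices cost \<open>8 * c\<close> by Grothendieck's inequality.
\<close>

lemma off_mass_le:
  fixes X :: "'k::finite bmat" and \<theta> p B :: "real^'k^'k"
  assumes sol: "sdp_solution n A \<theta> X"
    and cut: "cut_bound {1..n} {1..n} (\<lambda>i j. of_bool (A i j) - p $ zz i $ zz j) c"
    and same: "\<And>a b c d. (c, d) \<in> Qset B a b \<Longrightarrow> \<theta> $ c $ d = \<theta> $ a $ b"
    and gain: "\<And>a b c d. (c, d) \<notin> Qset B a b \<Longrightarrow> g \<le> log_gain p \<theta> a b c d"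
    and D: "\<And>a b. \<bar>ln (\<theta> $ a $ b) - ln (1 - \<theta> $ a $ b) - h\<bar> \<le> D"
  shows "g * off_mass n B zz X \<le> 16 * c * D * (real CARD('k))\<^sup>2"
proof -
  define W where "W i j = of_bool (A i j) - p $ zz i $ zz j" for i j
  define d where "d a b = ln (\<theta> $ a $ b) - ln (1 - \<theta> $ a $ b) - h" for a b
  define F where "F = sdp_cost A \<theta>"
  define Z where "Z = membership_matrix zz"
  have X: "sdp_feasible n X" and Z: "sdp_feasible n Z"
    using sol membership_matrix_feasible by (auto simp: sdp_solution_def is_arg_max_def Z_def)
  have opt: "binner n F Z \<le> binner n F X"
    using sol Z by (auto simp: sdp_solution_def is_arg_max_def F_def not_less)
  have cutW: "cut_bound {1..n} {1..n} W c" using cut unfolding W_def .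
  have D0: "0 \<le> D" using D[of undefined undefined] by linarith
  have block: "(\<Sum>a\<in>UNIV. \<Sum>b\<in>UNIV. log_gain p \<theta> (zz i) (zz j) a b * X (i, a) (j, b))
    = (\<Sum>a\<in>UNIV. \<Sum>b\<in>UNIV. d a b * (W i j * (X (i, a) (j, b) - Z (i, a) (j, b))))
      - (\<Sum>a\<in>UNIV. \<Sum>b\<in>UNIV. F (i, a) (j, b) * X (i, a) (j, b))
      + (\<Sum>a\<in>UNIV. \<Sum>b\<in>UNIV. F (i, a) (j, b) * Z (i, a) (j, b))"
    if ij: "i \<in> {1..n}" "j \<in> {1..n}" for i j
  proof -
    have Fz: "(\<Sum>a\<in>UNIV. \<Sum>b\<in>UNIV. F (i, a) (j, b) * Z (i, a) (j, b)) = F (i, zz i) (j, zz j)"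
      unfolding Z_def by (rule membership_block_sum)
    have dz: "(\<Sum>a\<in>UNIV. \<Sum>b\<in>UNIV. d a b * (W i j * Z (i, a) (j, b))) = d (zz i) (zz j) * W i j"
      using membership_block_sum[of "\<lambda>a b. d a b * W i j" zz i j] by (simp add: Z_def mult_ac)
    have const: "(\<Sum>a\<in>UNIV. \<Sum>b\<in>UNIV. r * X (i, a) (j, b)) = r" for r
      using feasible_block_sum[OF X ij] by (simp flip: sum_distrib_left)
    have pt: "log_gain p \<theta> (zz i) (zz j) a b
        = d a b * W i j - d (zz i) (zz j) * W i j - F (i, a) (j, b) + F (i, zz i) (j, zz j)" for a b
      by (simp add: log_gain_def d_def W_def F_def sdp_cost_def algebra_simps)
    have "(\<Sum>a\<in>UNIV. \<Sum>b\<in>UNIV. log_gain p \<theta> (zz i) (zz j) a b * X (i, a) (j, b))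
      = (\<Sum>a\<in>UNIV. \<Sum>b\<in>UNIV. d a b * (W i j * X (i, a) (j, b))
          - (d (zz i) (zz j) * W i j) * X (i, a) (j, b)
          - F (i, a) (j, b) * X (i, a) (j, b) + F (i, zz i) (j, zz j) * X (i, a) (j, b))"
      by (intro sum.cong refl) (simp add: pt algebra_simps)
    also have "\<dots> = (\<Sum>a\<in>UNIV. \<Sum>b\<in>UNIV. d a b * (W i j * X (i, a) (j, b)))
        - d (zz i) (zz j) * W i j
        - (\<Sum>a\<in>UNIV. \<Sum>b\<in>UNIV. F (i, a) (j, b) * X (i, a) (j, b)) + F (i, zz i) (j, zz j)"
      by (simp only: sum.distrib sum_subtractf const)
    finally show ?thesis
      by (simp add: Fz dz right_diff_distrib sum_subtractf)
  qed
  have "g * off_mass n B zz X \<le> (\<Sum>i\<in>{1..n}. \<Sum>j\<in>{1..n}.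
      \<Sum>a\<in>UNIV. \<Sum>b\<in>UNIV. log_gain p \<theta> (zz i) (zz j) a b * X (i, a) (j, b))"
    unfolding off_mass_def sum_distrib_left
  proof (intro sum_mono)
    fix i j a b assume ij: "i \<in> {1..n}" "j \<in> {1..n}"
    show "g * (of_bool ((a, b) \<notin> Qset B (zz i) (zz j)) * X (i, a) (j, b))
       \<le> log_gain p \<theta> (zz i) (zz j) a b * X (i, a) (j, b)"
      using same[of a b "zz i" "zz j"] gain[of a b "zz i" "zz j"] feasible_block_nonneg[OF X ij, of a b]
      by (cases "(a, b) \<in> Qset B (zz i) (zz j)") (auto intro: mult_right_mono simp: log_gain_def)
  qed
  also have "\<dots> = (\<Sum>i\<in>{1..n}. \<Sum>j\<in>{1..n}. \<Sum>a\<in>UNIV. \<Sum>b\<in>UNIV. 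
       d a b * (W i j * (X (i, a) (j, b) - Z (i, a) (j, b)))) - binner n F X + binner n F Z"
    by (simp add: block binner_blocks sum.distrib sum_subtractf)
  also have "\<dots> \<le> (\<Sum>i\<in>{1..n}. \<Sum>j\<in>{1..n}. \<Sum>a\<in>UNIV. \<Sum>b\<in>UNIV. 
       d a b * (W i j * (X (i, a) (j, b) - Z (i, a) (j, b))))"
    using opt by simp
  also have "\<dots> = (\<Sum>a\<in>UNIV. \<Sum>b\<in>UNIV. d a b * (\<Sum>i\<in>{1..n}. \<Sum>j\<in>{1..n}. 
       W i j * (X (i, a) (j, b) - Z (i, a) (j, b))))"
    unfolding sum_distrib_left
    by (simp only: sum.swap[where A = "{1..n}" and B = "UNIV :: 'k set"])
  also have "\<dots> \<le> (\<Sum>a\<in>(UNIV :: 'k set). \<Sum>b\<in>(UNIV :: 'k set). D * (16 * c))"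
  proof (intro sum_mono)
    fix a b
    have "\<bar>\<Sum>i\<in>{1..n}. \<Sum>j\<in>{1..n}. W i j * (X (i, a) (j, b) - Z (i, a) (j, b))\<bar> \<le> 16 * c"
      using feasible_cut_abs_le[OF X cutW, of a b] feasible_cut_abs_le[OF Z cutW, of a b]
      by (simp add: right_diff_distrib sum_subtractf)
    then have "\<bar>d a b\<bar> * \<bar>\<Sum>i\<in>{1..n}. \<Sum>j\<in>{1..n}. W i j * (X (i, a) (j, b) - Z (i, a) (j, b))\<bar> \<le> D * (16 * c)"
      using D D0 by (intro mult_mono) (auto simp: d_def)
    then show "d a b * (\<Sum>i\<in>{1..n}. \<Sum>j\<in>{1..n}. W i j * (X (i, a) (j, b) - Z (i, a) (j, b))) \<le> D * (16 * c)"
      by - (rule order_trans[OF abs_ge_self], simp only: abs_mult)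
  qed
  also have "\<dots> = 16 * c * D * (real CARD('k))\<^sup>2" by (simp add: power2_eq_square)
  finally show ?thesis .
qed

section \<open>Positive expected log-likelihood gain\<close>

lemma ln_one_minus_approx:
  fixes t :: real
  assumes "0 \<le> t" "t \<le> 1/2"
  shows "\<bar>ln (1 - t) + t\<bar> \<le> 2 * t\<^sup>2"
  using abs_ln_one_plus_x_minus_x_bound[of "- t"] assms by simp

text \<open>
  For a sparse graph the Bernoulli gain is \<open>\<alpha>\<close> times its Poisson limit, which is the quantity in the
  hypothesis on \<open>\<delta>\<close>. The corrections are \<open>\<eta> * R\<close> for the relative error of the density estimate
  \<open>\<rho> * \<alpha>\<close>, and \<open>2 * \<alpha> * R\<^sup>2 + 16 * \<alpha> * R\<^sup>2\<close> for the factor \<open>1 - \<alpha> * B\<close> and the second-order terms of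
  the logarithms.
\<close>

lemma log_gain_ge:
  fixes Bstar Bhat :: "real^'k^'k"
  assumes R: "\<And>a b. 0 \<le> Bstar $ a $ b" "\<And>a b. Bstar $ a $ b \<le> R"
      "\<And>a b. 0 < Bhat $ a $ b" "\<And>a b. Bhat $ a $ b \<le> R"
    and \<alpha>: "0 < \<alpha>" "\<alpha> * R \<le> 1/4" and \<rho>: "\<bar>\<rho> - 1\<bar> \<le> \<eta>" "\<eta> \<le> 1/2"
    and gap: "\<delta> \<le> Bstar $ a $ b * ln (Bhat $ a $ b / Bhat $ c $ d) - (Bhat $ a $ b - Bhat $ c $ d)"
  shows "\<alpha> * (\<delta> - \<eta> * R - 18 * \<alpha> * R\<^sup>2)
    \<le> log_gain (\<alpha> *\<^sub>R Bstar) ((\<rho> * \<alpha>) *\<^sub>R Bhat) a b c d"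
proof -
  define B x y where "B = Bstar $ a $ b" and "x = Bhat $ a $ b" and "y = Bhat $ c $ d"
  have xy: "0 < x" "x \<le> R" "0 < y" "y \<le> R" and B: "0 \<le> B" "B \<le> R"
    using R by (auto simp: B_def x_def y_def)
  have \<rho>b: "1/2 \<le> \<rho>" "\<rho> \<le> 2" using \<rho> by auto
  have small: "\<rho> * \<alpha> * w \<le> 2 * \<alpha> * R" "0 < \<rho> * \<alpha> * w" if "0 < w" "w \<le> R" for w
  proof -
    show "\<rho> * \<alpha> * w \<le> 2 * \<alpha> * R" using that \<rho>b \<alpha> by (intro mult_mono) auto
    show "0 < \<rho> * \<alpha> * w" using that \<rho>b \<alpha> by simp
  qed
  define e where "e w = ln (1 - \<rho> * \<alpha> * w) + \<rho> * \<alpha> * w" for w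
  have e: "\<bar>e w\<bar> \<le> 8 * \<alpha>\<^sup>2 * R\<^sup>2" if w: "0 < w" "w \<le> R" for w
  proof -
    have "\<bar>e w\<bar> \<le> 2 * (\<rho> * \<alpha> * w)\<^sup>2"
      unfolding e_def using small[OF w] \<alpha>(2) by (intro ln_one_minus_approx) linarith+
    also have "\<dots> \<le> 2 * (2 * \<alpha> * R)\<^sup>2"
      using small[OF w] by (intro mult_left_mono power_mono) auto
    finally show ?thesis by (simp add: power_mult_distrib)
  qed
  have "\<bar>x - y\<bar> \<le> R" using xy by auto
  have p: "0 \<le> \<alpha> * B" "\<alpha> * B \<le> \<alpha> * R" using \<alpha> B by (auto intro: mult_left_mono)
  have "\<bar>(\<rho> - 1) * (x - y)\<bar> \<le> \<eta> * R"
    unfolding abs_mult using \<rho> \<open>\<bar>x - y\<bar> \<le> R\<close> by (intro mult_mono) auto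
  then have t1: "\<alpha> * ((\<rho> - 1) * (x - y)) \<le> \<alpha> * (\<eta> * R)"
    using \<alpha> by (intro mult_left_mono) auto
  have "\<bar>(\<alpha> * B) * (\<rho> * \<alpha> * (x - y))\<bar> \<le> (\<alpha> * R) * (2 * \<alpha> * R)"
    unfolding abs_mult using p \<rho>b \<alpha> \<open>\<bar>x - y\<bar> \<le> R\<close> B by (intro mult_mono) auto
  then have t2: "- (2 * \<alpha>\<^sup>2 * R\<^sup>2) \<le> (\<alpha> * B) * (\<rho> * \<alpha> * (x - y))"
    by (simp add: power2_eq_square mult_ac)
  have "\<bar>1 - \<alpha> * B\<bar> \<le> 1" using p \<alpha>(2) by linarith
  then have "\<bar>(1 - \<alpha> * B) * (e x - e y)\<bar> \<le> 1 * (16 * \<alpha>\<^sup>2 * R\<^sup>2)"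
    unfolding abs_mult using e[of x] e[of y] xy by (intro mult_mono) auto
  then have t3: "- (16 * \<alpha>\<^sup>2 * R\<^sup>2) \<le> (1 - \<alpha> * B) * (e x - e y)"
    by linarith
  have "ln (\<rho> * \<alpha> * x) - ln (\<rho> * \<alpha> * y) = ln (x / y)"
    using xy \<rho>b \<alpha> by (simp add: ln_div ln_mult)
  moreover have "ln (1 - \<rho> * \<alpha> * x) - ln (1 - \<rho> * \<alpha> * y) = - \<rho> * \<alpha> * (x - y) + (e x - e y)"
    by (simp add: e_def algebra_simps)
  ultimately have "log_gain (\<alpha> *\<^sub>R Bstar) ((\<rho> * \<alpha>) *\<^sub>R Bhat) a b c d
      = \<alpha> * B * ln (x / y) + (1 - \<alpha> * B) * (- \<rho> * \<alpha> * (x - y) + (e x - e y))"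
    by (simp add: log_gain_def B_def x_def y_def mult_ac)
  also have "\<dots> = \<alpha> * (B * ln (x / y) - (x - y)) - \<alpha> * ((\<rho> - 1) * (x - y))
      + (\<alpha> * B) * (\<rho> * \<alpha> * (x - y)) + (1 - \<alpha> * B) * (e x - e y)"
    by (simp add: algebra_simps)
  also have "\<dots> \<ge> \<alpha> * \<delta> - \<alpha> * (\<eta> * R) - 2 * \<alpha>\<^sup>2 * R\<^sup>2 - 16 * \<alpha>\<^sup>2 * R\<^sup>2"
  proof -
    have "\<alpha> * \<delta> \<le> \<alpha> * (B * ln (x / y) - (x - y))"
      using gap \<alpha> by (intro mult_left_mono) (auto simp: B_def x_def y_def)
    with t1 t2 t3 show ?thesis by linarith
  qed
  finally show ?thesis by (simp add: algebra_simps power2_eq_square)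
qed

text \<open>
  There are finitely many pairs of classes, so the gap has a positive minimum \<open>\<delta>0\<close>. The thresholds for
  \<open>\<rho>\<close> and \<open>\<alpha>\<close> are chosen so that each of the two corrections in the previous bound uses up at
  most \<open>\<delta>0 / 4\<close>.
\<close>

lemma log_gain_uniform:
  fixes Bstar Bhat :: "real^'k::finite^'k"
  assumes Bstar: "\<And>a b. 0 \<le> Bstar $ a $ b" and Bhat: "\<And>a b. 0 < Bhat $ a $ b"
    and gap: "\<And>a b c d. (c, d) \<notin> Qset Bstar a b \<Longrightarrow>
        Bstar $ a $ b * ln (Bhat $ a $ b / Bhat $ c $ d) - (Bhat $ a $ b - Bhat $ c $ d) > 0"
  obtains \<delta> \<eta> \<alpha>0 D where "0 < \<delta>" "0 < \<eta>" "\<eta> \<le> 1/2" "0 < \<alpha>0" "0 < D"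
    and "\<And>\<alpha> \<rho>. 0 < \<alpha> \<Longrightarrow> \<alpha> \<le> \<alpha>0 \<Longrightarrow> \<bar>\<rho> - 1\<bar> \<le> \<eta> \<Longrightarrow> in_unit_interior ((\<rho> * \<alpha>) *\<^sub>R Bhat)"
    and "\<And>\<alpha> \<rho> a b. 0 < \<alpha> \<Longrightarrow> \<alpha> \<le> \<alpha>0 \<Longrightarrow> \<bar>\<rho> - 1\<bar> \<le> \<eta> \<Longrightarrow>
      \<bar>ln (((\<rho> * \<alpha>) *\<^sub>R Bhat) $ a $ b) - ln (1 - ((\<rho> * \<alpha>) *\<^sub>R Bhat) $ a $ b) - ln (\<rho> * \<alpha>)\<bar> \<le> D"
    and "\<And>\<alpha> \<rho> a b c d. 0 < \<alpha> \<Longrightarrow> \<alpha> \<le> \<alpha>0 \<Longrightarrow> \<bar>\<rho> - 1\<bar> \<le> \<eta> \<Longrightarrow> (c, d) \<notin> Qset Bstar a b \<Longrightarrow>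
      \<alpha> * \<delta> \<le> log_gain (\<alpha> *\<^sub>R Bstar) ((\<rho> * \<alpha>) *\<^sub>R Bhat) a b c d"
proof -
  define f where "f = (\<lambda>(a, b, c, d). Bstar $ a $ b * ln (Bhat $ a $ b / Bhat $ c $ d) - (Bhat $ a $ b - Bhat $ c $ d))"
  define \<delta>0 where "\<delta>0 = Min (insert 1 (f ` {(a, b, c, d). (c, d) \<notin> Qset Bstar a b}))"
  have \<delta>0: "0 < \<delta>0"
    unfolding \<delta>0_def using gap by (subst Min_gr_iff) (auto simp: f_def)
  have gap': "\<delta>0 \<le> Bstar $ a $ b * ln (Bhat $ a $ b / Bhat $ c $ d) - (Bhat $ a $ b - Bhat $ c $ d)"
    if "(c, d) \<notin> Qset Bstar a b" for a b c d
  proof -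
    have "\<delta>0 \<le> f (a, b, c, d)"
      unfolding \<delta>0_def using that by (intro Min_le finite.insertI finite_imageI) auto
    then show ?thesis by (simp add: f_def)
  qed
  define R where "R = Max (insert 1 (range (\<lambda>(a, b). max (Bstar $ a $ b) (Bhat $ a $ b))))"
  have R1: "1 \<le> R" unfolding R_def by (intro Max_ge) auto
  have Rmax: "max (Bstar $ a $ b) (Bhat $ a $ b) \<le> R" for a b
    unfolding R_def by (intro Max_ge) (auto intro: image_eqI[of _ _ "(a, b)"])
  then have R: "Bstar $ a $ b \<le> R" "Bhat $ a $ b \<le> R" for a b
    by (meson max.bounded_iff)+
  define L where "L = Max (range (\<lambda>(a, b). \<bar>ln (Bhat $ a $ b)\<bar>))"
  have L: "\<bar>ln (Bhat $ a $ b)\<bar> \<le> L" for a b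
    unfolding L_def by (intro Max_ge) (auto intro: image_eqI[of _ _ "(a, b)"])
  define \<eta> where "\<eta> = min (1/2) (\<delta>0 / (4 * R))"
  define \<alpha>0 where "\<alpha>0 = min (1 / (8 * R)) (\<delta>0 / (72 * R\<^sup>2))"
  have \<eta>: "0 < \<eta>" "\<eta> \<le> 1/2" "\<eta> * R \<le> \<delta>0 / 4" and \<alpha>0: "0 < \<alpha>0"
    using \<delta>0 R1 by (auto simp: \<eta>_def \<alpha>0_def min_def field_simps)
  have \<alpha>R: "\<alpha> * R \<le> 1/8" "18 * \<alpha> * R\<^sup>2 \<le> \<delta>0 / 4" if "\<alpha> \<le> \<alpha>0" for \<alpha>
    using that R1 by (auto simp: \<alpha>0_def field_simps)
  have range: "0 < \<rho> * \<alpha> * Bhat $ a $ b" "\<rho> * \<alpha> * Bhat $ a $ b \<le> 1/4"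
    if "0 < \<alpha>" "\<alpha> \<le> \<alpha>0" "\<bar>\<rho> - 1\<bar> \<le> \<eta>" for \<alpha> \<rho> a b
  proof -
    have \<rho>: "0 < \<rho>" "\<rho> \<le> 2" using that(3) \<eta> by auto
    then show "0 < \<rho> * \<alpha> * Bhat $ a $ b" using that Bhat by simp
    have "\<rho> * \<alpha> * Bhat $ a $ b \<le> 2 * \<alpha> * R"
      using \<rho> that R Bhat[of a b] by (intro mult_mono) auto
    then show "\<rho> * \<alpha> * Bhat $ a $ b \<le> 1/4" using \<alpha>R(1)[OF that(2)] by linarith
  qed
  show thesis
  proof (rule that[of "\<delta>0 / 2" \<eta> \<alpha>0 "L + 1"])
    show "0 < L + 1" using L[of undefined undefined] by linarith
    fix \<alpha> \<rho> :: real assume \<alpha>: "0 < \<alpha>" "\<alpha> \<le> \<alpha>0" and \<rho>: "\<bar>\<rho> - 1\<bar> \<le> \<eta>"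
    note r = range[OF \<alpha> \<rho>]
    have "\<rho> * \<alpha> * Bhat $ a $ b < 1" for a b using r(2)[of a b] by linarith
    then show "in_unit_interior ((\<rho> * \<alpha>) *\<^sub>R Bhat)"
      using r(1) by (simp add: in_unit_interior_def mult.assoc)
    show "\<bar>ln (((\<rho> * \<alpha>) *\<^sub>R Bhat) $ a $ b) - ln (1 - ((\<rho> * \<alpha>) *\<^sub>R Bhat) $ a $ b) - ln (\<rho> * \<alpha>)\<bar> \<le> L + 1" for a b
    proof -
      define t where "t = \<rho> * \<alpha> * Bhat $ a $ b"
      have t: "0 < t" "t \<le> 1/4" using r by (auto simp: t_def)
      have "0 < \<rho>" using \<rho> \<eta> by auto
      then have "ln t = ln (\<rho> * \<alpha>) + ln (Bhat $ a $ b)"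
        unfolding t_def using \<alpha> Bhat[of a b] by (intro ln_mult_pos) auto
      moreover have "t\<^sup>2 \<le> t" using t by (simp add: power2_eq_square mult_left_le)
      then have "\<bar>ln (1 - t)\<bar> \<le> 1" using ln_one_minus_approx[of t] t by linarith
      ultimately have "\<bar>ln t - ln (1 - t) - ln (\<rho> * \<alpha>)\<bar> \<le> L + 1"
        using L[of a b] by linarith
      then show ?thesis by (simp add: t_def)
    qed
    show "\<alpha> * (\<delta>0 / 2) \<le> log_gain (\<alpha> *\<^sub>R Bstar) ((\<rho> * \<alpha>) *\<^sub>R Bhat) a b c d"
      if Q: "(c, d) \<notin> Qset Bstar a b" for a b c d
    proof -
      have "\<alpha> * (\<delta>0 / 2) \<le> \<alpha> * (\<delta>0 - \<eta> * R - 18 * \<alpha> * R\<^sup>2)"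
        using \<alpha> \<eta>(3) \<alpha>R(2)[OF \<alpha>(2)] by (intro mult_left_mono) auto
      also have "\<dots> \<le> log_gain (\<alpha> *\<^sub>R Bstar) ((\<rho> * \<alpha>) *\<^sub>R Bhat) a b c d"
        using Bstar Bhat R \<alpha> \<alpha>R(1)[OF \<alpha>(2)] \<rho> \<eta> gap'[OF Q] by (intro log_gain_ge) auto
      finally show ?thesis .
    qed
  qed (use \<delta>0 \<eta> \<alpha>0 in auto)
qed

section \<open>Consistency of the density estimate\<close>

definition class_freq :: "nat \<Rightarrow> (nat \<Rightarrow> 'k) \<Rightarrow> 'k \<Rightarrow> real" where
  "class_freq n zz a = (\<Sum>i\<in>{1..n}. of_bool (zz i = a)) / real n"

lemma class_freq_bounds: "0 \<le> class_freq n zz a" "class_freq n zz a \<le> 1"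
proof -
  have "(\<Sum>i\<in>{1..n}. of_bool (zz i = a)) \<le> (\<Sum>i\<in>{1..n}. 1 :: real)" by (intro sum_mono) auto
  then show "class_freq n zz a \<le> 1" by (cases "n = 0") (auto simp: class_freq_def)
qed (auto simp: class_freq_def intro!: divide_nonneg_nonneg sum_nonneg)

lemma sum_pairs_class_freq:
  fixes zz :: "nat \<Rightarrow> 'k::finite" and B :: "real^'k^'k"
  shows "(\<Sum>i\<in>{1..n}. \<Sum>j\<in>{1..n}. B $ zz i $ zz j)
     = (real n)\<^sup>2 * (\<Sum>a\<in>UNIV. \<Sum>b\<in>UNIV. class_freq n zz a * class_freq n zz b * B $ a $ b)"
proof (cases "n = 0")
  case False
  have "(\<Sum>i\<in>{1..n}. \<Sum>j\<in>{1..n}. B $ zz i $ zz j)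
    = (\<Sum>i\<in>{1..n}. \<Sum>j\<in>{1..n}. \<Sum>a\<in>UNIV. \<Sum>b\<in>UNIV. B $ a $ b * membership_matrix zz (i, a) (j, b))"
    by (simp only: membership_block_sum)
  also have "\<dots> = (\<Sum>a\<in>UNIV. \<Sum>b\<in>UNIV. \<Sum>i\<in>{1..n}. \<Sum>j\<in>{1..n}. B $ a $ b * membership_matrix zz (i, a) (j, b))"
    by (simp only: sum.swap[where A = "{1..n}" and B = "UNIV :: 'k set"])
  also have "\<dots> = (\<Sum>a\<in>UNIV. \<Sum>b\<in>UNIV. B $ a $ b * ((\<Sum>i\<in>{1..n}. of_bool (zz i = a)) * (\<Sum>j\<in>{1..n}. of_bool (zz j = b))))"
    unfolding sum_product unfolding sum_distrib_left by (simp only: membership_matrix_def prod.case)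
  also have "\<dots> = (\<Sum>a\<in>UNIV. \<Sum>b\<in>UNIV. (real n)\<^sup>2 * (class_freq n zz a * class_freq n zz b * B $ a $ b))"
    using False by (intro sum.cong refl) (simp add: class_freq_def power2_eq_square)
  finally show ?thesis by (simp add: sum_distrib_left)
qed simp

text \<open>
  The number of edges differs from its conditional mean by at most \<open>c\<close>, the value of the centred
  matrix at constant sign vectors. The conditional mean is a quadratic form in the class frequencies,
  equal to \<open>\<alpha> n\<^sup>2\<close> at the true class probabilities by the normalization of \<open>B\<close>. The last term comes
  from dividing by \<open>n (n - 1)\<close> instead of \<open>n\<^sup>2\<close>.
\<close>

lemma alpha_hat_close:
  fixes \<pi> :: "'k::finite pmf" and B :: "real^'k^'k"
  assumes n: "2 \<le> n" and \<alpha>: "0 < \<alpha>" and B: "\<And>a b. 0 \<le> B $ a $ b"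
    and norm: "(\<Sum>a\<in>UNIV. \<Sum>b\<in>UNIV. pmf \<pi> a * pmf \<pi> b * B $ a $ b) = 1"
    and cut: "cut_bound {1..n} {1..n} (\<lambda>i j. of_bool (A i j) - (\<alpha> *\<^sub>R B) $ zz i $ zz j) c"
    and freq: "\<And>a. \<bar>class_freq n zz a - pmf \<pi> a\<bar> \<le> \<kappa>"
  shows "\<bar>alpha_hat n A / \<alpha> - 1\<bar>
    \<le> 2 * c / (\<alpha> * (real n)\<^sup>2) + 4 * \<kappa> * (\<Sum>a\<in>UNIV. \<Sum>b\<in>UNIV. B $ a $ b) + 1 / (real n - 1)"
proof -
  define W where "W i j = of_bool (A i j) - (\<alpha> *\<^sub>R B) $ zz i $ zz j" for i j
  define SA where "SA = (\<Sum>i\<in>{1..n}. \<Sum>j\<in>{1..n}. of_bool (A i j) :: real)"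
  define SB where "SB = (\<Sum>a\<in>UNIV. \<Sum>b\<in>UNIV. B $ a $ b)"
  define m where "m = (\<Sum>a\<in>UNIV. \<Sum>b\<in>UNIV. class_freq n zz a * class_freq n zz b * B $ a $ b)"
  have cutW: "cut_bound {1..n} {1..n} W c" using cut unfolding W_def .
  have sumW: "\<bar>\<Sum>i\<in>{1..n}. \<Sum>j\<in>{1..n}. W i j\<bar> \<le> c"
    using cut_bound_real[OF cutW, of "\<lambda>_. 1" "\<lambda>_. 1"] cut_bound_real[OF cutW, of "\<lambda>_. -1" "\<lambda>_. 1"]
    by (simp add: sum_negf)
  have "SA = (\<Sum>i\<in>{1..n}. \<Sum>j\<in>{1..n}. W i j) + \<alpha> * (\<Sum>i\<in>{1..n}. \<Sum>j\<in>{1..n}. B $ zz i $ zz j)"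
    by (simp add: SA_def W_def sum_subtractf sum_distrib_left)
  then have "SA = (\<Sum>i\<in>{1..n}. \<Sum>j\<in>{1..n}. W i j) + \<alpha> * ((real n)\<^sup>2 * m)"
    by (simp only: sum_pairs_class_freq m_def)
  then have SA: "\<bar>SA - \<alpha> * (real n)\<^sup>2 * m\<bar> \<le> c"
    using sumW by simp
  have \<kappa>0: "0 \<le> \<kappa>" using freq[of undefined] by linarith
  have prod: "\<bar>class_freq n zz a * class_freq n zz b - pmf \<pi> a * pmf \<pi> b\<bar> \<le> 2 * \<kappa>" for a b
  proof -
    have "class_freq n zz a * class_freq n zz b - pmf \<pi> a * pmf \<pi> b
      = class_freq n zz a * (class_freq n zz b - pmf \<pi> b) + pmf \<pi> b * (class_freq n zz a - pmf \<pi> a)"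
      by (simp add: algebra_simps)
    also have "\<bar>\<dots>\<bar> \<le> \<bar>class_freq n zz a\<bar> * \<bar>class_freq n zz b - pmf \<pi> b\<bar> + \<bar>pmf \<pi> b\<bar> * \<bar>class_freq n zz a - pmf \<pi> a\<bar>"
      by (metis abs_mult abs_triangle_ineq)
    also have "\<dots> \<le> 1 * \<kappa> + 1 * \<kappa>"
      using class_freq_bounds[of n zz a] pmf_le_1[of \<pi> b] pmf_nonneg[of \<pi> b] freq \<kappa>0
      by (intro add_mono mult_mono) auto
    finally show ?thesis by simp
  qed
  have "\<bar>m - 1\<bar> = \<bar>\<Sum>a\<in>UNIV. \<Sum>b\<in>UNIV. (class_freq n zz a * class_freq n zz b - pmf \<pi> a * pmf \<pi> b) * B $ a $ b\<bar>"
    unfolding norm[symmetric] m_def by (simp add: left_diff_distrib sum_subtractf)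
  also have "\<dots> \<le> (\<Sum>a\<in>UNIV. \<Sum>b\<in>UNIV. 2 * \<kappa> * B $ a $ b)"
  proof (intro order_trans[OF sum_abs] sum_mono)
    fix a b
    show "\<bar>(class_freq n zz a * class_freq n zz b - pmf \<pi> a * pmf \<pi> b) * B $ a $ b\<bar> \<le> 2 * \<kappa> * B $ a $ b"
      using prod[of a b] B[of a b] by (simp add: abs_mult mult_right_mono)
  qed
  finally have m: "\<bar>m - 1\<bar> \<le> 2 * \<kappa> * SB" by (simp add: SB_def sum_distrib_left)
  have n1: "real n - 1 > 0" "real n \<le> 2 * (real n - 1)" using n by auto
  define r where "r = real n / (real n - 1)"
  have r: "0 < r" "r \<le> 2" "r - 1 = 1 / (real n - 1)" using n1 by (auto simp: r_def field_simps)
  define E where "E = (SA - \<alpha> * (real n)\<^sup>2 * m) / (\<alpha> * (real n)\<^sup>2)"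
  have pos: "0 < \<alpha> * (real n)\<^sup>2" using \<alpha> n by simp
  have E: "\<bar>E\<bar> \<le> c / (\<alpha> * (real n)\<^sup>2)"
    unfolding E_def abs_divide using SA pos by (simp add: divide_right_mono)
  have "alpha_hat n A / \<alpha> = r * (SA / (\<alpha> * (real n)\<^sup>2))"
    using n1 n \<alpha> by (simp add: alpha_hat_def SA_def r_def power2_eq_square field_simps)
  also have "SA / (\<alpha> * (real n)\<^sup>2) = E + m"
    using \<alpha> n by (simp add: E_def diff_divide_distrib)
  finally have "alpha_hat n A / \<alpha> - 1 = r * (E + (m - 1)) + (r - 1)"
    by (simp add: algebra_simps)
  also have "\<bar>\<dots>\<bar> \<le> 2 * \<bar>E + (m - 1)\<bar> + 1 / (real n - 1)"
  proof -
    have "\<bar>r * (E + (m - 1))\<bar> \<le> 2 * \<bar>E + (m - 1)\<bar>"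
      unfolding abs_mult using r by (intro mult_right_mono) auto
    moreover have "\<bar>r - 1\<bar> = 1 / (real n - 1)" using r(3) n1 by simp
    ultimately show ?thesis by linarith
  qed
  also have "\<dots> \<le> 2 * (c / (\<alpha> * (real n)\<^sup>2) + 2 * \<kappa> * SB) + 1 / (real n - 1)"
    using E m by (intro add_mono mult_left_mono) auto
  finally show ?thesis by (simp add: SB_def)
qed

section \<open>Exponential tail bound for sums of Bernoulli variables\<close>

lemma exp_le_quadratic:
  fixes y :: real
  assumes "\<bar>y\<bar> \<le> 1"
  shows "exp y \<le> 1 + y + y\<^sup>2"
proof (cases "0 \<le> y")
  case True
  then show ?thesis using exp_bound[of y] assms by simp
next
  case False
  define t where "t = - y"
  have t: "0 < t" using False by (simp add: t_def)
  have "exp y = 1 / exp t" by (simp add: t_def exp_minus field_simps)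
  also have "\<dots> \<le> 1 / (1 + t)"
    using t exp_ge_add_one_self[of t] by (intro divide_left_mono) auto
  also have "\<dots> \<le> 1 - t + t\<^sup>2"
  proof -
    have "1 \<le> (1 - t + t\<^sup>2) * (1 + t)" using t by (simp add: algebra_simps power2_eq_square)
    then show ?thesis using t by (simp add: divide_le_eq)
  qed
  finally show ?thesis by (simp add: t_def)
qed

text \<open>
  The exponent is proportional to \<open>q\<close>, the variance scale, and not merely bounded by \<open>y\<^sup>2 / 8\<close> as in
  Hoeffding's lemma; sparse graphs need this gain.
\<close>

lemma bernoulli_mgf_le:
  fixes q y :: real
  assumes q: "0 \<le> q" "q \<le> 1" and y: "\<bar>y\<bar> \<le> 1"
  shows "measure_pmf.expectation (bernoulli_pmf q) (\<lambda>b. exp ((of_bool b - q) * y)) \<le> exp (q * y\<^sup>2)"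
proof -
  have "measure_pmf.expectation (bernoulli_pmf q) (\<lambda>b. exp ((of_bool b - q) * y))
    = q * exp ((1 - q) * y) + (1 - q) * exp (- (q * y))"
    using q by simp
  also have "\<dots> = exp (- (q * y)) * (1 + q * (exp y - 1))"
    by (simp add: algebra_simps exp_diff exp_minus field_simps)
  also have "\<dots> \<le> exp (- (q * y)) * exp (q * (exp y - 1))"
    by (intro mult_left_mono exp_ge_add_one_self) auto
  also have "\<dots> = exp (q * (exp y - 1 - y))"
    by (simp add: algebra_simps flip: exp_add)
  also have "\<dots> \<le> exp (q * y\<^sup>2)"
    using exp_le_quadratic[OF y] q by (simp add: mult_left_mono)
  finally show ?thesis .
qed

lemma (in prob_space) bernoulli_sum_tail:
  fixes Y :: "'p \<Rightarrow> 'a \<Rightarrow> bool" and q x :: "'p \<Rightarrow> real"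
  assumes J: "finite J" and indep: "indep_vars (\<lambda>_. count_space UNIV) Y J"
    and distr: "\<And>p. p \<in> J \<Longrightarrow> distr M (count_space UNIV) (Y p) = measure_pmf (bernoulli_pmf (q p))"
    and q: "\<And>p. p \<in> J \<Longrightarrow> 0 \<le> q p \<and> q p \<le> 1"
    and x: "\<And>p. p \<in> J \<Longrightarrow> \<bar>x p\<bar> \<le> 2" and l: "0 < l" "l \<le> 1/2"
  shows "prob {\<omega>\<in>space M. (\<Sum>p\<in>J. (of_bool (Y p \<omega>) - q p) * x p) \<ge> T}
    \<le> exp (4 * l\<^sup>2 * (\<Sum>p\<in>J. q p) - l * T)"
proof -
  have rv: "Y p \<in> M \<rightarrow>\<^sub>M count_space UNIV" if "p \<in> J" for p
    using indep that unfolding indep_vars_def by auto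
  define f where "f p b = exp ((of_bool b - q p) * (l * x p))" for p b
  have f_meas: "(\<lambda>\<omega>. f p (Y p \<omega>)) \<in> borel_measurable M" if "p \<in> J" for p
    using rv[OF that] by (rule measurable_compose) simp
  have f_indep: "indep_vars (\<lambda>_. borel) (\<lambda>p \<omega>. f p (Y p \<omega>)) J"
    by (rule indep_vars_compose2[OF indep]) simp
  have f_int: "integrable M (\<lambda>\<omega>. f p (Y p \<omega>))" if "p \<in> J" for p
  proof (rule integrable_const_bound[where B = "max (f p True) (f p False)"])
    show "AE \<omega> in M. norm (f p (Y p \<omega>)) \<le> max (f p True) (f p False)"
    proof (rule AE_I2)
      fix \<omega>
      show "norm (f p (Y p \<omega>)) \<le> max (f p True) (f p False)"
        by (cases "Y p \<omega>") (auto simp: f_def)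
    qed
  qed (rule f_meas[OF that])
  have mgf: "expectation (\<lambda>\<omega>. f p (Y p \<omega>)) \<le> exp (4 * l\<^sup>2 * q p)" if p: "p \<in> J" for p
  proof -
    have lx: "\<bar>l * x p\<bar> \<le> l * 2" using x[OF p] l by (simp add: abs_mult)
    have "expectation (\<lambda>\<omega>. f p (Y p \<omega>)) = integral\<^sup>L (distr M (count_space UNIV) (Y p)) (f p)"
      using rv[OF p] by (intro integral_distr[symmetric]) auto
    also have "\<dots> = measure_pmf.expectation (bernoulli_pmf (q p)) (f p)"
      by (simp add: distr[OF p])
    also have "\<dots> \<le> exp (q p * (l * x p)\<^sup>2)"
      unfolding f_def using q[OF p] lx l by (intro bernoulli_mgf_le) auto
    also have "\<dots> \<le> exp (q p * (l * 2)\<^sup>2)"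
    proof -
      have "(l * x p)\<^sup>2 \<le> (l * 2)\<^sup>2" using lx l by (subst abs_le_square_iff[symmetric]) auto
      then show ?thesis using q[OF p] by (simp add: mult_left_mono)
    qed
    finally show ?thesis by (simp add: power_mult_distrib mult_ac)
  qed
  define S where "S \<omega> = (\<Sum>p\<in>J. (of_bool (Y p \<omega>) - q p) * x p)" for \<omega>
  have prod: "exp (l * S \<omega>) = (\<Prod>p\<in>J. f p (Y p \<omega>))" for \<omega>
    using J by (simp add: S_def f_def sum_distrib_left mult_ac flip: exp_sum)
  have int: "integrable M (\<lambda>\<omega>. exp (l * S \<omega>))"
    unfolding prod by (rule indep_vars_integrable[OF J f_indep f_int])
  have "prob {\<omega>\<in>space M. S \<omega> \<ge> T} = prob {\<omega>\<in>space M. exp (l * S \<omega>) \<ge> exp (l * T)}"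
    using l by simp
  also have "\<dots> \<le> expectation (\<lambda>\<omega>. exp (l * S \<omega>)) / exp (l * T)"
    using int by (intro integral_Markov_inequality_measure[where A = "{}"]) auto
  also have "expectation (\<lambda>\<omega>. exp (l * S \<omega>)) = (\<Prod>p\<in>J. expectation (\<lambda>\<omega>. f p (Y p \<omega>)))"
    unfolding prod by (rule indep_vars_lebesgue_integral[OF J f_indep f_int])
  also have "\<dots> \<le> (\<Prod>p\<in>J. exp (4 * l\<^sup>2 * q p))"
    using mgf by (intro prod_mono) (auto simp: f_def intro!: integral_nonneg_AE)
  also have "\<dots> = exp (4 * l\<^sup>2 * (\<Sum>p\<in>J. q p))"
    using J by (simp add: exp_sum sum_distrib_left)
  finally show ?thesis by (simp add: S_def exp_diff divide_right_mono)
qed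

section \<open>Conditioning in the stochastic block model\<close>

definition adjacency_matrices :: "nat \<Rightarrow> adj set" where
  "adjacency_matrices n = {aa. \<forall>i j. aa i j \<longrightarrow> i \<in> {1..n} \<and> j \<in> {1..n}}"

lemma finite_adjacency_matrices: "finite (adjacency_matrices n)"
proof -
  have "adjacency_matrices n \<subseteq> (\<lambda>S i j. (i, j) \<in> S) ` Pow ({1..n} \<times> {1..n})"
  proof
    fix aa assume "aa \<in> adjacency_matrices n"
    then show "aa \<in> (\<lambda>S i j. (i, j) \<in> S) ` Pow ({1..n} \<times> {1..n})"
      by (intro image_eqI[of _ _ "{(i, j). aa i j}"]) (auto simp: adjacency_matrices_def)
  qed
  then show ?thesis by (rule finite_subset) auto
qed

definition labelings :: "nat \<Rightarrow> (nat \<Rightarrow> 'k::finite) set" where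
  "labelings n = {1..n} \<rightarrow>\<^sub>E UNIV"

lemma finite_labelings: "finite (labelings n)"
  by (auto simp: labelings_def intro: finite_PiE)

definition label_event :: "'w measure \<Rightarrow> nat \<Rightarrow> ('w \<Rightarrow> nat \<Rightarrow> 'k) \<Rightarrow> (nat \<Rightarrow> 'k) \<Rightarrow> 'w set" where
  "label_event M n z zz = {\<omega>\<in>space M. \<forall>i\<in>{1..n}. z \<omega> i = zz i}"

definition data_event ::
  "'w measure \<Rightarrow> nat \<Rightarrow> ('w \<Rightarrow> nat \<Rightarrow> 'k) \<Rightarrow> ('w \<Rightarrow> adj) \<Rightarrow> adj \<Rightarrow> (nat \<Rightarrow> 'k) \<Rightarrow> 'w set" where
  "data_event M n z A aa zz = {\<omega>\<in>space M. A \<omega> = aa \<and> (\<forall>i\<in>{1..n}. z \<omega> i = zz i)}"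

context
  fixes M :: "'w measure" and n :: nat and \<pi> :: "'k::finite pmf" and \<theta> :: "real^'k^'k"
    and z :: "'w \<Rightarrow> nat \<Rightarrow> 'k" and A :: "'w \<Rightarrow> adj"
  assumes sbm: "sbm M n \<pi> \<theta> z A"
begin

lemma sbm_prob_space: "prob_space M"
  using sbm by (simp add: sbm_def)

lemma sbm_labels_indep: "prob_space.indep_vars M (\<lambda>_. count_space UNIV) (\<lambda>i \<omega>. z \<omega> i) {1..n}"
  using sbm by (simp add: sbm_def)

lemma sbm_label_measurable: "i \<in> {1..n} \<Longrightarrow> (\<lambda>\<omega>. z \<omega> i) \<in> M \<rightarrow>\<^sub>M count_space UNIV"
  using sbm_labels_indep unfolding prob_space.indep_vars_def2[OF sbm_prob_space] by blast

lemma sbm_edge_measurable: "(\<lambda>\<omega>. A \<omega> i j) \<in> M \<rightarrow>\<^sub>M count_space UNIV"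
  using sbm by (simp add: sbm_def)

lemma sbm_edgeD: "\<omega> \<in> space M \<Longrightarrow> A \<omega> i j \<Longrightarrow> i \<in> {1..n} \<and> j \<in> {1..n} \<and> i \<noteq> j \<and> A \<omega> j i"
  using sbm by (simp add: sbm_def)

lemma sbm_edges_indep:
  assumes "measure M (label_event M n z zz) > 0"
  shows "prob_space.indep_vars (uniform_measure M (label_event M n z zz)) (\<lambda>_. count_space UNIV)
    (\<lambda>(i, j) \<omega>. A \<omega> i j) {(i, j). 1 \<le> i \<and> i < j \<and> j \<le> n}"
  using sbm assms unfolding sbm_def Let_def label_event_def by blast

lemma sbm_edge_distr:
  assumes "measure M (label_event M n z zz) > 0" and "1 \<le> i" "i < j" "j \<le> n"
  shows "distr (uniform_measure M (label_event M n z zz)) (count_space UNIV) (\<lambda>\<omega>. A \<omega> i j)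
    = measure_pmf (bernoulli_pmf (\<theta> $ zz i $ zz j))"
  using sbm assms unfolding sbm_def Let_def label_event_def by blast

lemma label_event_sets: "label_event M n z zz \<in> sets M"
proof -
  note [measurable] = sbm_label_measurable
  have "label_event M n z zz = {\<omega>\<in>space M. \<forall>i\<in>{1..n}. z \<omega> i \<in> {zz i}}"
    by (auto simp: label_event_def)
  also have "\<dots> \<in> sets M" by (intro sets.sets_Collect_finite_All) measurable
  finally show ?thesis .
qed

lemma data_event_sets: "data_event M n z A aa zz \<in> sets M"
proof -
  note [measurable] = sbm_edge_measurable
  have "data_event M n z A aa zz = label_event M n z zz \<inter> {\<omega>\<in>space M. \<forall>i j. A \<omega> i j = aa i j}"
    by (auto simp: label_event_def data_event_def fun_eq_iff)
  also have "\<dots> \<in> sets M" by (intro sets.Int label_event_sets) measurable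
  finally show ?thesis .
qed

lemma data_event_cover:
  assumes "\<omega> \<in> space M"
  shows "\<omega> \<in> data_event M n z A (A \<omega>) (restrict (z \<omega>) {1..n})"
    and "A \<omega> \<in> adjacency_matrices n" and "restrict (z \<omega>) {1..n} \<in> labelings n"
  using assms sbm_edgeD[OF assms] by (auto simp: data_event_def adjacency_matrices_def labelings_def)

text \<open>
  Adjacency matrix and labels take finitely many values, so conditioning on both amounts to a finite
  partition of the sample space.
\<close>

lemma prob_eq_sum_data_events:
  assumes S: "S \<in> sets M"
  shows "measure M S = (\<Sum>(aa, zz)\<in>adjacency_matrices n \<times> labelings n. measure M (data_event M n z A aa zz \<inter> S))"
proof -
  interpret prob_space M by (rule sbm_prob_space)
  define D where "D = (\<lambda>(aa, zz). data_event M n z A aa zz \<inter> S)"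
  have eq: "S = (\<Union>p\<in>adjacency_matrices n \<times> labelings n. D p)"
  proof (intro equalityI subsetI)
    fix \<omega> assume "\<omega> \<in> S"
    moreover from this have "\<omega> \<in> space M" using S sets.sets_into_space by auto
    ultimately show "\<omega> \<in> (\<Union>p\<in>adjacency_matrices n \<times> labelings n. D p)"
      using data_event_cover[of \<omega>]
      by (intro UN_I[of "(A \<omega>, restrict (z \<omega>) {1..n})"]) (auto simp: D_def)
  qed (auto simp: D_def)
  have disj: "disjoint_family_on D (adjacency_matrices n \<times> labelings n)"
    unfolding disjoint_family_on_def
  proof (intro ballI impI)
    fix p p' :: "adj \<times> (nat \<Rightarrow> 'k)"
    assume "p \<in> adjacency_matrices n \<times> labelings n" "p' \<in> adjacency_matrices n \<times> labelings n"
      and ne: "p \<noteq> p'"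
    then obtain aa zz aa' zz' where p: "p = (aa, zz)" "p' = (aa', zz')"
      and zz: "zz \<in> labelings n" "zz' \<in> labelings n" by auto
    show "D p \<inter> D p' = {}"
    proof (rule ccontr)
      assume "D p \<inter> D p' \<noteq> {}"
      then have "aa = aa'" "\<And>i. i \<in> {1..n} \<Longrightarrow> zz i = zz' i"
        by (auto simp: D_def p data_event_def)
      moreover from this have "zz = zz'"
        using zz unfolding labelings_def by (intro PiE_ext) auto
      ultimately show False using ne p by simp
    qed
  qed
  have sets: "D ` (adjacency_matrices n \<times> labelings n) \<subseteq> sets M"
    using S data_event_sets by (auto simp: D_def)
  have "measure M S = (\<Sum>p\<in>adjacency_matrices n \<times> labelings n. measure M (D p))"
    using finite_measure_finite_Union[OF finite_cartesian_product[OF finite_adjacency_matrices finite_labelings] sets disj]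
    unfolding eq[symmetric] .
  then show ?thesis by (simp add: D_def case_prod_unfold)
qed

lemma data_property_sets:
  assumes "\<And>aa zz zz'. (\<And>i. i \<in> {1..n} \<Longrightarrow> zz i = zz' i) \<Longrightarrow> \<Phi> aa zz = \<Phi> aa zz'"
  shows "{\<omega>\<in>space M. \<Phi> (A \<omega>) (z \<omega>)} \<in> sets M"
proof -
  have "{\<omega>\<in>space M. \<Phi> (A \<omega>) (z \<omega>)}
    = (\<Union>p\<in>{p \<in> adjacency_matrices n \<times> labelings n. \<Phi> (fst p) (snd p)}. data_event M n z A (fst p) (snd p))"
  proof (intro equalityI subsetI)
    fix \<omega> assume w: "\<omega> \<in> {\<omega>\<in>space M. \<Phi> (A \<omega>) (z \<omega>)}"
    have "\<Phi> (A \<omega>) (z \<omega>) = \<Phi> (A \<omega>) (restrict (z \<omega>) {1..n})" by (intro assms) simp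
    with w show "\<omega> \<in> (\<Union>p\<in>{p \<in> adjacency_matrices n \<times> labelings n. \<Phi> (fst p) (snd p)}. data_event M n z A (fst p) (snd p))"
      using data_event_cover[of \<omega>] by (intro UN_I[of "(A \<omega>, restrict (z \<omega>) {1..n})"]) auto
  next
    fix \<omega> assume "\<omega> \<in> (\<Union>p\<in>{p \<in> adjacency_matrices n \<times> labelings n. \<Phi> (fst p) (snd p)}. data_event M n z A (fst p) (snd p))"
    then obtain aa zz where p: "\<Phi> aa zz" "\<omega> \<in> data_event M n z A aa zz" by auto
    then have "\<Phi> (A \<omega>) (z \<omega>) = \<Phi> aa zz"
      using assms[of "z \<omega>" zz aa] by (auto simp: data_event_def)
    with p show "\<omega> \<in> {\<omega>\<in>space M. \<Phi> (A \<omega>) (z \<omega>)}" by (auto simp: data_event_def)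
  qed
  also have "\<dots> \<in> sets M"
  proof (rule sets.finite_UN)
    show "finite {p \<in> adjacency_matrices n \<times> (labelings n :: (nat \<Rightarrow> 'k) set). \<Phi> (fst p) (snd p)}"
      by (rule rev_finite_subset[OF finite_cartesian_product[OF finite_adjacency_matrices finite_labelings]]) auto
  qed (rule data_event_sets)
  finally show ?thesis .
qed

text \<open>
  The law of total probability over the labels; label vectors of probability zero, for which nothing
  is known about the edges, do not contribute.
\<close>

lemma prob_le_if_label_events_le:
  assumes S: "S \<in> sets M" and e: "0 \<le> e"
    and le: "\<And>zz. measure M (label_event M n z zz) > 0 \<Longrightarrow>
      measure M (label_event M n z zz \<inter> S) \<le> e * measure M (label_event M n z zz)"
  shows "measure M S \<le> e"
proof -
  interpret prob_space M by (rule sbm_prob_space)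
  define D where "D T zz = label_event M n z zz \<inter> T" for T zz
  have sum: "measure M T = (\<Sum>zz\<in>labelings n. measure M (D T zz))" if T: "T \<in> sets M" for T
  proof -
    have eq: "T = (\<Union>zz\<in>labelings n. D T zz)"
    proof (intro equalityI subsetI)
      fix \<omega> assume "\<omega> \<in> T"
      moreover from this have "\<omega> \<in> space M" using T sets.sets_into_space by auto
      ultimately show "\<omega> \<in> (\<Union>zz\<in>labelings n. D T zz)"
        using data_event_cover[of \<omega>]
        by (intro UN_I[of "restrict (z \<omega>) {1..n}"]) (auto simp: D_def label_event_def)
    qed (auto simp: D_def)
    have disj: "disjoint_family_on (D T) (labelings n)"
      unfolding disjoint_family_on_def
    proof (intro ballI impI)
      fix zz zz' :: "nat \<Rightarrow> 'k" assume zz: "zz \<in> labelings n" "zz' \<in> labelings n" "zz \<noteq> zz'"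
      show "D T zz \<inter> D T zz' = {}"
      proof (rule ccontr)
        assume "D T zz \<inter> D T zz' \<noteq> {}"
        then have "\<And>i. i \<in> {1..n} \<Longrightarrow> zz i = zz' i" by (auto simp: D_def label_event_def)
        then have "zz = zz'" using zz unfolding labelings_def by (intro PiE_ext) auto
        with zz show False by simp
      qed
    qed
    have sets: "D T ` labelings n \<subseteq> sets M" using T label_event_sets by (auto simp: D_def)
    show ?thesis
      using finite_measure_finite_Union[OF finite_labelings sets disj] unfolding eq[symmetric] .
  qed
  have "measure M S \<le> (\<Sum>zz\<in>labelings n. e * measure M (D (space M) zz))"
    unfolding sum[OF S]
  proof (rule sum_mono)
    fix zz :: "nat \<Rightarrow> 'k"
    have "D (space M) zz = label_event M n z zz" by (auto simp: D_def label_event_def)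
    moreover have "measure M (D S zz) \<le> measure M (label_event M n z zz)"
      using label_event_sets by (intro finite_measure_mono) (auto simp: D_def)
    ultimately show "measure M (D S zz) \<le> e * measure M (D (space M) zz)"
      using le[of zz] measure_nonneg[of M "label_event M n z zz"]
      by (cases "measure M (label_event M n z zz) = 0") (auto simp: D_def)
  qed
  also have "\<dots> = e * measure M (space M)"
    by (simp add: sum[of "space M"] sum_distrib_left)
  finally show ?thesis by (simp add: prob_space)
qed

end

section \<open>Concentration of the cut norm and of the class frequencies\<close>

definition vertex_pairs :: "nat \<Rightarrow> (nat \<times> nat) set" where
  "vertex_pairs n = {(i, j). 1 \<le> i \<and> i < j \<and> j \<le> n}"

lemma finite_vertex_pairs: "finite (vertex_pairs n)"
  by (rule finite_subset[of _ "{1..n} \<times> {1..n}"]) (auto simp: vertex_pairs_def)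

lemma sum_square_split:
  fixes f :: "nat \<Rightarrow> nat \<Rightarrow> real"
  shows "(\<Sum>i\<in>{1..n}. \<Sum>j\<in>{1..n}. f i j)
    = (\<Sum>(i, j)\<in>vertex_pairs n. f i j + f j i) + (\<Sum>i\<in>{1..n}. f i i)"
proof -
  define F where "F = (\<lambda>(i, j). f i j)"
  have "{1..n} \<times> {1..n} = vertex_pairs n \<union> (prod.swap ` vertex_pairs n \<union> (\<lambda>i. (i, i)) ` {1..n})"
  proof (intro equalityI subsetI)
    fix p assume "p \<in> {1..n} \<times> {1..n}"
    then obtain i j where p: "p = (i, j)" "i \<in> {1..n}" "j \<in> {1..n}" by auto
    consider "i < j" | "j < i" | "i = j" by linarith
    then show "p \<in> vertex_pairs n \<union> (prod.swap ` vertex_pairs n \<union> (\<lambda>i. (i, i)) ` {1..n})"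
    proof cases
      case 2
      then have "p = prod.swap (j, i)" "(j, i) \<in> vertex_pairs n" using p by (auto simp: vertex_pairs_def)
      then show ?thesis by blast
    qed (use p in \<open>auto simp: vertex_pairs_def\<close>)
  qed (auto simp: vertex_pairs_def)
  moreover have "(\<Sum>i\<in>{1..n}. \<Sum>j\<in>{1..n}. f i j) = sum F ({1..n} \<times> {1..n})"
    by (simp add: F_def sum.cartesian_product)
  ultimately have "(\<Sum>i\<in>{1..n}. \<Sum>j\<in>{1..n}. f i j)
      = sum F (vertex_pairs n \<union> (prod.swap ` vertex_pairs n \<union> (\<lambda>i. (i, i)) ` {1..n}))"
    by simp
  also have "\<dots> = sum F (vertex_pairs n) + sum F (prod.swap ` vertex_pairs n \<union> (\<lambda>i. (i, i)) ` {1..n})"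
    using finite_vertex_pairs by (intro sum.union_disjoint) (auto simp: vertex_pairs_def)
  also have "sum F (prod.swap ` vertex_pairs n \<union> (\<lambda>i. (i, i)) ` {1..n})
      = sum F (prod.swap ` vertex_pairs n) + sum F ((\<lambda>i. (i, i)) ` {1..n})"
    using finite_vertex_pairs by (intro sum.union_disjoint) (auto simp: vertex_pairs_def)
  also have "sum F (prod.swap ` vertex_pairs n) = (\<Sum>(i, j)\<in>vertex_pairs n. f j i)"
    by (subst sum.reindex) (auto simp: F_def o_def case_prod_unfold intro!: sum.cong)
  also have "sum F ((\<lambda>i. (i, i)) ` {1..n}) = (\<Sum>i\<in>{1..n}. f i i)"
    by (subst sum.reindex) (auto simp: F_def inj_on_def)
  finally show ?thesis by (simp add: F_def case_prod_unfold sum.distrib)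
qed

lemma card_vertex_pairs_le: "real (card (vertex_pairs n)) \<le> (real n)\<^sup>2 / 2"
  using sum_square_split[of "\<lambda>_ _. 1" n] by (simp add: power2_eq_square case_prod_unfold)

text \<open>
  Given the labels, the edges are independent. For a fixed pair of sign vectors the Chernoff bound with
  parameter \<open>1 / (2 s)\<close>, \<open>s = sqrt (n \<alpha>)\<close>, gives \<open>exp (- 3 n)\<close> at the level \<open>(R + 6) n s\<close>: the variance
  term is \<open>n R / 2\<close> and the linear term is \<open>(R + 6) n / 2\<close>. A union over the \<open>4 ^ n\<close> pairs costs
  less than \<open>exp (2 n)\<close>. The diagonal, where no edges exist but the centring is subtracted all the same,
  contributes at most \<open>R n s\<close>.
\<close>

lemma sbm_cut_tail:
  fixes B :: "real^'k::finite^'k" and z :: "'w \<Rightarrow> nat \<Rightarrow> 'k"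
  assumes sbm: "sbm M n \<pi> (\<alpha> *\<^sub>R B) z A"
    and B: "\<And>a b. 0 \<le> B $ a $ b" "\<And>a b. B $ a $ b \<le> R" "transpose B = B"
    and \<theta>: "\<And>a b. \<alpha> * B $ a $ b \<le> 1"
    and \<alpha>: "0 < \<alpha>" "\<alpha> \<le> 1" "1 < real n * \<alpha>"
  shows "measure M {\<omega>\<in>space M. \<not> cut_bound {1..n} {1..n}
      (\<lambda>i j. of_bool (A \<omega> i j) - (\<alpha> *\<^sub>R B) $ z \<omega> i $ z \<omega> j)
      ((2 * R + 6) * (real n * sqrt (real n * \<alpha>)))} \<le> exp (- real n)"
    (is "measure M ?bad \<le> _")
proof (rule prob_le_if_label_events_le[OF sbm])
  define s where "s = sqrt (real n * \<alpha>)"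
  have s: "1 < s" "s\<^sup>2 = real n * \<alpha>" using \<alpha> by (auto simp: s_def)
  have R: "0 \<le> R" using B(1,2) order_trans by blast
  define T where "T = (R + 6) * (real n * s)"
  have Bsym: "B $ a $ b = B $ b $ a" for a b
    by (metis B(3) transpose_def vec_lambda_beta)
  show bad: "?bad \<in> sets M"
  proof (rule data_property_sets[OF sbm])
    fix aa and zz zz' :: "nat \<Rightarrow> 'k" assume "\<And>i. i \<in> {1..n} \<Longrightarrow> zz i = zz' i"
    then have "(\<Sum>i\<in>{1..n}. \<Sum>j\<in>{1..n}. (of_bool (aa i j) - (\<alpha> *\<^sub>R B) $ zz i $ zz j) * (f i * g j))
      = (\<Sum>i\<in>{1..n}. \<Sum>j\<in>{1..n}. (of_bool (aa i j) - (\<alpha> *\<^sub>R B) $ zz' i $ zz' j) * (f i * g j))" for f g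
      by (intro sum.cong refl) auto
    then show "(\<not> cut_bound {1..n} {1..n} (\<lambda>i j. of_bool (aa i j) - (\<alpha> *\<^sub>R B) $ zz i $ zz j)
        ((2 * R + 6) * (real n * sqrt (real n * \<alpha>))))
      = (\<not> cut_bound {1..n} {1..n} (\<lambda>i j. of_bool (aa i j) - (\<alpha> *\<^sub>R B) $ zz' i $ zz' j)
        ((2 * R + 6) * (real n * sqrt (real n * \<alpha>))))"
      by (simp add: cut_bound_def)
  qed
  show "0 \<le> exp (- real n)" by simp
  fix zz :: "nat \<Rightarrow> 'k"
  define E where "E = label_event M n z zz"
  assume pos: "0 < measure M (label_event M n z zz)"
  define \<nu> where "\<nu> = uniform_measure M E"
  interpret M: prob_space M by (rule sbm_prob_space[OF sbm])
  have E: "E \<in> sets M" unfolding E_def by (rule label_event_sets[OF sbm])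
  have Epos: "emeasure M E \<noteq> 0" "emeasure M E \<noteq> \<infinity>"
    using pos by (auto simp: E_def M.emeasure_eq_measure)
  interpret \<nu>: prob_space \<nu> unfolding \<nu>_def by (rule prob_space_uniform_measure[OF Epos])
  have sets_\<nu>: "sets \<nu> = sets M" and space_\<nu>: "space \<nu> = space M" by (auto simp: \<nu>_def)
  define Y where "Y = (\<lambda>(i, j) \<omega>. A \<omega> i j)"
  define q where "q = (\<lambda>(i, j). \<alpha> * B $ zz i $ zz j)"
  have indep: "\<nu>.indep_vars (\<lambda>_. count_space UNIV) Y (vertex_pairs n)"
    using sbm_edges_indep[OF sbm pos] unfolding \<nu>_def E_def Y_def vertex_pairs_def .
  have distr: "distr \<nu> (count_space UNIV) (Y p) = measure_pmf (bernoulli_pmf (q p))"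
    if "p \<in> vertex_pairs n" for p
    using that sbm_edge_distr[OF sbm pos, of "fst p" "snd p"]
    by (auto simp: vertex_pairs_def Y_def q_def \<nu>_def E_def)
  have Ymeas: "Y p \<in> \<nu> \<rightarrow>\<^sub>M count_space UNIV" if "p \<in> vertex_pairs n" for p
    using indep that unfolding \<nu>.indep_vars_def by auto
  define Sg where "Sg = {1..n} \<rightarrow>\<^sub>E {-1, 1 :: real}"
  have Sg: "finite Sg" "card Sg = 2 ^ n"
    by (auto simp: Sg_def card_PiE numeral_2_eq_2 intro: finite_PiE)
  \<comment> \<open>Each edge occurs twice in the symmetric matrix, whence two products of signs.\<close>
  define x where "x f g = (\<lambda>(i, j). f i * g j + f j * g i :: real)" for f g :: "nat \<Rightarrow> real"
  define Ev where "Ev f g = {\<omega>\<in>space \<nu>. (\<Sum>p\<in>vertex_pairs n. (of_bool (Y p \<omega>) - q p) * x f g p) \<ge> T}" for f g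
  have Ev_sets: "Ev f g \<in> sets \<nu>" for f g
  proof -
    have "(\<lambda>\<omega>. \<Sum>p\<in>vertex_pairs n. (of_bool (Y p \<omega>) - q p) * x f g p) \<in> borel_measurable \<nu>"
      by (intro borel_measurable_sum borel_measurable_times borel_measurable_diff
          measurable_compose[OF Ymeas] borel_measurable_const) auto
    then show ?thesis unfolding Ev_def by measurable
  qed
  have Ev_prob: "measure \<nu> (Ev f g) \<le> exp (- 3 * real n)" if fg: "f \<in> Sg" "g \<in> Sg" for f g
  proof -
    define l where "l = 1 / (2 * s)"
    have l: "0 < l" "l \<le> 1/2" using s by (auto simp: l_def field_simps)
    have "\<bar>f i\<bar> = 1" "\<bar>g i\<bar> = 1" if "i \<in> {1..n}" for i
      using PiE_mem[OF fg(1)[unfolded Sg_def] that] PiE_mem[OF fg(2)[unfolded Sg_def] that] by auto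
    then have "\<bar>x f g p\<bar> \<le> 2" if "p \<in> vertex_pairs n" for p
      using that abs_triangle_ineq[of "f (fst p) * g (snd p)" "f (snd p) * g (fst p)"]
      by (auto simp: x_def vertex_pairs_def abs_mult)
    then have "measure \<nu> (Ev f g) \<le> exp (4 * l\<^sup>2 * (\<Sum>p\<in>vertex_pairs n. q p) - l * T)"
      unfolding Ev_def using finite_vertex_pairs indep distr l B \<theta> \<alpha>
      by (intro \<nu>.bernoulli_sum_tail) (auto simp: q_def)
    also have "\<dots> \<le> exp (- 3 * real n)"
    proof -
      have "(\<Sum>p\<in>vertex_pairs n. q p) \<le> (\<Sum>p\<in>vertex_pairs n. \<alpha> * R)"
        using B \<alpha> by (intro sum_mono) (auto simp: q_def)
      also have "\<dots> \<le> (real n)\<^sup>2 / 2 * (\<alpha> * R)"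
        using mult_right_mono[OF card_vertex_pairs_le[of n], of "\<alpha> * R"] \<alpha> R by simp
      also have "\<dots> = real n * R / 2 * s\<^sup>2" unfolding s(2) by (simp add: power2_eq_square)
      finally have "4 * l\<^sup>2 * (\<Sum>p\<in>vertex_pairs n. q p) \<le> 4 * l\<^sup>2 * (real n * R / 2 * s\<^sup>2)"
        by (intro mult_left_mono) auto
      also have "\<dots> = real n * R / 2" using s(1) by (simp add: l_def power_divide power_mult_distrib)
      finally have "4 * l\<^sup>2 * (\<Sum>p\<in>vertex_pairs n. q p) \<le> real n * R / 2" .
      moreover have "l * T = (R + 6) * real n / 2" using s by (simp add: l_def T_def)
      ultimately show ?thesis by (simp add: algebra_simps)
    qed
    finally show ?thesis .
  qed
  have sub: "E \<inter> ?bad \<subseteq> (\<Union>f\<in>Sg. \<Union>g\<in>Sg. Ev f g)"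
  proof
    fix \<omega> assume w: "\<omega> \<in> E \<inter> ?bad"
    then have sp: "\<omega> \<in> space M" by auto
    have zw: "z \<omega> i = zz i" if "i \<in> {1..n}" for i using w that by (auto simp: E_def label_event_def)
    define W where "W i j = of_bool (A \<omega> i j) - (\<alpha> *\<^sub>R B) $ z \<omega> i $ z \<omega> j" for i j
    obtain f g :: "nat \<Rightarrow> real" where f: "\<forall>i. f i \<in> {-1, 1}" and g: "\<forall>j. g j \<in> {-1, 1}"
      and big: "(\<Sum>i\<in>{1..n}. \<Sum>j\<in>{1..n}. W i j * (f i * g j)) > (2 * R + 6) * (real n * s)"
      using w unfolding cut_bound_def W_def s_def by (auto simp: not_le)
    define f' where "f' = restrict f {1..n}"
    define g' where "g' = restrict g {1..n}"
    have fg': "f' \<in> Sg" "g' \<in> Sg" using f g by (auto simp: f'_def g'_def Sg_def)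
    have Wsym: "W i j = W j i" for i j
      using sbm_edgeD[OF sbm sp, of i j] sbm_edgeD[OF sbm sp, of j i] Bsym[of "z \<omega> i" "z \<omega> j"]
      by (auto simp: W_def)
    have "(\<Sum>i\<in>{1..n}. \<Sum>j\<in>{1..n}. W i j * (f i * g j))
      = (\<Sum>(i, j)\<in>vertex_pairs n. W i j * (f i * g j) + W j i * (f j * g i))
        + (\<Sum>i\<in>{1..n}. W i i * (f i * g i))"
      by (rule sum_square_split)
    also have "(\<Sum>(i, j)\<in>vertex_pairs n. W i j * (f i * g j) + W j i * (f j * g i))
      = (\<Sum>p\<in>vertex_pairs n. (of_bool (Y p \<omega>) - q p) * x f' g' p)"
    proof (intro sum.cong refl)
      fix p assume p: "p \<in> vertex_pairs n"
      obtain i j where ij: "p = (i, j)" "i \<in> {1..n}" "j \<in> {1..n}"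
        using p by (auto simp: vertex_pairs_def)
      have xW: "W i j * (f i * g j) + W j i * (f j * g i) = W i j * x f' g' p"
        using ij Wsym[of j i] by (simp add: x_def f'_def g'_def algebra_simps)
      have "W i j = of_bool (Y p \<omega>) - q p" using ij zw by (simp add: W_def Y_def q_def)
      with xW show "(case p of (i, j) \<Rightarrow> W i j * (f i * g j) + W j i * (f j * g i))
        = (of_bool (Y p \<omega>) - q p) * x f' g' p"
        by (simp only: ij(1) prod.case)
    qed
    also have "(\<Sum>i\<in>{1..n}. W i i * (f i * g i)) \<le> (\<Sum>i\<in>{1..n}. R * s)"
    proof (intro sum_mono)
      fix i assume "i \<in> {1..n}"
      have "W i i = - (\<alpha> * B $ z \<omega> i $ z \<omega> i)"
        using sbm_edgeD[OF sbm sp, of i i] by (auto simp: W_def)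
      moreover have "f i * g i \<in> {-1, 1}" using f g by (metis insert_iff mult_1 mult_minus1 empty_iff minus_minus)
      ultimately have "W i i * (f i * g i) \<le> \<alpha> * B $ z \<omega> i $ z \<omega> i"
        using B(1) \<alpha>(1) by auto
      also have "\<dots> \<le> s * R" using B \<alpha> s by (intro mult_mono) auto
      finally show "W i i * (f i * g i) \<le> R * s" by (simp add: mult_ac)
    qed
    finally have "(2 * R + 6) * (real n * s) < (\<Sum>p\<in>vertex_pairs n. (of_bool (Y p \<omega>) - q p) * x f' g' p) + real n * (R * s)"
      using big by simp
    then have "\<omega> \<in> Ev f' g'" using sp by (simp add: Ev_def T_def space_\<nu> algebra_simps)
    then show "\<omega> \<in> (\<Union>f\<in>Sg. \<Union>g\<in>Sg. Ev f g)" using fg' by blast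
  qed
  have "measure \<nu> (E \<inter> ?bad) \<le> measure \<nu> (\<Union>f\<in>Sg. \<Union>g\<in>Sg. Ev f g)"
    using sub Sg(1) Ev_sets by (intro \<nu>.finite_measure_mono sets.finite_UN) auto
  also have "\<dots> \<le> (\<Sum>f\<in>Sg. measure \<nu> (\<Union>g\<in>Sg. Ev f g))"
    using Sg(1) Ev_sets by (intro \<nu>.finite_measure_subadditive_finite) auto
  also have "\<dots> \<le> (\<Sum>f\<in>Sg. \<Sum>g\<in>Sg. measure \<nu> (Ev f g))"
    using Sg(1) Ev_sets by (intro sum_mono \<nu>.finite_measure_subadditive_finite) auto
  also have "\<dots> \<le> (\<Sum>f\<in>Sg. \<Sum>g\<in>Sg. exp (- 3 * real n))"
    using Ev_prob by (intro sum_mono) auto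
  also have "\<dots> = (2 ^ n * 2 ^ n) * exp (- 3 * real n)" by (simp add: Sg)
  also have "\<dots> \<le> (exp 1 ^ n * exp 1 ^ n) * exp (- 3 * real n)"
    using exp_ge_add_one_self[of 1] by (intro mult_right_mono mult_mono power_mono) auto
  also have "\<dots> = exp (- real n)"
    by (simp flip: exp_of_nat_mult exp_add)
  finally have "measure \<nu> (E \<inter> ?bad) \<le> exp (- real n)" .
  moreover have "measure \<nu> (E \<inter> ?bad) = measure M (E \<inter> ?bad) / measure M E"
    unfolding \<nu>_def using E bad by (simp add: measure_uniform_measure[OF Epos] Int_absorb1)
  ultimately show "measure M (label_event M n z zz \<inter> ?bad) \<le> exp (- real n) * measure M (label_event M n z zz)"
    using pos by (simp add: E_def divide_le_eq)
qed

lemma class_freq_tail: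
  fixes z :: "'w \<Rightarrow> nat \<Rightarrow> 'k::finite"
  assumes sbm: "sbm M n \<pi> \<theta> z A" and n: "0 < n" and \<kappa>: "0 < \<kappa>"
  shows "measure M {\<omega>\<in>space M. \<exists>a. \<bar>class_freq n (z \<omega>) a - pmf \<pi> a\<bar> > \<kappa>}
    \<le> real CARD('k) * (2 * exp (- 2 * real n * \<kappa>\<^sup>2))"
proof -
  interpret prob_space M by (rule sbm_prob_space[OF sbm])
  note lab = sbm_label_measurable[OF sbm]
  define Ev where "Ev a = {\<omega>\<in>space M. \<bar>(\<Sum>i\<in>{1..n}. of_bool (z \<omega> i = a)) - (\<Sum>i\<in>{1..n}. pmf \<pi> a)\<bar> \<ge> real n * \<kappa>}" for a
  have meas: "(\<lambda>\<omega>. of_bool (z \<omega> i = a) :: real) \<in> borel_measurable M" if "i \<in> {1..n}" for i a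
    by (rule measurable_compose[OF lab[OF that]]) simp
  have expect: "expectation (\<lambda>\<omega>. of_bool (z \<omega> i = a)) = pmf \<pi> a" if i: "i \<in> {1..n}" for i a
  proof -
    have "expectation (\<lambda>\<omega>. of_bool (z \<omega> i = a) :: real) = integral\<^sup>L (distr M (count_space UNIV) (\<lambda>\<omega>. z \<omega> i)) (\<lambda>k. of_bool (k = a))"
      using integral_distr[OF lab[OF i], of "\<lambda>k. of_bool (k = a) :: real"] by simp
    also have "distr M (count_space UNIV) (\<lambda>\<omega>. z \<omega> i) = measure_pmf \<pi>"
      using sbm i by (simp add: sbm_def)
    also have "integral\<^sup>L (measure_pmf \<pi>) (\<lambda>k. of_bool (k = a)) = measure_pmf.expectation \<pi> (indicator {a})"
      by (intro Bochner_Integration.integral_cong) (auto simp: indicator_def)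
    finally show ?thesis by (simp add: pmf.rep_eq)
  qed
  have Ev_prob: "prob (Ev a) \<le> 2 * exp (- 2 * real n * \<kappa>\<^sup>2)" for a
  proof -
    interpret Hoeffding_ineq M "{1..n}" "\<lambda>i \<omega>. of_bool (z \<omega> i = a)" "\<lambda>_. 0" "\<lambda>_. 1" "\<Sum>i\<in>{1..n}. pmf \<pi> a"
    proof unfold_locales
      show "indep_vars (\<lambda>_. borel) (\<lambda>i \<omega>. of_bool (z \<omega> i = a) :: real) {1..n}"
        by (rule indep_vars_compose2[OF sbm_labels_indep[OF sbm]]) simp
      show "(\<Sum>i\<in>{1..n}. pmf \<pi> a) \<equiv> (\<Sum>i\<in>{1..n}. expectation (\<lambda>\<omega>. of_bool (z \<omega> i = a)))"
        by (intro eq_reflection sum.cong refl) (simp only: expect)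
    qed auto
    have "prob (Ev a) \<le> 2 * exp (- 2 * (real n * \<kappa>)\<^sup>2 / (\<Sum>i\<in>{1..n}. (1 - 0)\<^sup>2))"
      unfolding Ev_def using n \<kappa> by (intro Hoeffding_ineq_abs_ge) auto
    also have "- 2 * (real n * \<kappa>)\<^sup>2 / (\<Sum>i\<in>{1..n}. (1 - 0)\<^sup>2) = - 2 * real n * \<kappa>\<^sup>2"
      using n by (simp add: power2_eq_square)
    finally show ?thesis .
  qed
  have Ev_sets: "Ev a \<in> sets M" for a
  proof -
    have "(\<lambda>\<omega>. \<Sum>i\<in>{1..n}. of_bool (z \<omega> i = a) :: real) \<in> borel_measurable M"
      using meas by (intro borel_measurable_sum)
    then show ?thesis unfolding Ev_def by measurable
  qed
  have "{\<omega>\<in>space M. \<exists>a. \<bar>class_freq n (z \<omega>) a - pmf \<pi> a\<bar> > \<kappa>} \<subseteq> (\<Union>a\<in>UNIV. Ev a)"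
  proof safe
    fix \<omega> a assume w: "\<omega> \<in> space M" and gt: "\<kappa> < \<bar>class_freq n (z \<omega>) a - pmf \<pi> a\<bar>"
    have "(\<Sum>i\<in>{1..n}. of_bool (z \<omega> i = a)) - (\<Sum>i\<in>{1..n}. pmf \<pi> a) = real n * (class_freq n (z \<omega>) a - pmf \<pi> a)"
      using n by (simp add: class_freq_def right_diff_distrib del: sum_of_bool_eq)
    then have "\<omega> \<in> Ev a" using w gt by (simp add: Ev_def abs_mult mult_left_mono del: sum_of_bool_eq)
    then show "\<omega> \<in> (\<Union>a\<in>UNIV. Ev a)" by blast
  qed
  then have "prob {\<omega>\<in>space M. \<exists>a. \<bar>class_freq n (z \<omega>) a - pmf \<pi> a\<bar> > \<kappa>} \<le> prob (\<Union>a\<in>UNIV. Ev a)"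
    using Ev_sets by (intro finite_measure_mono sets.finite_UN) auto
  also have "\<dots> \<le> (\<Sum>a\<in>UNIV. prob (Ev a))"
    using Ev_sets by (intro finite_measure_subadditive_finite) auto
  also have "\<dots> \<le> (\<Sum>a\<in>(UNIV :: 'k set). 2 * exp (- 2 * real n * \<kappa>\<^sup>2))"
    by (intro sum_mono Ev_prob)
  finally show ?thesis by simp
qed

section \<open>Off-class mass of the solution on a likely event\<close>

text \<open>
  On such data every solution of the program has off-class mass at most \<open>r * n\<^sup>2\<close>. Quantifying over all
  solutions makes this a property of the observed graph and the labels alone, hence an event.
\<close>

definition good_data :: "nat \<Rightarrow> real^'k^'k \<Rightarrow> real^'k^'k \<Rightarrow> real \<Rightarrow> adj \<Rightarrow> (nat \<Rightarrow> 'k::finite) \<Rightarrow> bool" where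
  "good_data n Bstar Bhat r aa zz \<longleftrightarrow>
     in_unit_interior (theta_hat n aa Bhat) \<and>
     (\<forall>X. sdp_solution n aa (theta_hat n aa Bhat) X \<longrightarrow> off_mass n Bstar zz X \<le> r * (real n)\<^sup>2)"

lemma good_data_cong:
  assumes "\<And>i. i \<in> {1..n} \<Longrightarrow> zz i = zz' i"
  shows "good_data n Bstar Bhat r aa zz = good_data n Bstar Bhat r aa zz'"
proof -
  have "off_mass n Bstar zz X = off_mass n Bstar zz' X" for X
    unfolding off_mass_def using assms by (intro sum.cong refl) auto
  then show ?thesis by (simp add: good_data_def)
qed

text \<open>
  If the centred adjacency matrix has cut norm \<open>C n s\<close> with \<open>s = sqrt (n \<alpha>)\<close>, then the loss bound reads
  \<open>\<alpha> \<delta> off_mass \<le> 16 C n s D K\<^sup>2\<close>, and \<open>n s / \<alpha> = n\<^sup>2 / s\<close>. The cut norm also controls the relative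
  error of the density estimate, up to \<open>2 C / s\<close>; this is small only when \<open>s\<close> is large, which explains
  the hypothesis \<open>C1 < s\<close> and the summand \<open>8 C / \<eta>\<close> of \<open>C1\<close>.
\<close>

lemma good_data_criterion:
  fixes \<pi> :: "'k::finite pmf" and Bstar Bhat :: "real^'k^'k"
  assumes Bstar: "\<And>a b. 0 \<le> Bstar $ a $ b" and Bhat: "\<And>a b. 0 < Bhat $ a $ b"
    and norm: "(\<Sum>a\<in>UNIV. \<Sum>b\<in>UNIV. pmf \<pi> a * pmf \<pi> b * Bstar $ a $ b) = 1"
    and Q: "\<And>a b. Qset Bhat a b = Qset Bstar a b"
    and gap: "\<And>a b c d. (c, d) \<notin> Qset Bstar a b \<Longrightarrow>
        Bstar $ a $ b * ln (Bhat $ a $ b / Bhat $ c $ d) - (Bhat $ a $ b - Bhat $ c $ d) > 0"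
    and C: "0 \<le> C"
  obtains C1 \<kappa> \<alpha>0 N where "0 < C1" "0 < \<kappa>" "0 < \<alpha>0"
    and "\<And>n \<alpha> A zz. N \<le> n \<Longrightarrow> 0 < \<alpha> \<Longrightarrow> \<alpha> \<le> \<alpha>0 \<Longrightarrow> C1 < sqrt (real n * \<alpha>) \<Longrightarrow>
      cut_bound {1..n} {1..n} (\<lambda>i j. of_bool (A i j) - (\<alpha> *\<^sub>R Bstar) $ zz i $ zz j)
        (C * (real n * sqrt (real n * \<alpha>))) \<Longrightarrow>
      (\<And>a. \<bar>class_freq n zz a - pmf \<pi> a\<bar> \<le> \<kappa>) \<Longrightarrow>
      good_data n Bstar Bhat (C1 / sqrt (real n * \<alpha>)) A zz"
proof -
  obtain \<delta> \<eta> \<alpha>0 D where c: "0 < \<delta>" "0 < \<eta>" "\<eta> \<le> 1/2" "0 < \<alpha>0" "0 < D"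
    and inner: "\<And>\<alpha> \<rho>. 0 < \<alpha> \<Longrightarrow> \<alpha> \<le> \<alpha>0 \<Longrightarrow> \<bar>\<rho> - 1\<bar> \<le> \<eta> \<Longrightarrow> in_unit_interior ((\<rho> * \<alpha>) *\<^sub>R Bhat)"
    and D: "\<And>\<alpha> \<rho> a b. 0 < \<alpha> \<Longrightarrow> \<alpha> \<le> \<alpha>0 \<Longrightarrow> \<bar>\<rho> - 1\<bar> \<le> \<eta> \<Longrightarrow>
      \<bar>ln (((\<rho> * \<alpha>) *\<^sub>R Bhat) $ a $ b) - ln (1 - ((\<rho> * \<alpha>) *\<^sub>R Bhat) $ a $ b) - ln (\<rho> * \<alpha>)\<bar> \<le> D"
    and gain: "\<And>\<alpha> \<rho> a b c d. 0 < \<alpha> \<Longrightarrow> \<alpha> \<le> \<alpha>0 \<Longrightarrow> \<bar>\<rho> - 1\<bar> \<le> \<eta> \<Longrightarrow> (c, d) \<notin> Qset Bstar a b \<Longrightarrow>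
      \<alpha> * \<delta> \<le> log_gain (\<alpha> *\<^sub>R Bstar) ((\<rho> * \<alpha>) *\<^sub>R Bhat) a b c d"
    by (rule log_gain_uniform[OF Bstar Bhat gap]) blast+
  define SB where "SB = (\<Sum>a\<in>UNIV. \<Sum>b\<in>UNIV. Bstar $ a $ b)"
  have SB: "0 \<le> SB" unfolding SB_def using Bstar by (intro sum_nonneg)
  define \<kappa> where "\<kappa> = \<eta> / (16 * (SB + 1))"
  have \<kappa>: "0 < \<kappa>" using c SB by (simp add: \<kappa>_def)
  have \<kappa>SB: "4 * \<kappa> * SB \<le> \<eta> / 4"
  proof -
    have "4 * \<kappa> * SB \<le> 4 * \<kappa> * (SB + 1)" using \<kappa> by simp
    also have "\<dots> = \<eta> / 4" using SB by (simp add: \<kappa>_def field_simps)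
    finally show ?thesis .
  qed
  define K2 where "K2 = (real CARD('k))\<^sup>2"
  define C1 where "C1 = 16 * C * D * K2 / \<delta> + 8 * C / \<eta> + 1"
  define N where "N = nat \<lceil>4 / \<eta>\<rceil> + 2"
  have parts: "0 \<le> 16 * C * D * K2 / \<delta>" "0 \<le> 8 * C / \<eta>" using c C by (auto simp: K2_def)
  show thesis
  proof (rule that[of C1 \<kappa> \<alpha>0 N])
    show "0 < C1" using parts by (simp add: C1_def)
    fix n \<alpha> A and zz :: "nat \<Rightarrow> 'k"
    assume n: "N \<le> n" and \<alpha>: "0 < \<alpha>" "\<alpha> \<le> \<alpha>0" and s1: "C1 < sqrt (real n * \<alpha>)"
      and cut: "cut_bound {1..n} {1..n} (\<lambda>i j. of_bool (A i j) - (\<alpha> *\<^sub>R Bstar) $ zz i $ zz j)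
        (C * (real n * sqrt (real n * \<alpha>)))"
      and freq: "\<And>a. \<bar>class_freq n zz a - pmf \<pi> a\<bar> \<le> \<kappa>"
    define s where "s = sqrt (real n * \<alpha>)"
    have n2: "2 \<le> n" using n by (simp add: N_def)
    have s: "C1 < s" "0 < s" "s * s = real n * \<alpha>" using s1 \<alpha> n2 by (auto simp: s_def)
    define \<rho> where "\<rho> = alpha_hat n A / \<alpha>"
    have \<theta>: "theta_hat n A Bhat = (\<rho> * \<alpha>) *\<^sub>R Bhat" using \<alpha> by (simp add: theta_hat_def \<rho>_def)
    have "\<bar>\<rho> - 1\<bar> \<le> 2 * (C * (real n * s)) / (\<alpha> * (real n)\<^sup>2) + 4 * \<kappa> * SB + 1 / (real n - 1)"
      unfolding \<rho>_def SB_def s_def by (rule alpha_hat_close[OF n2 \<alpha>(1) Bstar norm cut freq])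
    also have "2 * (C * (real n * s)) / (\<alpha> * (real n)\<^sup>2) = 2 * C * s / (s * s)"
      using s(3) n2 \<alpha> by (simp add: power2_eq_square mult_ac)
    also have "\<dots> \<le> \<eta> / 4"
    proof -
      have "8 * C / \<eta> \<le> s" using s(1) parts by (simp add: C1_def)
      then show ?thesis using c s(2) by (simp add: field_simps)
    qed
    also have "4 * \<kappa> * SB \<le> \<eta> / 4" by (rule \<kappa>SB)
    also have "1 / (real n - 1) \<le> \<eta> / 4"
    proof -
      have "4 / \<eta> \<le> real n - 1" using n unfolding N_def by linarith
      then show ?thesis using c n2 by (simp add: field_simps)
    qed
    finally have \<rho>: "\<bar>\<rho> - 1\<bar> \<le> \<eta>" using c by simp
    have "off_mass n Bstar zz X \<le> C1 / s * (real n)\<^sup>2"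
      if X: "sdp_solution n A (theta_hat n A Bhat) X" for X
    proof -
      have same: "((\<rho> * \<alpha>) *\<^sub>R Bhat) $ c $ d = ((\<rho> * \<alpha>) *\<^sub>R Bhat) $ a $ b"
        if "(c, d) \<in> Qset Bstar a b" for a b c d
        using that Q[of a b] by (auto simp: Qset_def)
      have "\<alpha> * \<delta> * off_mass n Bstar zz X \<le> 16 * (C * (real n * s)) * D * K2"
        unfolding K2_def
        using X[unfolded \<theta>] cut[folded s_def] same gain[OF \<alpha> \<rho>] D[OF \<alpha> \<rho>] by (rule off_mass_le)
      also have "\<dots> = \<alpha> * \<delta> * ((16 * C * D * K2 / \<delta>) / s * (real n)\<^sup>2)"
      proof -
        have "\<alpha> * ((16 * C * D * K2 / \<delta>) / s * (real n)\<^sup>2) * \<delta> = (16 * C * D * K2) * real n * (real n * \<alpha>) / s"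
          using c(1) by (simp add: power2_eq_square mult_ac)
        also have "\<dots> = 16 * (C * (real n * s)) * D * K2"
          unfolding s(3)[symmetric] using s(2) by (simp add: mult_ac)
        finally show ?thesis by (simp add: mult_ac)
      qed
      also have "\<dots> \<le> \<alpha> * \<delta> * (C1 / s * (real n)\<^sup>2)"
        using \<alpha> c s parts
        by (intro mult_left_mono mult_right_mono divide_right_mono) (auto simp: C1_def)
      finally show ?thesis
        using mult_pos_pos[OF \<alpha>(1) c(1)] by (simp only: mult_le_cancel_left_pos)
    qed
    then show "good_data n Bstar Bhat (C1 / sqrt (real n * \<alpha>)) A zz"
      using inner[OF \<alpha> \<rho>] by (simp add: good_data_def \<theta> s_def)
  qed (use c \<kappa> in auto)
qed

section \<open>From off-class mass to estimation error\<close>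

lemma error_rate_le_1: "error_rate n \<theta> zz P \<le> 1"
proof -
  have "(\<Sum>i\<in>{1..n}. \<Sum>j\<in>{1..n}. of_bool (P i j \<noteq> \<theta> $ zz i $ zz j)) \<le> (\<Sum>i\<in>{1..n}. \<Sum>j\<in>{1..n}. 1 :: real)"
    by (intro sum_mono) auto
  then show ?thesis by (cases "n = 0") (auto simp: error_rate_def power2_eq_square divide_le_eq)
qed

lemma error_rate_nonneg: "0 \<le> error_rate n \<theta> zz P"
  by (simp add: error_rate_def sum_nonneg)

lemma error_rate_mult: "0 < n \<Longrightarrow> (real n)\<^sup>2 * error_rate n \<theta> zz P
    = (\<Sum>i\<in>{1..n}. \<Sum>j\<in>{1..n}. of_bool (P i j \<noteq> \<theta> $ zz i $ zz j))"
  by (simp add: error_rate_def)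

text \<open>
  Given the data, this is the probability that the randomized estimate errs at \<open>(i, j)\<close>.
\<close>

definition block_off_mass :: "real^'k^'k \<Rightarrow> (nat \<Rightarrow> 'k) \<Rightarrow> 'k::finite bmat \<Rightarrow> nat \<Rightarrow> nat \<Rightarrow> real" where
  "block_off_mass B zz X i j =
     (\<Sum>a\<in>UNIV. \<Sum>b\<in>UNIV. of_bool ((a, b) \<notin> Qset B (zz i) (zz j)) * X (i, a) (j, b))"

lemma off_mass_blocks: "off_mass n B zz X = (\<Sum>i\<in>{1..n}. \<Sum>j\<in>{1..n}. block_off_mass B zz X i j)"
  by (simp add: off_mass_def block_off_mass_def)

lemma block_off_mass_eq:
  assumes X: "sdp_feasible n X" "i \<in> {1..n}" "j \<in> {1..n}"
    and Q: "\<And>a b c d. \<theta> $ c $ d = \<theta> $ a $ b \<longleftrightarrow> (c, d) \<in> Qset B a b"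
  shows "block_off_mass B zz X i j
    = 1 - (\<Sum>a\<in>UNIV. \<Sum>b\<in>UNIV. X (i, a) (j, b) * of_bool (\<theta> $ a $ b = \<theta> $ zz i $ zz j))"
proof -
  have "block_off_mass B zz X i j + (\<Sum>a\<in>UNIV. \<Sum>b\<in>UNIV. X (i, a) (j, b) * of_bool (\<theta> $ a $ b = \<theta> $ zz i $ zz j))
    = (\<Sum>a\<in>UNIV. \<Sum>b\<in>UNIV. X (i, a) (j, b))"
    unfolding block_off_mass_def sum.distrib[symmetric] Q by (intro sum.cong refl) simp
  then show ?thesis using feasible_block_sum[OF X] by simp
qed

lemma block_off_mass_nonneg:
  assumes "sdp_feasible n X" "i \<in> {1..n}" "j \<in> {1..n}"
  shows "0 \<le> block_off_mass B zz X i j"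
  unfolding block_off_mass_def using feasible_block_nonneg[OF assms] by (intro sum_nonneg) simp

text \<open>
  If the estimate differs from the true value \<open>t\<close>, then the mass at \<open>t\<close> is at most the mass at another
  value, hence at most \<open>1 / 2\<close>, and the off-class mass of the block is at least \<open>1 / 2\<close>.
\<close>

lemma map_estimate_error_le:
  fixes X :: "'k::finite bmat"
  assumes X: "sdp_feasible n X" and int: "in_unit_interior \<theta>"
    and Q: "\<And>a b c d. \<theta> $ c $ d = \<theta> $ a $ b \<longleftrightarrow> (c, d) \<in> Qset B a b"
    and P: "map_estimate n \<theta> X P" and n: "0 < n"
  shows "(real n)\<^sup>2 * error_rate n \<theta> zz P \<le> 2 * off_mass n B zz X"
  unfolding error_rate_mult[OF n] off_mass_blocks sum_distrib_left
proof (intro sum_mono)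
  fix i j assume ij: "i \<in> {1..n}" "j \<in> {1..n}"
  define m where "m t = (\<Sum>a\<in>UNIV. \<Sum>b\<in>UNIV. X (i, a) (j, b) * of_bool (\<theta> $ a $ b = t))" for t
  define t where "t = \<theta> $ zz i $ zz j"
  have off: "block_off_mass B zz X i j = 1 - m t"
    unfolding m_def t_def by (rule block_off_mass_eq[OF X ij Q])
  show "of_bool (P i j \<noteq> \<theta> $ zz i $ zz j) \<le> 2 * block_off_mass B zz X i j"
  proof (cases "P i j = t")
    case False
    have "is_arg_max m (\<lambda>t. t \<in> {0..1}) (P i j)"
      using P ij unfolding map_estimate_def m_def[abs_def] by blast
    moreover have "t \<in> {0..1}"
      using int by (simp add: in_unit_interior_def t_def less_imp_le)
    ultimately have "m t \<le> m (P i j)" by (auto simp: is_arg_max_def not_less)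
    moreover have "m t + m (P i j) \<le> (\<Sum>a\<in>UNIV. \<Sum>b\<in>UNIV. X (i, a) (j, b))"
      unfolding m_def sum.distrib[symmetric] using False feasible_block_nonneg[OF X ij]
      by (intro sum_mono) (auto simp: t_def)
    ultimately have "2 * m t \<le> 1" using feasible_block_sum[OF X ij] by linarith
    then show ?thesis by (simp add: off)
  qed (use block_off_mass_nonneg[OF X ij] in \<open>simp add: t_def\<close>)
qed

lemma block_off_mass_sym:
  fixes X :: "'k::finite bmat"
  assumes X: "sdp_feasible n X" "i \<in> {1..n}" "j \<in> {1..n}" and B: "transpose B = B"
  shows "block_off_mass B zz X i j = block_off_mass B zz X j i"
proof -
  have Bsym: "B $ a $ b = B $ b $ a" for a b
    by (metis B transpose_def vec_lambda_beta)
  have Xsym: "X (i, a) (j, b) = X (j, b) (i, a)" for a b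
    using X by (auto simp: sdp_feasible_def bpsd_def bidx_def)
  have Qsym: "(a, b) \<in> Qset B c d \<longleftrightarrow> (b, a) \<in> Qset B d c" for a b c d
    using Bsym[of a b] Bsym[of c d] by (simp add: Qset_def)
  have "block_off_mass B zz X i j
    = (\<Sum>a\<in>UNIV. \<Sum>b\<in>UNIV. of_bool ((b, a) \<notin> Qset B (zz j) (zz i)) * X (j, b) (i, a))"
    unfolding block_off_mass_def by (intro sum.cong refl) (simp only: Xsym Qsym[of _ _ "zz i"])
  also have "\<dots> = block_off_mass B zz X j i"
    unfolding block_off_mass_def by (rule sum.swap)
  finally show ?thesis .
qed

lemma theta_hat_eq_iff:
  assumes "in_unit_interior (theta_hat n aa Bhat)" and "Qset Bhat a b = Qset Bstar a b"
  shows "theta_hat n aa Bhat $ c $ d = theta_hat n aa Bhat $ a $ b \<longleftrightarrow> (c, d) \<in> Qset Bstar a b"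
proof -
  have "alpha_hat n aa \<noteq> 0"
    using assms(1) by (auto simp: in_unit_interior_def theta_hat_def)
  then show ?thesis unfolding assms(2)[symmetric] by (simp add: theta_hat_def Qset_def)
qed

text \<open>
  The definition of the estimator determines the law for \<open>i \<le> j\<close>. The other entries follow by symmetry
  of the estimate, of \<open>X\<close> and of \<open>Bstar\<close>.
\<close>

lemma randomized_block_error:
  fixes Bstar Bhat :: "real^'k::finite^'k" and z :: "'w \<Rightarrow> nat \<Rightarrow> 'k" and zz :: "nat \<Rightarrow> 'k"
  assumes sbm: "sbm M n \<pi> \<theta> z A"
    and est: "is_randomized_estimator M n Bhat Xhat z A P"
    and int: "in_unit_interior (theta_hat n aa Bhat)" and X: "sdp_feasible n (Xhat aa)"
    and Q: "\<And>a b. Qset Bhat a b = Qset Bstar a b" and sym: "transpose Bstar = Bstar"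
    and ij: "i \<in> {1..n}" "j \<in> {1..n}"
  defines "E \<equiv> data_event M n z A aa zz"
  shows "measure M (E \<inter> {\<omega>\<in>space M. P \<omega> i j \<noteq> theta_hat n aa Bhat $ zz i $ zz j})
    = measure M E * block_off_mass Bstar zz (Xhat aa) i j"
proof -
  interpret M: prob_space M by (rule sbm_prob_space[OF sbm])
  have E: "E \<in> sets M" unfolding E_def by (rule data_event_sets[OF sbm])
  define t where "t i j = theta_hat n aa Bhat $ zz i $ zz j" for i j
  note eqQ = theta_hat_eq_iff[OF int Q]
  have Pmeas: "(\<lambda>\<omega>. P \<omega> i j) \<in> borel_measurable M" if "i \<in> {1..n}" "j \<in> {1..n}" for i j
    using est that unfolding is_randomized_estimator_def by blast
  have ordered: "measure M (E \<inter> {\<omega>\<in>space M. P \<omega> i j \<noteq> t i j})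
      = measure M E * block_off_mass Bstar zz (Xhat aa) i j"
    if ij: "i \<in> {1..n}" "j \<in> {1..n}" "i \<le> j" for i j
  proof (cases "measure M E = 0")
    case True
    moreover have "measure M (E \<inter> {\<omega>\<in>space M. P \<omega> i j \<noteq> t i j}) \<le> measure M E"
      using E by (intro M.finite_measure_mono) auto
    ultimately show ?thesis using measure_nonneg[of M "E \<inter> {\<omega>\<in>space M. P \<omega> i j \<noteq> t i j}"] by simp
  next
    case False
    then have pos: "0 < measure M E" by (simp add: zero_less_measure_iff)
    then have Epos: "emeasure M E \<noteq> 0" "emeasure M E \<noteq> \<infinity>" by (auto simp: M.emeasure_eq_measure)
    note [measurable] = Pmeas[OF ij(1,2)]
    have S: "{\<omega>\<in>space M. P \<omega> i j = t i j} \<in> sets M" by measurable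
    have "measure (uniform_measure M E) {\<omega>\<in>space M. P \<omega> i j = t i j}
        = (\<Sum>(a, b) | theta_hat n aa Bhat $ a $ b = t i j. Xhat aa (i, a) (j, b))"
      using est pos int ij unfolding is_randomized_estimator_def Let_def E_def data_event_def by auto
    also have "\<dots> = (\<Sum>p\<in>UNIV \<times> UNIV. case p of (a, b) \<Rightarrow>
        Xhat aa (i, a) (j, b) * of_bool (theta_hat n aa Bhat $ a $ b = t i j))"
      by (intro sum.mono_neutral_cong_left) auto
    also have "\<dots> = (\<Sum>a\<in>UNIV. \<Sum>b\<in>UNIV.
        Xhat aa (i, a) (j, b) * of_bool (theta_hat n aa Bhat $ a $ b = t i j))"
      by (simp only: sum.cartesian_product)
    also have "\<dots> = 1 - block_off_mass Bstar zz (Xhat aa) i j"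
      using block_off_mass_eq[OF X ij(1,2) eqQ, of zz] by (simp add: t_def)
    finally have "measure M (E \<inter> {\<omega>\<in>space M. P \<omega> i j = t i j})
        = measure M E * (1 - block_off_mass Bstar zz (Xhat aa) i j)"
      using pos by (simp add: measure_uniform_measure[OF Epos S] field_simps)
    moreover have "E \<inter> {\<omega>\<in>space M. P \<omega> i j \<noteq> t i j} = E - (E \<inter> {\<omega>\<in>space M. P \<omega> i j = t i j})"
      using sets.sets_into_space[OF E] by auto
    moreover have "measure M (E - (E \<inter> {\<omega>\<in>space M. P \<omega> i j = t i j}))
      = measure M E - measure M (E \<inter> {\<omega>\<in>space M. P \<omega> i j = t i j})"
      using E S by (intro M.finite_measure_Diff) auto
    ultimately show ?thesis by (simp add: algebra_simps)
  qed
  show ?thesis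
  proof (cases "i \<le> j")
    case True
    then show ?thesis using ordered ij by (simp add: t_def)
  next
    case False
    have "t i j = t j i"
    proof -
      have "(zz i, zz j) \<in> Qset Bstar (zz j) (zz i)"
        using sym by (auto simp: Qset_def) (metis transpose_def vec_lambda_beta)
      then show ?thesis by (simp add: t_def eqQ)
    qed
    moreover have "P \<omega> i j = P \<omega> j i" if "\<omega> \<in> E" for \<omega>
      using est int ij that unfolding is_randomized_estimator_def E_def data_event_def by auto
    ultimately have "E \<inter> {\<omega>\<in>space M. P \<omega> i j \<noteq> t i j} = E \<inter> {\<omega>\<in>space M. P \<omega> j i \<noteq> t j i}"
      by auto
    then show ?thesis
      using ordered[of j i] False ij block_off_mass_sym[OF X ij sym] by (simp add: t_def)
  qed
qed

text \<open>
  Given data on which the off-class mass is at most \<open>r n\<^sup>2\<close>, the expected error rate is at most \<open>r\<close>, so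
  Markov's inequality bounds the conditional tail by \<open>r / \<tau>\<close>. The inequality is applied on each cell of
  the finite partition by the data, to the number of errors restricted to that cell.
\<close>

lemma randomized_error_tail:
  fixes Bstar Bhat :: "real^'k::finite^'k" and z :: "'w \<Rightarrow> nat \<Rightarrow> 'k"
  assumes sbm: "sbm M n \<pi> \<theta> z A"
    and est: "is_randomized_estimator M n Bhat Xhat z A P"
    and sol: "\<And>\<omega>. \<omega> \<in> space M \<Longrightarrow> in_unit_interior (theta_hat n (A \<omega>) Bhat) \<Longrightarrow>
        sdp_solution n (A \<omega>) (theta_hat n (A \<omega>) Bhat) (Xhat (A \<omega>))"
    and Q: "\<And>a b. Qset Bhat a b = Qset Bstar a b" and sym: "transpose Bstar = Bstar"
    and n: "0 < n" and r: "0 \<le> r" and \<tau>: "0 < \<tau>"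
  shows "measure M {\<omega>\<in>space M. error_rate n (theta_hat n (A \<omega>) Bhat) (z \<omega>) (P \<omega>) > \<tau>}
    \<le> measure M {\<omega>\<in>space M. \<not> good_data n Bstar Bhat r (A \<omega>) (z \<omega>)} + r / \<tau>"
proof -
  interpret prob_space M by (rule sbm_prob_space[OF sbm])
  define F where "F = adjacency_matrices n \<times> (labelings n :: (nat \<Rightarrow> 'k) set)"
  have F: "finite F" by (simp add: F_def finite_adjacency_matrices finite_labelings)
  define E where "E = (\<lambda>(aa, zz). data_event M n z A aa zz)"
  have E: "E p \<in> sets M" for p using data_event_sets[OF sbm] by (auto simp: E_def split: prod.split)
  define H where "H = {p \<in> F. E p \<noteq> {} \<and> good_data n Bstar Bhat r (fst p) (snd p)}"
  have H: "finite H" "H \<subseteq> F" using F by (auto simp: H_def)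
  define err where "err p i j = E p \<inter> {\<omega>\<in>space M. P \<omega> i j \<noteq> theta_hat n (fst p) Bhat $ snd p i $ snd p j}" for p i j
  have err_sets: "err p i j \<in> sets M" if "i \<in> {1..n}" "j \<in> {1..n}" for p i j
  proof -
    have [measurable]: "(\<lambda>\<omega>. P \<omega> i j) \<in> borel_measurable M"
      using est that unfolding is_randomized_estimator_def by blast
    have "{\<omega>\<in>space M. P \<omega> i j \<noteq> theta_hat n (fst p) Bhat $ snd p i $ snd p j} \<in> sets M" by measurable
    then show ?thesis unfolding err_def using E by (intro sets.Int) auto
  qed
  define f where "f p \<omega> = (\<Sum>i\<in>{1..n}. \<Sum>j\<in>{1..n}. indicator (err p i j) \<omega> :: real)" for p \<omega>
  have f_int: "integrable M (f p)" for p
    unfolding f_def using err_sets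
    by (intro Bochner_Integration.integrable_sum integrable_real_indicator) (auto simp: emeasure_eq_measure)
  have f_nonneg: "0 \<le> f p \<omega>" for p \<omega>
    by (simp add: f_def sum_nonneg)
  define G where "G p = {\<omega>\<in>space M. f p \<omega> \<ge> \<tau> * (real n)\<^sup>2}" for p
  have G_sets: "G p \<in> sets M" for p
  proof -
    have [measurable]: "f p \<in> borel_measurable M" using f_int by auto
    show ?thesis unfolding G_def by measurable
  qed
  have G_prob: "prob (G p) \<le> prob (E p) * (r / \<tau>)" if p: "p \<in> H" for p
  proof -
    obtain aa zz where p': "p = (aa, zz)" by (cases p)
    have good: "good_data n Bstar Bhat r aa zz" and "E p \<noteq> {}" using p by (auto simp: H_def p')
    then obtain \<omega> where "\<omega> \<in> space M" "A \<omega> = aa" by (auto simp: E_def p' data_event_def)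
    moreover have int: "in_unit_interior (theta_hat n aa Bhat)" using good by (simp add: good_data_def)
    ultimately have X: "sdp_solution n aa (theta_hat n aa Bhat) (Xhat aa)" using sol by auto
    then have Xf: "sdp_feasible n (Xhat aa)" by (simp add: sdp_solution_def is_arg_max_def)
    have off: "off_mass n Bstar zz (Xhat aa) \<le> r * (real n)\<^sup>2" using good X by (simp add: good_data_def)
    have "prob (G p) \<le> expectation (f p) / (\<tau> * (real n)\<^sup>2)"
      unfolding G_def using f_int f_nonneg \<tau> n
      by (intro integral_Markov_inequality_measure[where A = "{}"]) auto
    also have "expectation (f p) = (\<Sum>i\<in>{1..n}. \<Sum>j\<in>{1..n}. prob (err p i j))"
    proof -
      have ind: "integrable M (indicator (err p i j) :: _ \<Rightarrow> real)" if "i \<in> {1..n}" "j \<in> {1..n}" for i j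
        using err_sets[OF that] by (intro integrable_real_indicator) (auto simp: emeasure_eq_measure)
      have "expectation (f p) = (\<Sum>i\<in>{1..n}. expectation (\<lambda>\<omega>. \<Sum>j\<in>{1..n}. indicator (err p i j) \<omega>))"
        unfolding f_def by (intro Bochner_Integration.integral_sum Bochner_Integration.integrable_sum ind)
      also have "\<dots> = (\<Sum>i\<in>{1..n}. \<Sum>j\<in>{1..n}. expectation (indicator (err p i j)))"
        by (intro sum.cong refl Bochner_Integration.integral_sum ind)
      also have "\<dots> = (\<Sum>i\<in>{1..n}. \<Sum>j\<in>{1..n}. prob (err p i j))"
      proof (intro sum.cong refl)
        fix i j assume "i \<in> {1..n}" "j \<in> {1..n}"
        then have "err p i j \<inter> space M = err p i j"
          using sets.sets_into_space[OF err_sets] by blast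
        then show "expectation (indicator (err p i j)) = prob (err p i j)" by simp
      qed
      finally show ?thesis .
    qed
    also have "\<dots> = (\<Sum>i\<in>{1..n}. \<Sum>j\<in>{1..n}. prob (E p) * block_off_mass Bstar zz (Xhat aa) i j)"
    proof (intro sum.cong refl)
      fix i j assume "i \<in> {1..n}" "j \<in> {1..n}"
      then show "prob (err p i j) = prob (E p) * block_off_mass Bstar zz (Xhat aa) i j"
        unfolding err_def E_def p' fst_conv snd_conv prod.case
        by (rule randomized_block_error[OF sbm est int Xf Q sym])
    qed
    also have "\<dots> = prob (E p) * off_mass n Bstar zz (Xhat aa)"
      by (simp add: off_mass_blocks sum_distrib_left)
    also have "prob (E p) * off_mass n Bstar zz (Xhat aa) / (\<tau> * (real n)\<^sup>2) \<le> prob (E p) * (r * (real n)\<^sup>2) / (\<tau> * (real n)\<^sup>2)"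
      using off \<tau> by (intro divide_right_mono mult_left_mono) auto
    also have "\<dots> = prob (E p) * (r / \<tau>)" using n by simp
    finally show ?thesis .
  qed
  define Bad where "Bad = {\<omega>\<in>space M. \<not> good_data n Bstar Bhat r (A \<omega>) (z \<omega>)}"
  have Bad: "Bad \<in> sets M"
    unfolding Bad_def using good_data_cong by (intro data_property_sets[OF sbm, where \<Phi> = "\<lambda>aa zz. \<not> good_data n Bstar Bhat r aa zz"]) blast
  have "{\<omega>\<in>space M. error_rate n (theta_hat n (A \<omega>) Bhat) (z \<omega>) (P \<omega>) > \<tau>} \<subseteq> Bad \<union> (\<Union>p\<in>H. G p)"
  proof
    fix \<omega> assume "\<omega> \<in> {\<omega>\<in>space M. error_rate n (theta_hat n (A \<omega>) Bhat) (z \<omega>) (P \<omega>) > \<tau>}"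
    then have w: "\<omega> \<in> space M" and e: "error_rate n (theta_hat n (A \<omega>) Bhat) (z \<omega>) (P \<omega>) > \<tau>" by auto
    define p where "p = (A \<omega>, restrict (z \<omega>) {1..n})"
    have Ep: "\<omega> \<in> E p" and pF: "p \<in> F"
      using data_event_cover[OF sbm w] by (auto simp: E_def F_def p_def)
    have gd: "good_data n Bstar Bhat r (fst p) (snd p) = good_data n Bstar Bhat r (A \<omega>) (z \<omega>)"
      unfolding p_def fst_conv snd_conv by (intro good_data_cong) simp
    have "f p \<omega> = (\<Sum>i\<in>{1..n}. \<Sum>j\<in>{1..n}. of_bool (P \<omega> i j \<noteq> theta_hat n (A \<omega>) Bhat $ z \<omega> i $ z \<omega> j))"
      unfolding f_def err_def using Ep w
      by (intro sum.cong refl) (auto simp: p_def indicator_def)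
    also have "\<dots> = (real n)\<^sup>2 * error_rate n (theta_hat n (A \<omega>) Bhat) (z \<omega>) (P \<omega>)"
      using n by (simp only: error_rate_mult)
    also have "\<dots> \<ge> (real n)\<^sup>2 * \<tau>" using e by (intro mult_left_mono) auto
    finally have "\<omega> \<in> G p" using w by (simp add: G_def mult_ac)
    moreover have "p \<in> H" if "\<omega> \<notin> Bad"
      using that Ep pF gd w by (auto simp: Bad_def H_def)
    ultimately show "\<omega> \<in> Bad \<union> (\<Union>p\<in>H. G p)" by blast
  qed
  then have "prob {\<omega>\<in>space M. error_rate n (theta_hat n (A \<omega>) Bhat) (z \<omega>) (P \<omega>) > \<tau>} \<le> prob (Bad \<union> (\<Union>p\<in>H. G p))"
    using Bad G_sets H by (intro finite_measure_mono sets.Un sets.finite_UN) auto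
  also have "\<dots> \<le> prob Bad + prob (\<Union>p\<in>H. G p)"
    using Bad G_sets H by (intro measure_Un_le sets.finite_UN) auto
  also have "prob (\<Union>p\<in>H. G p) \<le> (\<Sum>p\<in>H. prob (G p))"
    using G_sets H by (intro finite_measure_subadditive_finite) auto
  also have "\<dots> \<le> (\<Sum>p\<in>H. prob (E p) * (r / \<tau>))" by (intro sum_mono G_prob)
  also have "\<dots> \<le> (\<Sum>p\<in>F. prob (E p) * (r / \<tau>))"
    using H F r \<tau> by (intro sum_mono2) auto
  also have "\<dots> = (\<Sum>p\<in>F. prob (E p)) * (r / \<tau>)" by (simp only: sum_distrib_right)
  also have "(\<Sum>p\<in>F. prob (E p)) = 1"
  proof -
    have "data_event M n z A aa zz \<inter> space M = data_event M n z A aa zz" for aa zz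
      by (auto simp: data_event_def)
    then show ?thesis
      using prob_eq_sum_data_events[OF sbm sets.top] by (simp add: prob_space F_def E_def case_prod_unfold)
  qed
  finally show ?thesis by (simp add: Bad_def)
qed

section \<open>The error rate\<close>

text \<open>
  The two exceptional events, a large cut norm and atypical class frequencies, have exponentially small
  probability. Where \<open>sqrt (n \<alpha>) \<le> C1\<close> nothing is claimed about the data: there the target rate is
  bounded below, and the error rate never exceeds 1.
\<close>

lemma good_data_likely:
  fixes \<pi> :: "'k::finite pmf"
    and Bstar Bhat :: "real^'k^'k"
    and \<alpha> :: "nat \<Rightarrow> real"
    and n0 :: nat
    and \<Omega> :: "nat \<Rightarrow> 'w measure"
    and z :: "nat \<Rightarrow> 'w \<Rightarrow> nat \<Rightarrow> 'k"
    and A :: "nat \<Rightarrow> 'w \<Rightarrow> adj"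
  assumes Bstar_nonneg: "\<And>a b. Bstar $ a $ b \<ge> 0"
    and Bstar_sym: "transpose Bstar = Bstar"
    and Bstar_normalized: "(\<Sum>a\<in>UNIV. \<Sum>b\<in>UNIV. pmf \<pi> a * pmf \<pi> b * Bstar $ a $ b) = 1"
    and alpha_lim: "\<alpha> \<longlonglongrightarrow> 0"
    and alpha_lower: "\<And>n. n \<ge> n0 \<Longrightarrow> \<alpha> n > 1 / real n"
    and theta_range: "\<And>n a b. n \<ge> n0 \<Longrightarrow> (\<alpha> n *\<^sub>R Bstar) $ a $ b \<in> {0..1}"
    and model: "\<And>n. n \<ge> n0 \<Longrightarrow> sbm (\<Omega> n) n \<pi> (\<alpha> n *\<^sub>R Bstar) (z n) (A n)"
    and Bhat_pos: "\<And>a b. Bhat $ a $ b > 0"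
    and Bhat_Q: "\<And>a b. Qset Bhat a b = Qset Bstar a b"
    and Bhat_gap: "\<And>a b c d. (c, d) \<notin> Qset Bstar a b \<Longrightarrow>
        Bstar $ a $ b * ln (Bhat $ a $ b / Bhat $ c $ d) - (Bhat $ a $ b - Bhat $ c $ d) > 0"
  obtains C1 where "0 < C1"
    and "\<And>\<epsilon>. 0 < \<epsilon> \<Longrightarrow> \<exists>N. \<forall>n\<ge>N. n0 \<le> n \<and> 0 < n \<and> 1 < real n * \<alpha> n \<and>
      (C1 < sqrt (real n * \<alpha> n) \<longrightarrow>
        measure (\<Omega> n) {\<omega>\<in>space (\<Omega> n).
          \<not> good_data n Bstar Bhat (C1 / sqrt (real n * \<alpha> n)) (A n \<omega>) (z n \<omega>)} \<le> \<epsilon>)"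
proof -
  define R where "R = Max (range (\<lambda>(a, b). Bstar $ a $ b))"
  have R: "Bstar $ a $ b \<le> R" for a b
    unfolding R_def by (intro Max_ge) (auto intro: image_eqI[of _ _ "(a, b)"])
  have R0: "0 \<le> R" using R Bstar_nonneg order_trans by blast
  define C where "C = 2 * R + 6"
  have C: "0 \<le> C" using R0 by (simp add: C_def)
  obtain C1 \<kappa> \<alpha>0 N1 where c: "0 < C1" "0 < \<kappa>" "0 < \<alpha>0"
    and crit: "\<And>n \<alpha> A zz. N1 \<le> n \<Longrightarrow> 0 < \<alpha> \<Longrightarrow> \<alpha> \<le> \<alpha>0 \<Longrightarrow> C1 < sqrt (real n * \<alpha>) \<Longrightarrow>
      cut_bound {1..n} {1..n} (\<lambda>i j. of_bool (A i j) - (\<alpha> *\<^sub>R Bstar) $ zz i $ zz j)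
        (C * (real n * sqrt (real n * \<alpha>))) \<Longrightarrow>
      (\<And>a. \<bar>class_freq n zz a - pmf \<pi> a\<bar> \<le> \<kappa>) \<Longrightarrow>
      good_data n Bstar Bhat (C1 / sqrt (real n * \<alpha>)) A zz"
    by (rule good_data_criterion[OF Bstar_nonneg Bhat_pos Bstar_normalized Bhat_Q Bhat_gap C]) blast+
  show thesis
  proof (rule that[OF c(1)])
    fix \<epsilon> :: real assume \<epsilon>: "0 < \<epsilon>"
    define e where "e n = exp (- real n) + real CARD('k) * (2 * exp (- 2 * real n * \<kappa>\<^sup>2))" for n :: nat
    have exp_0: "(\<lambda>n. exp (- (b * real n))) \<longlonglongrightarrow> 0" if "0 < b" for b :: real
      using LIMSEQ_realpow_zero[of "exp (- b)"] that by (simp add: mult.commute flip: exp_of_nat_mult)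
    have "(\<lambda>n. exp (- (1 * real n)) + real CARD('k) * (2 * exp (- (2 * \<kappa>\<^sup>2 * real n)))) \<longlonglongrightarrow> 0 + real CARD('k) * (2 * 0)"
      using c(2) by (intro tendsto_intros exp_0) auto
    then have "e \<longlonglongrightarrow> 0" by (simp add: e_def[abs_def] mult_ac)
    then have "\<forall>\<^sub>F n in sequentially. e n < \<epsilon>" using \<epsilon> by (rule order_tendstoD)
    moreover have "\<forall>\<^sub>F n in sequentially. \<alpha> n < min \<alpha>0 1"
      using alpha_lim c by (intro order_tendstoD) auto
    moreover have "\<forall>\<^sub>F n in sequentially. max (max n0 N1) 1 \<le> n"
      by (rule eventually_ge_at_top)
    ultimately have "\<forall>\<^sub>F n in sequentially. e n < \<epsilon> \<and> \<alpha> n < min \<alpha>0 1 \<and> max (max n0 N1) 1 \<le> n"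
      by eventually_elim auto
    then obtain N where N: "\<And>n. N \<le> n \<Longrightarrow> e n < \<epsilon> \<and> \<alpha> n < min \<alpha>0 1 \<and> max (max n0 N1) 1 \<le> n"
      unfolding eventually_sequentially by blast
    have "n0 \<le> n \<and> 0 < n \<and> 1 < real n * \<alpha> n \<and>
      (C1 < sqrt (real n * \<alpha> n) \<longrightarrow> measure (\<Omega> n) {\<omega>\<in>space (\<Omega> n).
          \<not> good_data n Bstar Bhat (C1 / sqrt (real n * \<alpha> n)) (A n \<omega>) (z n \<omega>)} \<le> \<epsilon>)"
      if n: "N \<le> n" for n
    proof -
      have n': "n0 \<le> n" "N1 \<le> n" "0 < n" "\<alpha> n \<le> \<alpha>0" "\<alpha> n \<le> 1" "e n < \<epsilon>" using N[OF n] by auto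
      have n\<alpha>: "1 < real n * \<alpha> n"
        using alpha_lower[OF n'(1)] n'(3) by (simp add: divide_less_eq mult_ac)
      have \<alpha>: "0 < \<alpha> n" using alpha_lower[OF n'(1)] n'(3) by (meson divide_nonneg_nonneg le_less_trans of_nat_0_le_iff zero_le_one)
      note sbm = model[OF n'(1)]
      interpret prob_space "\<Omega> n" by (rule sbm_prob_space[OF sbm])
      define cut where "cut aa zz \<longleftrightarrow> cut_bound {1..n} {1..n}
        (\<lambda>i j. of_bool (aa i j) - (\<alpha> n *\<^sub>R Bstar) $ zz i $ zz j) (C * (real n * sqrt (real n * \<alpha> n)))" for aa zz
      define S1 where "S1 = {\<omega>\<in>space (\<Omega> n). \<not> cut (A n \<omega>) (z n \<omega>)}"
      define S2 where "S2 = {\<omega>\<in>space (\<Omega> n). \<exists>a. \<bar>class_freq n (z n \<omega>) a - pmf \<pi> a\<bar> > \<kappa>}"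
      have S1: "prob S1 \<le> exp (- real n)"
        unfolding S1_def cut_def C_def using Bstar_nonneg R Bstar_sym theta_range[OF n'(1)] \<alpha> n'(5) n\<alpha>
        by (intro sbm_cut_tail[OF sbm]) auto
      have S2: "prob S2 \<le> real CARD('k) * (2 * exp (- 2 * real n * \<kappa>\<^sup>2))"
        unfolding S2_def by (rule class_freq_tail[OF sbm n'(3) c(2)])
      have S1_sets: "S1 \<in> events"
        unfolding S1_def
      proof (rule data_property_sets[OF sbm])
        fix aa and zz zz' :: "nat \<Rightarrow> 'k" assume zz: "\<And>i. i \<in> {1..n} \<Longrightarrow> zz i = zz' i"
        show "(\<not> cut aa zz) = (\<not> cut aa zz')" unfolding cut_def
          by (intro arg_cong[where f = Not] cut_bound_cong) (simp add: zz)
      qed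
      have S2_sets: "S2 \<in> events"
        unfolding S2_def
      proof (rule data_property_sets[OF sbm])
        fix aa and zz zz' :: "nat \<Rightarrow> 'k" assume "\<And>i. i \<in> {1..n} \<Longrightarrow> zz i = zz' i"
        then have "class_freq n zz = class_freq n zz'"
          unfolding class_freq_def by (intro ext arg_cong2[where f = "(/)"] sum.cong refl) auto
        then show "(\<exists>a. \<bar>class_freq n zz a - pmf \<pi> a\<bar> > \<kappa>) = (\<exists>a. \<bar>class_freq n zz' a - pmf \<pi> a\<bar> > \<kappa>)"
          by simp
      qed
      have "prob {\<omega>\<in>space (\<Omega> n).
          \<not> good_data n Bstar Bhat (C1 / sqrt (real n * \<alpha> n)) (A n \<omega>) (z n \<omega>)} \<le> \<epsilon>"
        if s: "C1 < sqrt (real n * \<alpha> n)"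
      proof -
        have "{\<omega>\<in>space (\<Omega> n).
          \<not> good_data n Bstar Bhat (C1 / sqrt (real n * \<alpha> n)) (A n \<omega>) (z n \<omega>)} \<subseteq> S1 \<union> S2"
          using crit[OF n'(2) \<alpha> n'(4) s] unfolding S1_def S2_def cut_def by (fastforce simp: not_le)
        then have "prob {\<omega>\<in>space (\<Omega> n).
          \<not> good_data n Bstar Bhat (C1 / sqrt (real n * \<alpha> n)) (A n \<omega>) (z n \<omega>)} \<le> prob (S1 \<union> S2)"
          using S1_sets S2_sets by (intro finite_measure_mono) auto
        also have "\<dots> \<le> prob S1 + prob S2"
          using S1_sets S2_sets by (rule measure_Un_le)
        also have "\<dots> \<le> e n" using S1 S2 by (simp add: e_def)
        finally show ?thesis using n'(6) by simp
      qed
      then show ?thesis using n' n\<alpha> by simp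
    qed
    then show "\<exists>N. \<forall>n\<ge>N. n0 \<le> n \<and> 0 < n \<and> 1 < real n * \<alpha> n \<and>
      (C1 < sqrt (real n * \<alpha> n) \<longrightarrow> measure (\<Omega> n) {\<omega>\<in>space (\<Omega> n).
          \<not> good_data n Bstar Bhat (C1 / sqrt (real n * \<alpha> n)) (A n \<omega>) (z n \<omega>)} \<le> \<epsilon>)"
      by blast
  qed
qed

theorem theorem2:
  fixes \<pi> :: "'k::finite pmf"
    and Bstar Bhat :: "real^'k^'k"
    and \<alpha> :: "nat \<Rightarrow> real"
    and n0 :: nat
    and \<Omega> :: "nat \<Rightarrow> 'w measure"
    and z :: "nat \<Rightarrow> 'w \<Rightarrow> nat \<Rightarrow> 'k"
    and A :: "nat \<Rightarrow> 'w \<Rightarrow> adj"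
    and Xhat :: "nat \<Rightarrow> adj \<Rightarrow> 'k bmat"
  assumes Bstar_nonneg: "\<And>a b. Bstar $ a $ b \<ge> 0"
    and Bstar_sym: "transpose Bstar = Bstar"
    and Bstar_rank: "rank Bstar = CARD('k)"
    and Bstar_normalized: "(\<Sum>a\<in>UNIV. \<Sum>b\<in>UNIV. pmf \<pi> a * pmf \<pi> b * Bstar $ a $ b) = 1"
    and alpha_lim: "\<alpha> \<longlonglongrightarrow> 0"
    and alpha_lower: "\<And>n. n \<ge> n0 \<Longrightarrow> \<alpha> n > 1 / real n"
    and theta_range: "\<And>n a b. n \<ge> n0 \<Longrightarrow> (\<alpha> n *\<^sub>R Bstar) $ a $ b \<in> {0..1}"
    and model: "\<And>n. n \<ge> n0 \<Longrightarrow> sbm (\<Omega> n) n \<pi> (\<alpha> n *\<^sub>R Bstar) (z n) (A n)"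
    and Bhat_pos: "\<And>a b. Bhat $ a $ b > 0"
    and Bhat_Q: "\<And>a b. Qset Bhat a b = Qset Bstar a b"
    and Bhat_gap: "\<And>a b c d. (c, d) \<notin> Qset Bstar a b \<Longrightarrow>
        Bstar $ a $ b * ln (Bhat $ a $ b / Bhat $ c $ d) - (Bhat $ a $ b - Bhat $ c $ d) > 0"
    and Xhat_solution: "\<And>n \<omega>. n \<ge> n0 \<Longrightarrow> \<omega> \<in> space (\<Omega> n) \<Longrightarrow>
        in_unit_interior (theta_hat n (A n \<omega>) Bhat) \<Longrightarrow>
        sdp_solution n (A n \<omega>) (theta_hat n (A n \<omega>) Bhat) (Xhat n (A n \<omega>))"
  shows "(\<forall>Phat. (\<forall>n\<ge>n0. is_map_estimator (\<Omega> n) n Bhat (Xhat n) (A n) (Phat n)) \<longrightarrow>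
            big_O_prob \<Omega>
              (\<lambda>n \<omega>. error_rate n (theta_hat n (A n \<omega>) Bhat) (z n \<omega>) (Phat n \<omega>))
              (\<lambda>n. 1 / sqrt (real n * \<alpha> n))) \<and>
         (\<forall>Ptilde. (\<forall>n\<ge>n0. is_randomized_estimator (\<Omega> n) n Bhat (Xhat n) (z n) (A n) (Ptilde n)) \<longrightarrow>
            big_O_prob \<Omega>
              (\<lambda>n \<omega>. error_rate n (theta_hat n (A n \<omega>) Bhat) (z n \<omega>) (Ptilde n \<omega>))
              (\<lambda>n. 1 / sqrt (real n * \<alpha> n)))"
proof (intro conjI allI impI)
  obtain C1 where C1: "0 < C1"
    and likely: "\<And>\<epsilon>. 0 < \<epsilon> \<Longrightarrow> \<exists>N. \<forall>n\<ge>N. n0 \<le> n \<and> 0 < n \<and> 1 < real n * \<alpha> n \<and>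
      (C1 < sqrt (real n * \<alpha> n) \<longrightarrow>
        measure (\<Omega> n) {\<omega>\<in>space (\<Omega> n).
          \<not> good_data n Bstar Bhat (C1 / sqrt (real n * \<alpha> n)) (A n \<omega>) (z n \<omega>)} \<le> \<epsilon>)"
    by (rule good_data_likely[OF Bstar_nonneg Bstar_sym Bstar_normalized alpha_lim alpha_lower
          theta_range model Bhat_pos Bhat_Q Bhat_gap]) blast+
  \<comment> \<open>The average degree \<open>n \<alpha>\<close> need not tend to infinity. Where it is bounded, a large constant makes
    the bound exceed 1.\<close>
  have trivial_regime: "{\<omega>\<in>space (\<Omega> n). \<bar>error_rate n (\<theta> \<omega>) (zz \<omega>) (P \<omega>)\<bar> > C * (1 / sqrt (real n * \<alpha> n))} = {}"
    if "sqrt (real n * \<alpha> n) \<le> C" "1 < real n * \<alpha> n" for n C \<theta> zz P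
  proof -
    have "1 \<le> C * (1 / sqrt (real n * \<alpha> n))"
      using that by (simp add: le_divide_eq)
    moreover have "\<bar>error_rate n (\<theta> \<omega>) (zz \<omega>) (P \<omega>)\<bar> \<le> 1" for \<omega>
      using error_rate_le_1[of n "\<theta> \<omega>" "zz \<omega>" "P \<omega>"] error_rate_nonneg[of n "\<theta> \<omega>" "zz \<omega>" "P \<omega>"]
      by linarith
    ultimately show ?thesis by (auto simp: not_less intro: order_trans)
  qed
  {
    fix Phat assume est: "\<forall>n\<ge>n0. is_map_estimator (\<Omega> n) n Bhat (Xhat n) (A n) (Phat n)"
    show "big_O_prob \<Omega>
        (\<lambda>n \<omega>. error_rate n (theta_hat n (A n \<omega>) Bhat) (z n \<omega>) (Phat n \<omega>))
        (\<lambda>n. 1 / sqrt (real n * \<alpha> n))"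
      unfolding big_O_prob_def
    proof (intro allI impI)
      fix \<epsilon> :: real assume \<epsilon>: "\<epsilon> > 0"
      obtain N where N: "\<And>n. N \<le> n \<Longrightarrow> n0 \<le> n \<and> 0 < n \<and> 1 < real n * \<alpha> n \<and>
        (C1 < sqrt (real n * \<alpha> n) \<longrightarrow>
          measure (\<Omega> n) {\<omega>\<in>space (\<Omega> n).
            \<not> good_data n Bstar Bhat (C1 / sqrt (real n * \<alpha> n)) (A n \<omega>) (z n \<omega>)} \<le> \<epsilon>)"
        using likely[OF \<epsilon>] by blast
      have "measure (\<Omega> n) {\<omega>\<in>space (\<Omega> n). \<bar>error_rate n (theta_hat n (A n \<omega>) Bhat) (z n \<omega>) (Phat n \<omega>)\<bar>
          > 2 * C1 * (1 / sqrt (real n * \<alpha> n))} \<le> \<epsilon>" (is "measure _ ?S \<le> _") if n: "N \<le> n" for n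
      proof (cases "C1 < sqrt (real n * \<alpha> n)")
        case False
        then have "?S = {}" using N[OF n] C1 by (intro trivial_regime) auto
        then show ?thesis using \<epsilon> by (simp only: measure_empty)
      next
        case True
        define r where "r = C1 / sqrt (real n * \<alpha> n)"
        have n': "n0 \<le> n" "0 < n" using N[OF n] by auto
        note sbm = model[OF n'(1)]
        interpret prob_space "\<Omega> n" by (rule sbm_prob_space[OF sbm])
        define Bad where "Bad = {\<omega>\<in>space (\<Omega> n). \<not> good_data n Bstar Bhat r (A n \<omega>) (z n \<omega>)}"
        have "Bad \<in> events"
          unfolding Bad_def using good_data_cong
          by (intro data_property_sets[OF sbm, where \<Phi> = "\<lambda>aa zz. \<not> good_data n Bstar Bhat r aa zz"]) blast
        moreover have "?S \<subseteq> Bad"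
        proof
          fix \<omega> assume "\<omega> \<in> ?S"
          then have w: "\<omega> \<in> space (\<Omega> n)"
            and big: "\<bar>error_rate n (theta_hat n (A n \<omega>) Bhat) (z n \<omega>) (Phat n \<omega>)\<bar> > 2 * C1 * (1 / sqrt (real n * \<alpha> n))"
            by auto
          show "\<omega> \<in> Bad"
          proof (rule ccontr)
            assume "\<omega> \<notin> Bad"
            then have good: "good_data n Bstar Bhat r (A n \<omega>) (z n \<omega>)" using w by (simp add: Bad_def)
            then have int: "in_unit_interior (theta_hat n (A n \<omega>) Bhat)" by (simp add: good_data_def)
            note X = Xhat_solution[OF n'(1) w int]
            have P: "map_estimate n (theta_hat n (A n \<omega>) Bhat) (Xhat n (A n \<omega>)) (Phat n \<omega>)"
              using est n'(1) w int by (simp add: is_map_estimator_def)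
            have "(real n)\<^sup>2 * error_rate n (theta_hat n (A n \<omega>) Bhat) (z n \<omega>) (Phat n \<omega>)
               \<le> 2 * off_mass n Bstar (z n \<omega>) (Xhat n (A n \<omega>))"
              using X by (intro map_estimate_error_le[OF _ int theta_hat_eq_iff[OF int Bhat_Q] P n'(2)])
                (simp add: sdp_solution_def is_arg_max_def)
            also have "\<dots> \<le> 2 * (r * (real n)\<^sup>2)" using good X by (simp add: good_data_def)
            finally have "error_rate n (theta_hat n (A n \<omega>) Bhat) (z n \<omega>) (Phat n \<omega>) \<le> 2 * r"
              using n'(2) by (simp add: mult_ac)
            then show False using big by (simp add: r_def abs_of_nonneg[OF error_rate_nonneg])
          qed
        qed
        ultimately have "prob ?S \<le> prob Bad" by (rule finite_measure_mono[rotated])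
        then show ?thesis using N[OF n] True by (simp add: Bad_def r_def)
      qed
      then show "\<exists>C N. \<forall>n\<ge>N. measure (\<Omega> n) {\<omega>\<in>space (\<Omega> n).
          \<bar>error_rate n (theta_hat n (A n \<omega>) Bhat) (z n \<omega>) (Phat n \<omega>)\<bar> > C * (1 / sqrt (real n * \<alpha> n))} \<le> \<epsilon>"
        by blast
    qed
  next
    fix Ptilde assume est: "\<forall>n\<ge>n0. is_randomized_estimator (\<Omega> n) n Bhat (Xhat n) (z n) (A n) (Ptilde n)"
    show "big_O_prob \<Omega>
        (\<lambda>n \<omega>. error_rate n (theta_hat n (A n \<omega>) Bhat) (z n \<omega>) (Ptilde n \<omega>))
        (\<lambda>n. 1 / sqrt (real n * \<alpha> n))"
      unfolding big_O_prob_def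
    proof (intro allI impI)
      fix \<epsilon> :: real assume \<epsilon>: "\<epsilon> > 0"
      \<comment> \<open>The term \<open>2 / \<epsilon>\<close> makes the Markov bound \<open>C1 / C\<close> at most \<open>\<epsilon> / 2\<close>; the term 1 gives \<open>C1 \<le> C\<close>.\<close>
      define C where "C = C1 * (2 / \<epsilon> + 1)"
      have C: "C1 \<le> C" "0 < C" "C1 / C \<le> \<epsilon> / 2"
        using C1 \<epsilon> by (auto simp: C_def field_simps add_pos_pos)
      have "0 < \<epsilon> / 2" using \<epsilon> by simp
      then obtain N where N: "\<And>n. N \<le> n \<Longrightarrow> n0 \<le> n \<and> 0 < n \<and> 1 < real n * \<alpha> n \<and>
        (C1 < sqrt (real n * \<alpha> n) \<longrightarrow>
          measure (\<Omega> n) {\<omega>\<in>space (\<Omega> n).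
            \<not> good_data n Bstar Bhat (C1 / sqrt (real n * \<alpha> n)) (A n \<omega>) (z n \<omega>)} \<le> \<epsilon> / 2)"
        using likely by blast
      have "measure (\<Omega> n) {\<omega>\<in>space (\<Omega> n). \<bar>error_rate n (theta_hat n (A n \<omega>) Bhat) (z n \<omega>) (Ptilde n \<omega>)\<bar>
          > C * (1 / sqrt (real n * \<alpha> n))} \<le> \<epsilon>" (is "measure _ ?S \<le> _") if n: "N \<le> n" for n
      proof (cases "C1 < sqrt (real n * \<alpha> n)")
        case False
        then have "?S = {}" using N[OF n] C by (intro trivial_regime) auto
        then show ?thesis using \<epsilon> by (simp only: measure_empty)
      next
        case True
        define s where "s = sqrt (real n * \<alpha> n)"
        have n': "n0 \<le> n" "0 < n" and s: "0 < s" using N[OF n] True C1 by (auto simp: s_def)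
        have "?S = {\<omega>\<in>space (\<Omega> n). error_rate n (theta_hat n (A n \<omega>) Bhat) (z n \<omega>) (Ptilde n \<omega>) > C / s}"
          by (simp add: s_def abs_of_nonneg[OF error_rate_nonneg])
        also have "measure (\<Omega> n) \<dots> \<le> measure (\<Omega> n) {\<omega>\<in>space (\<Omega> n).
            \<not> good_data n Bstar Bhat (C1 / s) (A n \<omega>) (z n \<omega>)} + (C1 / s) / (C / s)"
          using est n' C C1 s Xhat_solution[OF n'(1)]
          by (intro randomized_error_tail[OF model[OF n'(1)] _ _ Bhat_Q Bstar_sym]) auto
        also have "\<dots> \<le> \<epsilon> / 2 + \<epsilon> / 2"
          using N[OF n] True C s by (intro add_mono) (auto simp: s_def)
        finally show ?thesis by simp
      qed
      then show "\<exists>C N. \<forall>n\<ge>N. measure (\<Omega> n) {\<omega>\<in>space (\<Omega> n).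
          \<bar>error_rate n (theta_hat n (A n \<omega>) Bhat) (z n \<omega>) (Ptilde n \<omega>)\<bar> > C * (1 / sqrt (real n * \<alpha> n))} \<le> \<epsilon>"
        by blast
    qed
  }
qed

end
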